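(* Let $\mathcal{M}=(S,Act,\bar{s},\mathbf{P})$ be an MDP, let $\varphi_1,\dots,\varphi_k$ be Rabin properties on $\mathcal{M}$ with pair sets $P_1,\dots,P_k\subseteq 2^S\times 2^S$, let $\lambda_1,\dots,\lambda_k\in[0,1]$ and $\triangleright\in\{\geq,>\}$. Let $\Psi=\exists\mathfrak{S}.\bigwedge_{i=1}^k\mathbb{P}_{\triangleright\lambda_i}(\varphi_i)$ and $\Phi=\forall\mathfrak{S}.\bigvee_{i=1}^k\mathbb{P}_{\triangleright\lambda_i}(\bar{\varphi}_i)$, where $\bar\varphi_i$ is the complement of $\varphi_i$. Let $\mathcal{I}^*=\{(S(\mathcal{E}),I)\mid \mathcal{E}\text{ a MEC of }\mathcal{M},\ I\subseteq[k],\ \exists\text{ EC }\mathcal{E}'\subseteq\mathcal{E}\text{ with }\mathcal{E}'\models_{\mathsf{Rabin}}P_i\text{ for all }i\in I\}$, and let $\widehat{\mathcal{M}}=\mathcal{M}_{/\mathcal{D}_{\mathsf{MEC}}}^{\mathcal{I}^*}$. For $i\in[k]$ let $G_i=\{\bot_I\mid I\subseteq[k],\ i\in I\}$ and $\bar G_i=\{\bot_I\mid I\subseteq[k],\ i\notin I\}$, and let $\widehat\Psi=\exists\mathfrak{S}.\bigwedge_{i=1}^k\mathbb{P}_{\triangleright\lambda_i}(\lozenge G_i)$ and $\widehat\Phi=\forall\mathfrak{S}.\bigvee_{i=1}^k\mathbb{P}_{\triangleright\lambda_i}(\lozenge\bar G_i)$. Then (1) $\mathcal{M}\models\Psi$ if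 and only if $\widehat{\mathcal{M}}\models\widehat\Psi$, and (2) $\mathcal{M}\models\Phi$ if and only if $\widehat{\mathcal{M}}\models\widehat\Phi$.
   Context: An MDP is a tuple $\mathcal{M}=(S,Act,\bar s,\mathbf{P})$ with finite state set $S$, finite action set $Act$, initial state $\bar s$ and partial transition function $\mathbf{P}:S\times Act\to\mathrm{Dist}(S)$; write $\mathbf{P}(s,a,s')=\mathbf{P}(s,a)(s')$ and $\mathbf{P}(s,a,T)=\sum_{t\in T}\mathbf{P}(s,a,t)$. A pair $(s,a)$ is enabled if $\mathbf{P}(s,a)$ is defined; $\mathsf{En}$ denotes the set of enabled pairs, $Act(s)$ the enabled actions of $s$. Actions of distinct states are assumed pairwise disjoint. A scheduler $\mathfrak{S}$ maps finite paths to distributions over the enabled actions of the last state; $\Pr^{\mathfrak{S}}_{\mathcal{M},\bar s}$ is the induced probability measure on infinite paths from $\bar s$. An end component (EC) is a nonempty $\mathcal{E}\subseteq\mathsf{En}$ such that, with $S(\mathcal{E})=\{s\mid\exists a.(s,a)\in\mathcal{E}\}$, $\mathbf{P}(s,a,S(\mathcal{E}))=1$ for all $(s,a)\in\mathcal{E}$ and the graph on $S(\mathcal{E})$ with edges $s\to s'$ whenever $\mathbf{P}(s,a,s')>0$ for some $(s,a)\in\mathcal{E}$ is strongly connected; a MEC is an inclusion-maximal EC. $\mathcal{D}_{\mathsf{MEC}}$ is the partition of $S$ consisting of the state sets of the MECs together with singletons $\{s\}$ for states contained in no MEC. A Rabin property given by a finite set $P\subseteq 2^S\times 2^S$ is the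 set of infinite paths satisfying $\bigvee_{(F,E)\in P}(\square\lozenge F\wedge\lozenge\square E)$; its complement is a Streett property. For an EC, $\mathcal{E}\models_{\mathsf{Rabin}}P$ means there is $(F,E)\in P$ with $S(\mathcal{E})\cap F\neq\emptyset$ and $S(\mathcal{E})\subseteq E$. Semantics: $\mathcal{M}\models\exists\mathfrak{S}.\bigwedge_i\mathbb{P}_{\triangleright\lambda_i}(\psi_i)$ iff some scheduler $\mathfrak{S}$ has $\Pr^{\mathfrak{S}}_{\mathcal{M},\bar s}(\psi_i)\triangleright\lambda_i$ for all $i$; $\mathcal{M}\models\forall\mathfrak{S}.\bigvee_i\mathbb{P}_{\triangleright\lambda_i}(\psi_i)$ iff every scheduler satisfies $\Pr^{\mathfrak{S}}_{\mathcal{M},\bar s}(\psi_i)\triangleright\lambda_i$ for some $i$; $\lozenge G$ is the event of eventually visiting $G$. Quotient: for a partition $\mathcal{D}$ of $S$ let $[s]_{\mathcal{D}}$ be the class of $s$ and $\mathsf{En}_{\mathcal{D}}=\{(s,a)\in\mathsf{En}\mid\mathbf{P}(s,a,[s]_{\mathcal{D}})<1\}$. For $\mathcal{I}\subseteq\mathcal{D}\times 2^{[k]}$, the quotient MDP $\mathcal{M}_{/\mathcal{D}}^{\mathcal{I}}$ has states $\mathcal{D}\cup\{\bot_I\}_{I\subseteq[k]}$, actions $Act\cup\{\tau_I\}_{I\subseteq[k]}$, initial state $[\bar s]_{\mathcal{D}}$, transitions $\mathbf{P}'([s]_{\mathcal{D}},a,[s']_{\mathcal{D}})=\mathbf{P}(s,a,[s']_{\mathcal{D}})$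 for all $(s,a)\in\mathsf{En}_{\mathcal{D}}$, $\mathbf{P}'(D,\tau_I,\bot_I)=1$ for all $(D,I)\in\mathcal{I}$, and each $\bot_I$ absorbing; no other pairs are enabled. *)

theory Defs
  imports "HOL-Probability.Probability"
begin

section \<open>Markov decision processes\<close>

record ('s, 'a) mdp =
  states :: "'s set"
  actions :: "'a set"
  initial :: 's
  transition :: "'s \<Rightarrow> 'a \<Rightarrow> 's pmf option"

definition mdp :: "('s, 'a) mdp \<Rightarrow> bool" where
  "mdp M \<longleftrightarrow> finite (states M) \<and> finite (actions M) \<and> initial M \<in> states M \<and>
     (\<forall>s a p. transition M s a = Some p \<longrightarrow>
        s \<in> states M \<and> a \<in> actions M \<and> set_pmf p \<subseteq> states M)"

definition enabled :: "('s, 'a) mdp \<Rightarrow> ('s \<times> 'a) set" where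
  "enabled M = {(s, a) \<in> states M \<times> actions M. transition M s a \<noteq> None}"

definition disjoint_actions :: "('s, 'a) mdp \<Rightarrow> bool" where
  "disjoint_actions M \<longleftrightarrow>
     (\<forall>s t a. (s, a) \<in> enabled M \<longrightarrow> (t, a) \<in> enabled M \<longrightarrow> s = t)"

definition tprob :: "('s, 'a) mdp \<Rightarrow> 's \<Rightarrow> 'a \<Rightarrow> 's set \<Rightarrow> real" where
  "tprob M s a T =
     (case transition M s a of None \<Rightarrow> 0 | Some p \<Rightarrow> measure_pmf.prob p T)"


section \<open>Paths, schedulers and the induced measure\<close>

text \<open>
  The finite path \<open>s\<^sub>0 a\<^sub>0 s\<^sub>1 \<dots> a\<^sub>n\<^sub>-\<^sub>1 s\<^sub>n\<close> is represented by the list of pairs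
  \<open>(s\<^sub>i, a\<^sub>i)\<close>, \<open>i < n\<close>, together with its last state \<open>s\<^sub>n\<close>; an infinite path by the
  function \<open>i \<mapsto> (s\<^sub>i, a\<^sub>i)\<close>.
\<close>

inductive finite_path :: "('s, 'a) mdp \<Rightarrow> ('s \<times> 'a) list \<Rightarrow> 's \<Rightarrow> bool" for M where
  start: "s \<in> states M \<Longrightarrow> finite_path M [] s"
| step: "finite_path M h s \<Longrightarrow> (s, a) \<in> enabled M \<Longrightarrow> tprob M s a {t} > 0 \<Longrightarrow>
    finite_path M (h @ [(s, a)]) t"

definition infinite_paths :: "('s, 'a) mdp \<Rightarrow> (nat \<Rightarrow> 's \<times> 'a) set" where
  "infinite_paths M = {\<omega>. \<forall>n. \<omega> n \<in> enabled M \<and>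
     tprob M (fst (\<omega> n)) (snd (\<omega> n)) {fst (\<omega> (Suc n))} > 0}"

text \<open>
  If some state has no enabled action then there is no scheduler, because the support of a
  \<open>pmf\<close> is never empty.
\<close>

definition scheduler :: "('s, 'a) mdp \<Rightarrow> (('s \<times> 'a) list \<Rightarrow> 's \<Rightarrow> 'a pmf) \<Rightarrow> bool" where
  "scheduler M \<sigma> \<longleftrightarrow>
     (\<forall>h s. finite_path M h s \<longrightarrow> set_pmf (\<sigma> h s) \<subseteq> {a. (s, a) \<in> enabled M})"

text \<open>
  The measure induced by \<open>\<sigma>\<close> lives on the sequences over \<open>states M \<times> actions M\<close> with the
  sigma-algebra generated by the cylinder sets, and is determined by its values on cylinders.
\<close>

definition path_space :: "('s, 'a) mdp \<Rightarrow> (nat \<Rightarrow> 's \<times> 'a) measure" where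
  "path_space M = PiM UNIV (\<lambda>_. count_space (states M \<times> actions M))"

definition cylinder :: "('s, 'a) mdp \<Rightarrow> ('s \<times> 'a) list \<Rightarrow> (nat \<Rightarrow> 's \<times> 'a) set" where
  "cylinder M h = {\<omega> \<in> space (path_space M). \<forall>i < length h. \<omega> i = h ! i}"

definition cylinder_prob ::
  "('s, 'a) mdp \<Rightarrow> (('s \<times> 'a) list \<Rightarrow> 's \<Rightarrow> 'a pmf) \<Rightarrow> ('s \<times> 'a) list \<Rightarrow> real" where
  "cylinder_prob M \<sigma> h = (\<Prod>i < length h.
     (if i = 0 then (if fst (h ! 0) = initial M then 1 else 0)
      else tprob M (fst (h ! (i - 1))) (snd (h ! (i - 1))) {fst (h ! i)}) *
     pmf (\<sigma> (take i h) (fst (h ! i))) (snd (h ! i)))"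

definition is_path_measure ::
  "('s, 'a) mdp \<Rightarrow> (('s \<times> 'a) list \<Rightarrow> 's \<Rightarrow> 'a pmf) \<Rightarrow> (nat \<Rightarrow> 's \<times> 'a) measure \<Rightarrow> bool" where
  "is_path_measure M \<sigma> \<mu> \<longleftrightarrow> prob_space \<mu> \<and> sets \<mu> = sets (path_space M) \<and>
     (\<forall>h \<in> lists (states M \<times> actions M).
        Sigma_Algebra.measure \<mu> (cylinder M h) = cylinder_prob M \<sigma> h)"

text \<open>See \<open>ex1_path_measure\<close> below for existence and uniqueness.\<close>

definition path_measure ::
  "('s, 'a) mdp \<Rightarrow> (('s \<times> 'a) list \<Rightarrow> 's \<Rightarrow> 'a pmf) \<Rightarrow> (nat \<Rightarrow> 's \<times> 'a) measure" where
  "path_measure M \<sigma> = (THE \<mu>. is_path_measure M \<sigma> \<mu>)"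


section \<open>Properties and queries\<close>

definition rabin ::
  "('s, 'a) mdp \<Rightarrow> ('s set \<times> 's set) set \<Rightarrow> (nat \<Rightarrow> 's \<times> 'a) set" where
  "rabin M P = {\<omega> \<in> infinite_paths M. \<exists>(F, E) \<in> P.
     (\<forall>n. \<exists>m\<ge>n. fst (\<omega> m) \<in> F) \<and> (\<exists>n. \<forall>m\<ge>n. fst (\<omega> m) \<in> E)}"

definition streett ::
  "('s, 'a) mdp \<Rightarrow> ('s set \<times> 's set) set \<Rightarrow> (nat \<Rightarrow> 's \<times> 'a) set" where
  "streett M P = infinite_paths M - rabin M P"

definition reach :: "('s, 'a) mdp \<Rightarrow> 's set \<Rightarrow> (nat \<Rightarrow> 's \<times> 'a) set" where
  "reach M G = {\<omega> \<in> infinite_paths M. \<exists>n. fst (\<omega> n) \<in> G}"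

definition sat_exists_conj ::
  "('s, 'a) mdp \<Rightarrow> (real \<Rightarrow> real \<Rightarrow> bool) \<Rightarrow> nat \<Rightarrow> (nat \<Rightarrow> real) \<Rightarrow>
     (nat \<Rightarrow> (nat \<Rightarrow> 's \<times> 'a) set) \<Rightarrow> bool" where
  "sat_exists_conj M cmp k lam \<psi> \<longleftrightarrow>
     (\<exists>\<sigma>. scheduler M \<sigma> \<and>
        (\<forall>i \<in> {1..k}. cmp (Sigma_Algebra.measure (path_measure M \<sigma>) (\<psi> i)) (lam i)))"

definition sat_forall_disj ::
  "('s, 'a) mdp \<Rightarrow> (real \<Rightarrow> real \<Rightarrow> bool) \<Rightarrow> nat \<Rightarrow> (nat \<Rightarrow> real) \<Rightarrow>
     (nat \<Rightarrow> (nat \<Rightarrow> 's \<times> 'a) set) \<Rightarrow> bool" where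
  "sat_forall_disj M cmp k lam \<psi> \<longleftrightarrow>
     (\<forall>\<sigma>. scheduler M \<sigma> \<longrightarrow>
        (\<exists>i \<in> {1..k}. cmp (Sigma_Algebra.measure (path_measure M \<sigma>) (\<psi> i)) (lam i)))"


section \<open>End components\<close>

definition ec_edges :: "('s, 'a) mdp \<Rightarrow> ('s \<times> 'a) set \<Rightarrow> ('s \<times> 's) set" where
  "ec_edges M E =
     {(s, t). s \<in> fst ` E \<and> t \<in> fst ` E \<and> (\<exists>a. (s, a) \<in> E \<and> tprob M s a {t} > 0)}"

definition end_component :: "('s, 'a) mdp \<Rightarrow> ('s \<times> 'a) set \<Rightarrow> bool" where
  "end_component M E \<longleftrightarrow> E \<noteq> {} \<and> E \<subseteq> enabled M \<and>
     (\<forall>(s, a) \<in> E. tprob M s a (fst ` E) = 1) \<and>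
     (\<forall>s \<in> fst ` E. \<forall>t \<in> fst ` E. (s, t) \<in> (ec_edges M E)\<^sup>*)"

definition MEC :: "('s, 'a) mdp \<Rightarrow> ('s \<times> 'a) set \<Rightarrow> bool" where
  "MEC M E \<longleftrightarrow> end_component M E \<and> (\<forall>E'. end_component M E' \<longrightarrow> E \<subseteq> E' \<longrightarrow> E' = E)"

definition mec_partition :: "('s, 'a) mdp \<Rightarrow> 's set set" where
  "mec_partition M = {fst ` E | E. MEC M E} \<union>
     {{s} | s. s \<in> states M \<and> (\<forall>E. MEC M E \<longrightarrow> s \<notin> fst ` E)}"

definition ec_rabin :: "('s \<times> 'a) set \<Rightarrow> ('s set \<times> 's set) set \<Rightarrow> bool" where
  "ec_rabin E P \<longleftrightarrow> (\<exists>(F, G) \<in> P. fst ` E \<inter> F \<noteq> {} \<and> fst ` E \<subseteq> G)"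


section \<open>Quotients\<close>

datatype 's qstate = Cls "'s set" | Bot "nat set"
datatype 'a qaction = Act 'a | Tau "nat set"

definition class_of :: "'s set set \<Rightarrow> 's \<Rightarrow> 's set" where
  "class_of D s = (THE d. d \<in> D \<and> s \<in> d)"

definition quotient_enabled :: "('s, 'a) mdp \<Rightarrow> 's set set \<Rightarrow> ('s \<times> 'a) set" where
  "quotient_enabled M D = {(s, a) \<in> enabled M. tprob M s a (class_of D s) < 1}"

text \<open>
  With pairwise disjoint actions, the state \<open>s\<close> described by \<open>THE\<close> in the first equation is
  determined by \<open>a\<close> alone. The sink \<open>Bot I\<close> is made absorbing by a self-loop under \<open>Tau I\<close>.
\<close>

fun quotient_transition ::
  "('s, 'a) mdp \<Rightarrow> nat \<Rightarrow> 's set set \<Rightarrow> ('s set \<times> nat set) set \<Rightarrow>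
     's qstate \<Rightarrow> 'a qaction \<Rightarrow> 's qstate pmf option" where
  "quotient_transition M k D \<I> (Cls d) (Act a) =
     (if \<exists>s. (s, a) \<in> quotient_enabled M D \<and> class_of D s = d
      then map_option (map_pmf (\<lambda>t. Cls (class_of D t)))
        (transition M (THE s. (s, a) \<in> quotient_enabled M D \<and> class_of D s = d) a)
      else None)"
| "quotient_transition M k D \<I> (Cls d) (Tau I) =
     (if (d, I) \<in> \<I> then Some (return_pmf (Bot I)) else None)"
| "quotient_transition M k D \<I> (Bot I) (Tau J) =
     (if I = J \<and> I \<subseteq> {1..k} then Some (return_pmf (Bot I)) else None)"
| "quotient_transition M k D \<I> (Bot I) (Act a) = None"

text \<open>Intended for a partition \<open>D\<close> of \<open>states M\<close> and \<open>\<I> \<subseteq> D \<times> Pow {1..k}\<close>.\<close>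

definition quotient ::
  "('s, 'a) mdp \<Rightarrow> nat \<Rightarrow> 's set set \<Rightarrow> ('s set \<times> nat set) set \<Rightarrow>
     ('s qstate, 'a qaction) mdp" where
  "quotient M k D \<I> =
     \<lparr> states = Cls ` D \<union> Bot ` Pow {1..k},
       actions = Act ` actions M \<union> Tau ` Pow {1..k},
       initial = Cls (class_of D (initial M)),
       transition = quotient_transition M k D \<I> \<rparr>"

definition achievable ::
  "('s, 'a) mdp \<Rightarrow> nat \<Rightarrow> (nat \<Rightarrow> ('s set \<times> 's set) set) \<Rightarrow> ('s set \<times> nat set) set" where
  "achievable M k P = {(fst ` E, I) | E I. MEC M E \<and> I \<subseteq> {1..k} \<and>
     (\<exists>E'. end_component M E' \<and> E' \<subseteq> E \<and> (\<forall>i \<in> I. ec_rabin E' (P i)))}"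

definition mec_quotient ::
  "('s, 'a) mdp \<Rightarrow> nat \<Rightarrow> (nat \<Rightarrow> ('s set \<times> 's set) set) \<Rightarrow> ('s qstate, 'a qaction) mdp" where
  "mec_quotient M k P = quotient M k (mec_partition M) (achievable M k P)"


section \<open>Well-definedness\<close>

subsection \<open>The MEC partition and the quotient\<close>

lemma tprob_pos_mem:
  assumes "tprob M s a T = 1" "tprob M s a {t} > 0"
  shows "t \<in> T"
proof -
  obtain p where p: "transition M s a = Some p"
    using assms(1) by (cases "transition M s a") (auto simp: tprob_def)
  have "AE x in measure_pmf p. x \<in> T"
    using assms(1) p by (simp add: tprob_def measure_pmf.prob_eq_1)
  moreover have "t \<in> set_pmf p"
    using assms(2) p by (simp add: tprob_def set_pmf_iff measure_pmf_single)
  ultimately show ?thesis by (auto simp: AE_measure_pmf_iff)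
qed

lemma end_component_Un:
  assumes 1: "end_component M E1" and 2: "end_component M E2"
    and s: "s \<in> fst ` E1" "s \<in> fst ` E2"
  shows "end_component M (E1 \<union> E2)"
proof -
  have sub: "(ec_edges M E1)\<^sup>* \<subseteq> (ec_edges M (E1 \<union> E2))\<^sup>*"
    "(ec_edges M E2)\<^sup>* \<subseteq> (ec_edges M (E1 \<union> E2))\<^sup>*"
    by (rule rtrancl_mono; auto simp: ec_edges_def)+
  have to: "(t, s) \<in> (ec_edges M (E1 \<union> E2))\<^sup>*" and out: "(s, t) \<in> (ec_edges M (E1 \<union> E2))\<^sup>*"
    if "t \<in> fst ` (E1 \<union> E2)" for t
    using that 1 2 s sub unfolding end_component_def image_Un by blast+
  have one: "tprob M t a (fst ` (E1 \<union> E2)) = 1"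
    if E: "tprob M t a (fst ` E) = 1" "E \<subseteq> E1 \<union> E2" for t a E
  proof -
    obtain p where p: "transition M t a = Some p"
      using E(1) by (cases "transition M t a") (auto simp: tprob_def)
    have "measure_pmf.prob p (fst ` E) \<le> measure_pmf.prob p (fst ` (E1 \<union> E2))"
      using E(2) by (intro measure_pmf.finite_measure_mono) auto
    then show ?thesis
      using E(1) p by (simp add: tprob_def antisym)
  qed
  have A: "E1 \<union> E2 \<noteq> {}" "E1 \<union> E2 \<subseteq> enabled M"
    using 1 2 by (auto simp: end_component_def)
  have B: "\<forall>(t, a) \<in> E1 \<union> E2. tprob M t a (fst ` (E1 \<union> E2)) = 1"
    using 1 2 one[of _ _ E1] one[of _ _ E2] unfolding end_component_def by blast
  have C: "\<forall>t \<in> fst ` (E1 \<union> E2). \<forall>u \<in> fst ` (E1 \<union> E2). (t, u) \<in> (ec_edges M (E1 \<union> E2))\<^sup>*"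
    using to out by (meson rtrancl_trans)
  from A B C show ?thesis
    unfolding end_component_def by blast
qed

lemma MEC_eq:
  assumes "MEC M E1" "MEC M E2" "s \<in> fst ` E1" "s \<in> fst ` E2"
  shows "E1 = E2"
proof -
  have "end_component M (E1 \<union> E2)"
    using assms end_component_Un[of M E1 E2 s] by (simp add: MEC_def)
  then have "E1 \<union> E2 = E1" "E1 \<union> E2 = E2"
    using assms(1,2) unfolding MEC_def by (metis sup_ge1, metis sup_ge2)
  then show ?thesis by simp
qed

lemma partition_on_mec_partition: "partition_on (states M) (mec_partition M)"
proof (rule partition_onI)
  have "fst ` E \<subseteq> states M" if "MEC M E" for E
    using that by (auto simp: MEC_def end_component_def enabled_def)
  then show "\<Union> (mec_partition M) = states M"
    unfolding mec_partition_def by blast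
  show "{} \<notin> mec_partition M"
    by (auto simp: mec_partition_def MEC_def end_component_def)
  have same: "p = q" if p: "p \<in> mec_partition M" "s \<in> p" and q: "q \<in> mec_partition M" "s \<in> q" for p q s
  proof (cases "\<exists>E. MEC M E \<and> s \<in> fst ` E")
    case True
    then obtain E where E: "MEC M E" "s \<in> fst ` E" by blast
    have "r = fst ` E" if "r \<in> mec_partition M" "s \<in> r" for r
    proof -
      from that E obtain E' where E': "MEC M E'" "r = fst ` E'"
        unfolding mec_partition_def by blast
      with E that(2) show ?thesis
        using MEC_eq[of M E' E s] by simp
    qed
    with p q show ?thesis by blast
  next
    case False
    then have "r = {s}" if "r \<in> mec_partition M" "s \<in> r" for r
      using that unfolding mec_partition_def by blast
    with p q show ?thesis by blast
  qed
  show "disjnt p q" if "p \<in> mec_partition M" "q \<in> mec_partition M" "p \<noteq> q" for p q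
    using same[of p _ q] that by (auto simp: disjnt_iff)
qed

lemma class_of:
  assumes "partition_on S D" "s \<in> S"
  shows "class_of D s \<in> D" "s \<in> class_of D s"
proof -
  have "\<exists>d. d \<in> D \<and> s \<in> d"
    using assms by (auto simp: partition_on_def)
  moreover have "d = e" if "d \<in> D" "s \<in> d" "e \<in> D" "s \<in> e" for d e
    using assms(1) that disjointD[of D d e] by (auto simp: partition_on_def)
  ultimately have "\<exists>!d. d \<in> D \<and> s \<in> d" by metis
  from theI'[OF this] show "class_of D s \<in> D" "s \<in> class_of D s"
    by (auto simp: class_of_def)
qed

lemma mdp_quotient:
  assumes M: "mdp M" and D: "partition_on (states M) D" and I: "\<I> \<subseteq> D \<times> Pow {1..k}"
  shows "mdp (quotient M k D \<I>)"
proof -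
  have fin: "finite D"
    using M D finite_elements by (auto simp: mdp_def)
  have "x \<in> states (quotient M k D \<I>) \<and> b \<in> actions (quotient M k D \<I>) \<and>
      set_pmf p \<subseteq> states (quotient M k D \<I>)"
    if tr: "transition (quotient M k D \<I>) x b = Some p" for x b p
  proof (cases x)
    case (Cls d)
    show ?thesis
    proof (cases b)
      case (Act a)
      let ?s = "THE s. (s, a) \<in> quotient_enabled M D \<and> class_of D s = d"
      have ex: "\<exists>s. (s, a) \<in> quotient_enabled M D \<and> class_of D s = d"
        using tr Cls Act by (auto simp: quotient_def split: if_splits)
      then obtain q where q: "transition M ?s a = Some q" "p = map_pmf (\<lambda>t. Cls (class_of D t)) q"
        using tr Cls Act by (auto simp: quotient_def)
      have "set_pmf q \<subseteq> states M"
        using M q(1) unfolding mdp_def by blast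
      then have "set_pmf p \<subseteq> Cls ` D"
        using class_of(1)[OF D] q(2) by auto
      moreover have "d \<in> D" "a \<in> actions M"
        using ex class_of(1)[OF D] by (auto simp: quotient_enabled_def enabled_def)
      ultimately show ?thesis
        using Cls Act by (auto simp: quotient_def)
    next
      case (Tau J)
      then have "(d, J) \<in> \<I>" "p = return_pmf (Bot J)"
        using tr Cls by (simp_all add: quotient_def split: if_splits)
      moreover from this(1) I have "d \<in> D" "J \<in> Pow {1..k}" by blast+
      ultimately show ?thesis
        using Cls Tau by (simp add: quotient_def)
    qed
  next
    case (Bot J)
    then obtain "b = Tau J" "J \<subseteq> {1..k}" "p = return_pmf (Bot J)"
      using tr by (cases b) (simp_all add: quotient_def split: if_splits)
    then show ?thesis
      using Bot by (simp add: quotient_def)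
  qed
  moreover have "initial (quotient M k D \<I>) \<in> states (quotient M k D \<I>)"
    using M class_of(1)[OF D] by (auto simp: quotient_def mdp_def)
  ultimately show ?thesis
    using fin M by (auto simp: mdp_def quotient_def)
qed

lemma mdp_mec_quotient: "mdp M \<Longrightarrow> mdp (mec_quotient M k P)"
  unfolding mec_quotient_def
  by (rule mdp_quotient[OF _ partition_on_mec_partition])
    (auto simp: achievable_def mec_partition_def)


subsection \<open>The path measure\<close>

lemma cylinder_prob_Nil: "cylinder_prob M \<sigma> [] = 1"
  by (simp add: cylinder_prob_def)

lemma cylinder_prob_snoc:
  "cylinder_prob M \<sigma> (h @ [(s, a)]) = cylinder_prob M \<sigma> h *
     ((if h = [] then (if s = initial M then 1 else 0)
       else tprob M (fst (last h)) (snd (last h)) {s}) * pmf (\<sigma> h s) a)"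
proof -
  have "(h @ [(s, a)]) ! (length h - Suc 0) = last h" if "h \<noteq> []"
    using that by (simp add: nth_append last_conv_nth)
  moreover have "cylinder_prob M \<sigma> h = (\<Prod>i < length h.
     (if i = 0 then (if fst ((h @ [(s, a)]) ! 0) = initial M then 1 else 0)
      else tprob M (fst ((h @ [(s, a)]) ! (i - 1))) (snd ((h @ [(s, a)]) ! (i - 1)))
             {fst ((h @ [(s, a)]) ! i)}) *
     pmf (\<sigma> (take i (h @ [(s, a)])) (fst ((h @ [(s, a)]) ! i))) (snd ((h @ [(s, a)]) ! i)))"
    unfolding cylinder_prob_def by (rule prod.cong) (auto simp: nth_append)
  ultimately show ?thesis
    by (simp add: cylinder_prob_def[of M \<sigma> "h @ [(s, a)]"])
qed

lemma cylinder_prob_nonneg: "cylinder_prob M \<sigma> h \<ge> 0"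
  unfolding cylinder_prob_def by (intro prod_nonneg) (auto simp: tprob_def split: option.split)

lemma cylinder_prob_path:
  assumes "mdp M" "scheduler M \<sigma>" "cylinder_prob M \<sigma> h \<noteq> 0"
  shows "(h = [] \<longrightarrow> finite_path M h (initial M)) \<and>
    (h \<noteq> [] \<longrightarrow> last h \<in> enabled M \<and>
       (\<forall>t. tprob M (fst (last h)) (snd (last h)) {t} > 0 \<longrightarrow> finite_path M h t))"
  using assms(3)
proof (induction h rule: rev_induct)
  case Nil
  then show ?case using assms(1) by (auto simp: mdp_def intro: finite_path.start)
next
  case (snoc x h)
  obtain s a where x: "x = (s, a)" by (cases x)
  have nz: "cylinder_prob M \<sigma> h \<noteq> 0" "pmf (\<sigma> h s) a \<noteq> 0"
    "h = [] \<longrightarrow> s = initial M" "h \<noteq> [] \<longrightarrow> tprob M (fst (last h)) (snd (last h)) {s} \<noteq> 0"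
    using snoc.prems unfolding x cylinder_prob_snoc by (auto split: if_splits)
  have "tprob M (fst (last h)) (snd (last h)) {s} \<ge> 0"
    by (simp add: tprob_def split: option.split)
  then have path: "finite_path M h s"
    using snoc.IH[OF nz(1)] nz(3,4) by (cases "h = []") auto
  then have "(s, a) \<in> enabled M"
    using assms(2) nz(2) unfolding scheduler_def set_pmf_eq by blast
  then show ?case
    using path by (auto simp: x intro: finite_path.step)
qed

text \<open>The distribution of the next state-action pair; arbitrary after a history of probability 0.\<close>

definition next_pmf ::
  "('s, 'a) mdp \<Rightarrow> (('s \<times> 'a) list \<Rightarrow> 's \<Rightarrow> 'a pmf) \<Rightarrow> ('s \<times> 'a) list \<Rightarrow> ('s \<times> 'a) pmf" where
  "next_pmf M \<sigma> h =
     (if cylinder_prob M \<sigma> h = 0 then return_pmf (SOME x. x \<in> states M \<times> actions M)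
      else bind_pmf
        (if h = [] then return_pmf (initial M)
         else the (transition M (fst (last h)) (snd (last h))))
        (\<lambda>s. map_pmf (Pair s) (\<sigma> h s)))"

lemma pmf_bind_Pair:
  "pmf (bind_pmf p (\<lambda>s. map_pmf (Pair s) (f s))) (s, a) = pmf p s * pmf (f s) a"
proof -
  have "pmf (map_pmf (Pair x) (f x)) (s, a) = indicator {s} x * pmf (f s) a" for x
  proof (cases "x = s")
    case True
    have "pmf (map_pmf (Pair s) (f s)) (s, a) = pmf (f s) a"
      by (rule pmf_map_inj') (simp add: inj_on_def)
    then show ?thesis using True by simp
  next
    case False
    then show ?thesis by (auto intro!: pmf_map_outside)
  qed
  then have "pmf (bind_pmf p (\<lambda>s. map_pmf (Pair s) (f s))) (s, a) =
      (\<integral>x. indicator {s} x * pmf (f s) a \<partial>measure_pmf p)"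
    by (simp add: pmf_bind)
  also have "\<dots> = pmf p s * pmf (f s) a"
    by (simp add: measure_pmf_single)
  finally show ?thesis .
qed

lemma next_pmf:
  assumes M: "mdp M" and \<sigma>: "scheduler M \<sigma>"
  shows "set_pmf (next_pmf M \<sigma> h) \<subseteq> states M \<times> actions M"
    and "cylinder_prob M \<sigma> (h @ [x]) = cylinder_prob M \<sigma> h * pmf (next_pmf M \<sigma> h) x"
proof -
  obtain s a where x: "x = (s, a)" by (cases x)
  show eq: "cylinder_prob M \<sigma> (h @ [x]) = cylinder_prob M \<sigma> h * pmf (next_pmf M \<sigma> h) x"
  proof (cases "cylinder_prob M \<sigma> h = 0")
    case False
    have "transition M (fst (last h)) (snd (last h)) \<noteq> None" if "h \<noteq> []"
      using cylinder_prob_path[OF M \<sigma> False] that by (auto simp: enabled_def split: prod.splits)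
    then show ?thesis
      using False unfolding x cylinder_prob_snoc next_pmf_def
      by (auto simp: pmf_bind_Pair tprob_def measure_pmf_single)
  qed (simp add: x cylinder_prob_snoc)
  have "y \<in> states M \<times> actions M" if y: "y \<in> set_pmf (next_pmf M \<sigma> h)" for y
  proof (cases "cylinder_prob M \<sigma> h = 0")
    case True
    have "finite_path M [] (initial M)"
      using M by (auto simp: mdp_def intro: finite_path.start)
    then have "set_pmf (\<sigma> [] (initial M)) \<subseteq> {a. (initial M, a) \<in> enabled M}"
      using \<sigma> unfolding scheduler_def by blast
    then have "enabled M \<noteq> {}"
      using set_pmf_not_empty[of "\<sigma> [] (initial M)"] by blast
    then have "\<exists>x. x \<in> states M \<times> actions M"
      by (auto simp: enabled_def)
    then have "(SOME x. x \<in> states M \<times> actions M) \<in> states M \<times> actions M"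
      by (rule someI_ex)
    then show ?thesis
      using y True by (simp add: next_pmf_def)
  next
    case False
    obtain s a where ysa: "y = (s, a)" by (cases y)
    let ?p = "if h = [] then return_pmf (initial M)
         else the (transition M (fst (last h)) (snd (last h)))"
    from y False have s: "s \<in> set_pmf ?p" and a: "a \<in> set_pmf (\<sigma> h s)"
      by (auto simp: next_pmf_def ysa split: if_splits)
    have "finite_path M h s"
    proof (cases "h = []")
      case True
      then show ?thesis
        using s cylinder_prob_path[OF M \<sigma> False] by simp
    next
      case ne: False
      then have "transition M (fst (last h)) (snd (last h)) \<noteq> None"
        using cylinder_prob_path[OF M \<sigma> False] by (auto simp: enabled_def split: prod.splits)
      then have "tprob M (fst (last h)) (snd (last h)) {s} > 0"
        using s ne by (auto simp: tprob_def measure_pmf_single pmf_positive)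
      then show ?thesis
        using cylinder_prob_path[OF M \<sigma> False] ne by simp
    qed
    then have "(s, a) \<in> enabled M"
      using a \<sigma> unfolding scheduler_def by blast
    then show ?thesis
      by (auto simp: ysa enabled_def)
  qed
  then show "set_pmf (next_pmf M \<sigma> h) \<subseteq> states M \<times> actions M" by blast
qed

lemma cylinder_eq_prod_emb:
  assumes "h \<in> lists (states M \<times> actions M)"
  shows "cylinder M h = prod_emb UNIV (\<lambda>_. count_space (states M \<times> actions M)) {0..<length h}
     {restrict ((!) h) {0..<length h}}"
  unfolding cylinder_def path_space_def prod_emb_def space_PiM
  by (auto simp: restrict_def fun_eq_iff) metis

lemma PiM_finite_count_space:
  assumes "finite C" "finite J"
  shows "PiM J (\<lambda>_. count_space C) = count_space (PiE J (\<lambda>_. C))"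
  using assms by (intro count_space_PiM_finite) (auto intro: countable_finite)

lemma ex_path_measure:
  assumes M: "mdp M" and \<sigma>: "scheduler M \<sigma>"
  shows "\<exists>\<mu>. is_path_measure M \<sigma> \<mu>"
proof -
  define C where "C = states M \<times> actions M"
  define K where "K = (\<lambda>n \<omega>. restrict_space (measure_pmf (next_pmf M \<sigma> (map \<omega> [0..<n]))) C)"
  have fin: "finite C"
    using M by (auto simp: mdp_def C_def)
  have set: "set_pmf (next_pmf M \<sigma> h) \<subseteq> C" for h
    using next_pmf(1)[OF M \<sigma>] by (simp add: C_def)
  have sets_K: "sets (K n \<omega>) = Pow C" for n \<omega>
    by (auto simp: K_def sets_restrict_space)
  have space_K: "space (K n \<omega>) = C" for n \<omega>
    by (simp add: K_def space_restrict_space)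
  have em_K: "emeasure (K n \<omega>) A = emeasure (measure_pmf (next_pmf M \<sigma> (map \<omega> [0..<n]))) A"
    if "A \<subseteq> C" for n \<omega> A
    using that by (simp add: K_def emeasure_restrict_space)
  have prob_K: "prob_space (K n \<omega>)" for n \<omega>
  proof
    have "AE x in measure_pmf (next_pmf M \<sigma> (map \<omega> [0..<n])). x \<in> C"
      using set by (auto simp: AE_measure_pmf_iff)
    then show "emeasure (K n \<omega>) (space (K n \<omega>)) = 1"
      by (simp add: space_K em_K measure_pmf.emeasure_eq_1_AE)
  qed
  interpret IT: Ionescu_Tulcea K "\<lambda>_. count_space C"
  proof (rule Ionescu_Tulcea.intro)
    fix n :: nat
    show "K n \<in> PiM {0..<n} (\<lambda>_. count_space C) \<rightarrow>\<^sub>M subprob_algebra (count_space C)"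
      unfolding PiM_finite_count_space[OF fin finite_atLeastLessThan]
      using prob_K sets_K
      by (auto simp: space_subprob_algebra prob_space_imp_subprob_space)
    show "prob_space (K n \<omega>)" for \<omega> by (rule prob_K)
  qed
  have C_eq: "emeasure (IT.C 0 n (\<lambda>_. undefined)) {x} = cylinder_prob M \<sigma> (map x [0..<n])"
    if "x \<in> PiE {0..<n} (\<lambda>_. C)" for n x
    using that
  proof (induction n arbitrary: x)
    case 0
    then show ?case
      by (simp add: cylinder_prob_Nil PiM_finite_count_space fin)
  next
    case (Suc n)
    let ?N = "PiM {0..<n} (\<lambda>_. count_space C)" and ?S = "PiM {0..<Suc n} (\<lambda>_. count_space C)"
    let ?x = "restrict x {0..<n}" and ?u = "\<lambda>_::nat. undefined :: 'a \<times> 'b"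
    have u: "?u \<in> space (PiM {0..<0} (\<lambda>_. count_space C))"
      by (simp add: space_PiM)
    have x: "?x \<in> PiE {0..<n} (\<lambda>_. C)" "x n \<in> C"
      using Suc.prems by (auto simp: PiE_iff)
    have mem: "{x} \<in> sets ?S"
      using Suc.prems by (simp add: PiM_finite_count_space fin)
    have ep: "emeasure (IT.eP n \<omega>) {x} =
        emeasure (measure_pmf (next_pmf M \<sigma> (map ?x [0..<n]))) {x n} * indicator {?x} \<omega>"
      if \<omega>: "\<omega> \<in> space ?N" for \<omega>
    proof -
      have \<omega>_undef: "\<omega> i = undefined" if "\<not> i < n" for i
        using \<omega> that by (simp add: space_PiM PiE_iff extensional_def)
      have x_undef: "x i = undefined" if "\<not> i < n" "i \<noteq> n" for i
        using Suc.prems that by (simp add: PiE_iff extensional_def)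
      have "fun_upd \<omega> n y = x \<longleftrightarrow> \<omega> = ?x \<and> y = x n" for y
      proof
        assume eq: "fun_upd \<omega> n y = x"
        have "\<omega> i = ?x i" for i
          using fun_cong[OF eq, of i] \<omega>_undef[of i] by (cases "i < n") simp_all
        then show "\<omega> = ?x \<and> y = x n"
          using fun_cong[OF eq, of n] by auto
      next
        assume "\<omega> = ?x \<and> y = x n"
        then show "fun_upd \<omega> n y = x"
          using x_undef by (auto simp: fun_eq_iff)
      qed
      then have "fun_upd \<omega> n -` {x} \<inter> C = (if \<omega> = ?x then {x n} else {})"
        using x(2) by auto
      then show ?thesis
        using x(2) by (simp add: IT.emeasure_eP[OF \<omega> mem] em_K)
    qed
    have "emeasure (IT.C 0 (Suc n) ?u) {x} = (\<integral>\<^sup>+ \<omega>. emeasure (IT.eP n \<omega>) {x} \<partial>IT.C 0 n ?u)"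
    proof -
      have eP: "IT.eP n \<in> IT.C 0 n ?u \<rightarrow>\<^sub>M subprob_algebra ?S"
        using IT.measurable_eP[of n] IT.sets_C[OF u, of n] by (simp cong: measurable_cong_sets)
      have "space (IT.C 0 n ?u) \<noteq> {}"
        using IT.prob_space_C[OF u, of n] by (rule prob_space.not_empty)
      from emeasure_bind[OF this eP mem] show ?thesis by simp
    qed
    also have "\<dots> = (\<integral>\<^sup>+ \<omega>. emeasure (measure_pmf (next_pmf M \<sigma> (map ?x [0..<n]))) {x n} *
        indicator {?x} \<omega> \<partial>IT.C 0 n ?u)"
      by (rule nn_integral_cong) (simp add: IT.space_C[OF u] ep)
    also have "\<dots> = emeasure (measure_pmf (next_pmf M \<sigma> (map ?x [0..<n]))) {x n} *
        emeasure (IT.C 0 n ?u) {?x}"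
      using x(1) by (intro nn_integral_cmult_indicator)
        (simp add: IT.sets_C[OF u] PiM_finite_count_space fin)
    also have "\<dots> = cylinder_prob M \<sigma> (map ?x [0..<n] @ [x n])"
      unfolding next_pmf(2)[OF M \<sigma>] Suc.IH[OF x(1)]
      by (simp add: emeasure_pmf_single ennreal_mult' cylinder_prob_nonneg mult.commute)
    also have "map ?x [0..<n] @ [x n] = map x [0..<Suc n]"
      by simp
    finally show ?case .
  qed
  have P: "prob_space IT.PF.lim"
  proof
    have "emeasure IT.PF.lim (IT.PF.emb UNIV {} {\<lambda>_. undefined}) = emeasure (IT.CI {}) {\<lambda>_. undefined}"
      by (rule IT.lim) (auto simp: PiM_empty)
    also have "\<dots> = 1"
      using prob_space.emeasure_space_1[OF IT.PF.prob_space_P[of "{}"]]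
      by (simp add: IT.PF.space_P space_PiM)
    finally show "emeasure IT.PF.lim (space IT.PF.lim) = 1"
      by (simp add: prod_emb_def space_PiM restrict_def vimage_def)
  qed
  have "Sigma_Algebra.measure IT.PF.lim (cylinder M h) = cylinder_prob M \<sigma> h" if h: "h \<in> lists C" for h
  proof -
    let ?x = "restrict ((!) h) {0..<length h}"
    let ?u = "\<lambda>_::nat. undefined :: 'a \<times> 'b"
    have x: "?x \<in> PiE {0..<length h} (\<lambda>_. C)"
      using h by (auto simp: in_lists_conv_set)
    have "emeasure IT.PF.lim (cylinder M h) = emeasure (IT.CI {0..<length h}) {?x}"
      using h x unfolding C_def
      by (subst cylinder_eq_prod_emb)
        (auto intro!: IT.lim simp: C_def[symmetric] PiM_finite_count_space fin)
    also have "\<dots> = emeasure (IT.C 0 (length h) ?u)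
        (IT.PF.emb {0..<length h} {0..<length h} {?x})"
      using x by (intro IT.emeasure_CI) (auto simp: PiM_finite_count_space fin)
    also have "IT.PF.emb {0..<length h} {0..<length h} {?x} = {?x}"
      using x by (intro prod_emb_id) simp
    also have "emeasure (IT.C 0 (length h) ?u) {?x} = cylinder_prob M \<sigma> (map ?x [0..<length h])"
      by (rule C_eq[OF x])
    also have "map ?x [0..<length h] = h"
      by (rule nth_equalityI) simp_all
    finally show ?thesis
      by (simp add: Sigma_Algebra.measure_def cylinder_prob_nonneg)
  qed
  then have "is_path_measure M \<sigma> IT.PF.lim"
    using P unfolding is_path_measure_def path_space_def C_def[symmetric] by simp
  then show ?thesis by blast
qed

lemma path_measure_unique:
  assumes M: "mdp M" and \<mu>: "is_path_measure M \<sigma> \<mu>" and \<nu>: "is_path_measure M \<sigma> \<nu>"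
  shows "\<mu> = \<nu>"
proof -
  define C where "C = states M \<times> actions M"
  have fin: "finite C"
    using M by (auto simp: mdp_def C_def)
  interpret \<mu>: prob_space \<mu> using \<mu> by (simp add: is_path_measure_def)
  interpret \<nu>: prob_space \<nu> using \<nu> by (simp add: is_path_measure_def)
  have sets: "sets \<mu> = sets (PiM UNIV (\<lambda>_. count_space C))"
    "sets \<nu> = sets (PiM UNIV (\<lambda>_. count_space C))"
    using \<mu> \<nu> by (auto simp: is_path_measure_def path_space_def C_def)
  have cyl_sets: "cylinder M h \<in> sets (PiM UNIV (\<lambda>_. count_space C))" if "h \<in> lists C" for h
    using that unfolding C_def
    by (subst cylinder_eq_prod_emb)
      (auto intro!: sets_PiM_I_finite 
        simp: C_def[symmetric] PiM_finite_count_space fin in_lists_conv_set)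
  have eq: "emeasure \<mu> (cylinder M h) = emeasure \<nu> (cylinder M h)" if "h \<in> lists C" for h
    using that \<mu> \<nu> by (simp add: is_path_measure_def C_def \<mu>.emeasure_eq_measure \<nu>.emeasure_eq_measure)
  show ?thesis
  proof (rule measure_eqI_PiM_infinite[OF sets])
    fix A :: "nat \<Rightarrow> ('a \<times> 'b) set" and J :: "nat set"
    assume J: "finite J" and A: "\<And>i. i \<in> J \<Longrightarrow> A i \<in> sets (count_space C)"
    obtain n where n: "J \<subseteq> {0..<n}"
      using J finite_nat_iff_bounded[of J] by (auto simp: atLeast0LessThan)
    define H where "H = {h. set h \<subseteq> C \<and> length h = n \<and> (\<forall>i\<in>J. h ! i \<in> A i)}"
    have H: "finite H" "H \<subseteq> lists C"
      using finite_lists_length_eq[OF fin, of n] by (auto simp: H_def elim: rev_finite_subset)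
    then have cyl_H: "cylinder M h \<in> sets (PiM UNIV (\<lambda>_. count_space C))" if "h \<in> H" for h
      using that cyl_sets by blast
    have un: "prod_emb UNIV (\<lambda>_. count_space C) J (PiE J A) = (\<Union>h\<in>H. cylinder M h)"
    proof (intro set_eqI iffI)
      fix \<omega> assume w: "\<omega> \<in> prod_emb UNIV (\<lambda>_. count_space C) J (PiE J A)"
      then have "map \<omega> [0..<n] \<in> H" "\<omega> \<in> cylinder M (map \<omega> [0..<n])"
        using n by (auto simp: H_def prod_emb_def PiE_iff cylinder_def path_space_def space_PiM C_def
            subset_eq)
      then show "\<omega> \<in> (\<Union>h\<in>H. cylinder M h)" by blast
    next
      fix \<omega> assume "\<omega> \<in> (\<Union>h\<in>H. cylinder M h)"
      then obtain h where h: "h \<in> H" "\<omega> \<in> cylinder M h" by blast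
      then have "\<omega> i \<in> A i" if "i \<in> J" for i
        using that n by (auto simp: H_def cylinder_def subset_eq)
      with h show "\<omega> \<in> prod_emb UNIV (\<lambda>_. count_space C) J (PiE J A)"
        by (auto simp: prod_emb_def cylinder_def path_space_def space_PiM C_def)
    qed
    have disj: "disjoint_family_on (cylinder M) H"
    proof -
      have "h = h'" if "h \<in> H" "h' \<in> H" "\<omega> \<in> cylinder M h" "\<omega> \<in> cylinder M h'" for h h' \<omega>
        using that by (auto simp: H_def cylinder_def list_eq_iff_nth_eq)
      then show ?thesis by (auto simp: disjoint_family_on_def)
    qed
    have "emeasure \<mu> (\<Union>h\<in>H. cylinder M h) = (\<Sum>h\<in>H. emeasure \<mu> (cylinder M h))"
      using H(1) cyl_H disj by (intro sum_emeasure[symmetric]) (auto simp: sets)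
    also have "\<dots> = (\<Sum>h\<in>H. emeasure \<nu> (cylinder M h))"
      using H(2) eq by (intro sum.cong) blast+
    also have "\<dots> = emeasure \<nu> (\<Union>h\<in>H. cylinder M h)"
      using H(1) cyl_H disj by (intro sum_emeasure) (auto simp: sets)
    finally show "emeasure \<mu> (prod_emb UNIV (\<lambda>_. count_space C) J (PiE J A)) =
        emeasure \<nu> (prod_emb UNIV (\<lambda>_. count_space C) J (PiE J A))"
      by (simp add: un)
  qed unfold_locales
qed

theorem ex1_path_measure:
  assumes "mdp M" "scheduler M \<sigma>"
  shows "\<exists>!\<mu>. is_path_measure M \<sigma> \<mu>"
  using ex_path_measure[OF assms] path_measure_unique[OF assms(1)] by blast

corollary is_path_measure_path_measure:
  assumes "mdp M" "scheduler M \<sigma>"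
  shows "is_path_measure M \<sigma> (path_measure M \<sigma>)"
  unfolding path_measure_def by (rule theI'[OF ex1_path_measure[OF assms]])

end

theory Submission
  imports Defs
begin

text \<open>
  A path of \<open>M\<close> is cut at its exits, the steps \<open>(s, a)\<close> that leave the current class with positive
  probability. Between exits the path stays in one class, so the sequence of exits is a path of the
  quotient. Almost surely the pairs visited infinitely often form an end component; it lies in a MEC,
  hence there are only finitely many exits, and the end component witnesses that the label \<open>Tau I\<close>,
  with \<open>I\<close> the set of Rabin properties satisfied by the path, is available in the final class.
  Conditioning on the sequence of exits thus turns a scheduler of \<open>M\<close> into one of the quotient with
  the same probabilities. Conversely, a scheduler of the quotient is realised with a memory for the
  label it has chosen: for \<open>Act b\<close> all actions of the MEC are played uniformly until the source of
  \<open>b\<close> is reached, for \<open>Tau I\<close> until a good end component is reached, whose actions are then played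
  uniformly forever. The memory lives in the actions of an auxiliary MDP and is removed by taking
  conditional probabilities again. In both directions the probability of the complementary
  properties is controlled too, which gives the second equivalence by duality.
\<close>

section \<open>Histories and path measures\<close>

text \<open>The quotient remembers which class was entered but not which state, and its scheduler
  must work from that alone. Two facts make this harmless. Disjointness of the actions lets an exit
  be recovered from its quotient action, so the law of the next class depends only on the last exit
  and equals the quotient transition. And the choice of the next label may be averaged over all
  histories with the same exits, since only the joint law of the exits and the final label matters.
  Both directions therefore end in one statement, \<open>prob_reach\<close>, about a sample space
  \<open>\<Omega>\<close> carrying a path \<open>W\<close> of \<open>M\<close> and a label
  \<open>J\<close>. Towards the quotient, \<open>\<Omega>\<close> is the path space of
  \<open>M\<close> and \<open>J\<close> the set of satisfied properties; on the way back,
  \<open>\<Omega>\<close> is the path space of the auxiliary MDP and \<open>J\<close> the remembered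
  label. That the quotient almost surely reaches a sink comes out of the same statement, from the
  finite number of exits in \<open>M\<close> rather than from the shape of the quotient graph. On
  the way back a path may satisfy more properties than its label promises, so only inequalities
  result; they point the right way for both queries.\<close>

definition history :: "nat \<Rightarrow> (nat \<Rightarrow> 'x) \<Rightarrow> 'x list" where
  "history n \<omega> = map \<omega> [0..<n]"

lemma length_history [simp]: "length (history n \<omega>) = n"
  by (simp add: history_def)

lemma history_0 [simp]: "history 0 \<omega> = []"
  by (simp add: history_def)

lemma history_Suc: "history (Suc n) \<omega> = history n \<omega> @ [\<omega> n]"
  by (simp add: history_def)

lemma nth_history [simp]: "i < n \<Longrightarrow> history n \<omega> ! i = \<omega> i"
  by (simp add: history_def)

lemma take_history [simp]: "i \<le> n \<Longrightarrow> take i (history n \<omega>) = history i \<omega>"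
  by (simp add: history_def take_map)

lemma last_history [simp]: "0 < n \<Longrightarrow> last (history n \<omega>) = \<omega> (n - 1)"
  by (simp add: last_conv_nth flip: length_greater_0_conv)

lemma history_eq_Nil [simp]: "history n \<omega> = [] \<longleftrightarrow> n = 0"
  by (metis length_0_conv length_history)

lemma history_eq_iff: "history n \<omega> = h \<longleftrightarrow> length h = n \<and> (\<forall>i<n. \<omega> i = h ! i)"
  by (auto simp: list_eq_iff_nth_eq)

lemma measurable_history:
  assumes "countable C"
  shows "history n \<in> PiM UNIV (\<lambda>_. count_space C) \<rightarrow>\<^sub>M count_space UNIV"
proof -
  let ?N = "PiM UNIV (\<lambda>_. count_space C)"
  have "history n \<in> ?N \<rightarrow>\<^sub>M count_space (lists C)"
  proof (subst measurable_count_space_eq_countable[OF countable_lists[OF assms]], intro conjI ballI)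
    show "history n \<in> space ?N \<rightarrow> lists C"
      by (auto simp: history_def space_PiM PiE_iff)
    fix h assume "h \<in> lists C"
    have [measurable]: "(\<lambda>\<omega>. \<omega> i) \<in> ?N \<rightarrow>\<^sub>M count_space C" for i
      by simp
    have "history n -` {h} \<inter> space ?N = {\<omega>\<in>space ?N. length h = n \<and> (\<forall>i<n. \<omega> i = h ! i)}"
      by (auto simp: history_eq_iff)
    also have "\<dots> \<in> sets ?N" by measurable
    finally show "history n -` {h} \<inter> space ?N \<in> sets ?N" .
  qed
  from measurable_compose[OF this, of "\<lambda>h. h" "count_space UNIV"] show ?thesis by simp
qed

lemma pred_count_space:
  assumes "f \<in> N \<rightarrow>\<^sub>M count_space UNIV"
  shows "Measurable.pred N (\<lambda>x. R (f x))"
  using measurable_compose[OF assms, of R "count_space UNIV"] by simp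

section \<open>The path measure of a fixed scheduler\<close>

locale scheduled =
  fixes M :: "('s, 'a) mdp" and \<sigma>
  assumes mdp_M: "mdp M" and scheduler: "scheduler M \<sigma>"
begin

abbreviation "\<mu> \<equiv> path_measure M \<sigma>"
abbreviation "C \<equiv> states M \<times> actions M"

lemma is_path_measure: "is_path_measure M \<sigma> \<mu>"
  by (rule is_path_measure_path_measure[OF mdp_M scheduler])

sublocale prob_space \<mu>
  using is_path_measure by (simp add: is_path_measure_def)

lemma finite_C: "finite C"
  using mdp_M by (auto simp: mdp_def)

lemma sets_\<mu> [measurable_cong]: "sets \<mu> = sets (PiM UNIV (\<lambda>_. count_space C))"
  using is_path_measure by (simp add: is_path_measure_def path_space_def)

lemma space_\<mu>: "space \<mu> = {\<omega>. \<forall>n. \<omega> n \<in> C}"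
  using sets_eq_imp_space_eq[OF sets_\<mu>] by (auto simp: space_PiM)

lemma history_measurable [measurable]: "history n \<in> \<mu> \<rightarrow>\<^sub>M count_space UNIV"
  using measurable_history[OF countable_finite[OF finite_C], of n]
  by (simp cong: measurable_cong_sets)

lemma pred_history [measurable]: "Measurable.pred \<mu> (\<lambda>\<omega>. R (history n \<omega>))"
  by (rule pred_count_space[OF history_measurable])

lemma coordinate_measurable [measurable]: "(\<lambda>\<omega>. \<omega> n) \<in> \<mu> \<rightarrow>\<^sub>M count_space UNIV"
  using measurable_compose[OF history_measurable[of "Suc n"], of last "count_space UNIV"] by simp

lemma pred_coordinate [measurable]: "Measurable.pred \<mu> (\<lambda>\<omega>. R (\<omega> n))"
  by (rule pred_count_space[OF coordinate_measurable])

lemma pred_coordinate2: "Measurable.pred \<mu> (\<lambda>\<omega>. R (\<omega> n) (\<omega> m))"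
proof -
  have "Measurable.pred \<mu> (\<lambda>\<omega>. (\<lambda>h. R (h ! n) (h ! m)) (history (Suc (max n m)) \<omega>))"
    by (rule pred_history)
  then show ?thesis by (simp add: less_Suc_eq_le)
qed

lemma cylinder_prob_support: "cylinder_prob M \<sigma> h \<noteq> 0 \<Longrightarrow> set h \<subseteq> enabled M"
proof (induction h rule: rev_induct)
  case (snoc x h)
  then have "cylinder_prob M \<sigma> h \<noteq> 0"
    by (metis cylinder_prob_snoc mult_zero_left surj_pair)
  then show ?case
    using snoc cylinder_prob_path[OF mdp_M scheduler snoc.prems] by auto
qed simp

lemma enabled_subset: "enabled M \<subseteq> C"
  by (auto simp: enabled_def)

text \<open>The defining equation of the path measure speaks of words over \<open>C\<close> only. On
  any other word both sides vanish, so later uses carry no side condition on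
  \<open>h\<close>.\<close>

lemma prob_history: "\<P>(\<omega> in \<mu>. history (length h) \<omega> = h) = cylinder_prob M \<sigma> h"
proof (cases "h \<in> lists C")
  case True
  have "{\<omega> \<in> space \<mu>. history (length h) \<omega> = h} = cylinder M h"
    using sets_eq_imp_space_eq[OF sets_\<mu>]
    by (auto simp: cylinder_def path_space_def history_eq_iff)
  then show ?thesis
    using is_path_measure True by (simp add: is_path_measure_def)
next
  case False
  then have "cylinder_prob M \<sigma> h = 0"
    using cylinder_prob_support[of h] enabled_subset by fastforce
  moreover have "{\<omega> \<in> space \<mu>. history (length h) \<omega> = h} = {}"
    using False by (auto simp: space_\<mu> history_eq_iff in_set_conv_nth in_lists_conv_set mem_Times_iff)
      (metis fst_conv snd_conv)+
  ultimately show ?thesis by (metis measure_empty)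
qed

lemma set_history_subset: "\<omega> \<in> space \<mu> \<Longrightarrow> set (history n \<omega>) \<subseteq> C"
  by (simp only: space_\<mu> history_def set_map) blast

text \<open>There are only countably many words over \<open>C\<close>, so removing all null
  cylinders at once still removes a null set.\<close>

lemma AE_cylinder_prob_pos: "AE \<omega> in \<mu>. \<forall>n. cylinder_prob M \<sigma> (history n \<omega>) > 0"
proof -
  let ?X = "{h \<in> lists C. cylinder_prob M \<sigma> h = 0}"
  have "AE \<omega> in \<mu>. \<forall>h\<in>?X. history (length h) \<omega> \<noteq> h"
  proof (rule AE_ball_countable')
    show "countable ?X"
      using countable_lists[OF countable_finite[OF finite_C]] by (rule countable_subset[rotated]) auto
    fix h assume "h \<in> ?X"
    then have "\<P>(\<omega> in \<mu>. history (length h) \<omega> = h) = 0"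
      by (simp add: prob_history)
    then show "AE \<omega> in \<mu>. history (length h) \<omega> \<noteq> h"
      by (subst (asm) prob_Collect_eq_0) measurable
  qed
  with AE_space show ?thesis
  proof (eventually_elim, safe)
    fix \<omega> n assume *: "\<forall>h\<in>?X. history (length h) \<omega> \<noteq> h" and "\<omega> \<in> space \<mu>"
    then have "history n \<omega> \<in> lists C"
      using set_history_subset[of \<omega> n] by (auto simp: in_lists_conv_set)
    with * have "cylinder_prob M \<sigma> (history n \<omega>) \<noteq> 0"
      by force
    then show "cylinder_prob M \<sigma> (history n \<omega>) > 0"
      using cylinder_prob_nonneg[of M \<sigma> "history n \<omega>"] by linarith
  qed
qed

end

section \<open>Recurrence\<close>

definition limit_pairs :: "(nat \<Rightarrow> 'x) \<Rightarrow> 'x set" where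
  "limit_pairs \<omega> = {x. \<exists>\<^sub>\<infinity>n. \<omega> n = x}"

lemma INFM_finite_range:
  assumes "finite A" "\<exists>\<^sub>\<infinity>n. \<omega> n \<in> A \<and> R n"
  shows "\<exists>x\<in>A. \<exists>\<^sub>\<infinity>n. \<omega> n = x \<and> R n"
proof -
  have "\<exists>\<^sub>\<infinity>n. \<exists>x\<in>A. \<omega> n = x \<and> R n"
    using assms(2) by (rule frequently_mono[rotated]) auto
  then show ?thesis
    by (simp only: INFM_finite_Bex_distrib[OF assms(1)])
qed

text \<open>Pigeonhole: were the path outside its limit pairs infinitely often, one single pair
  would account for infinitely many of these times and would thereby be a limit pair.\<close>

lemma eventually_limit_pairs:
  assumes "finite A" "\<And>n. \<omega> n \<in> A"
  shows "\<exists>n0. \<forall>n\<ge>n0. \<omega> n \<in> limit_pairs \<omega>"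
proof (rule ccontr)
  assume "\<not> ?thesis"
  then have "\<exists>\<^sub>\<infinity>n. \<omega> n \<in> A \<and> \<omega> n \<notin> limit_pairs \<omega>"
    using assms(2) by (auto simp: INFM_nat_le)
  from INFM_finite_range[OF assms(1) this]
  obtain x where x: "\<exists>\<^sub>\<infinity>n. \<omega> n = x \<and> \<omega> n \<notin> limit_pairs \<omega>" by blast
  then have "\<exists>\<^sub>\<infinity>n. \<omega> n = x" by (rule frequently_mono[rotated]) auto
  then have "x \<in> limit_pairs \<omega>" by (simp add: limit_pairs_def)
  with x show False by (auto simp: INFM_nat_le)
qed

context scheduled begin

text \<open>The one-step conditional law, written as a product so that histories of probability 0
  need no exception. An arbitrary \<open>B\<close> reduces to finitely many pairs of
  \<open>C\<close>, for which the cylinder recursion applies.\<close>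

lemma prob_next:
  "\<P>(\<omega> in \<mu>. history (length h) \<omega> = h \<and> \<omega> (length h) \<in> B) =
     cylinder_prob M \<sigma> h * measure_pmf.prob (next_pmf M \<sigma> h) B"
proof -
  have eq: "history (length h) \<omega> = h \<and> \<omega> (length h) = x \<longleftrightarrow>
      history (length (h @ [x])) \<omega> = h @ [x]" for \<omega> x
    by (simp add: history_Suc)
  have "\<P>(\<omega> in \<mu>. history (length h) \<omega> = h \<and> \<omega> (length h) \<in> B) =
      (\<Sum>x\<in>B \<inter> C. \<P>(\<omega> in \<mu>. history (length h) \<omega> = h \<and> \<omega> (length h) = x))"
  proof (rule prob_sum)
    show "AE \<omega> in \<mu>. (\<forall>x\<in>B \<inter> C. history (length h) \<omega> = h \<and> \<omega> (length h) = x \<longrightarrow>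
          history (length h) \<omega> = h \<and> \<omega> (length h) \<in> B) \<and>
        (history (length h) \<omega> = h \<and> \<omega> (length h) \<in> B \<longrightarrow>
          (\<exists>!x. x \<in> B \<inter> C \<and> history (length h) \<omega> = h \<and> \<omega> (length h) = x))"
      by (rule AE_I2) (auto simp: space_\<mu> mem_Times_iff)
    show "finite (B \<inter> C)" using finite_C by simp
  qed measurable
  also have "\<dots> = (\<Sum>x\<in>B \<inter> C. cylinder_prob M \<sigma> h * pmf (next_pmf M \<sigma> h) x)"
    unfolding eq prob_history next_pmf(2)[OF mdp_M scheduler] ..
  also have "\<dots> = cylinder_prob M \<sigma> h * measure_pmf.prob (next_pmf M \<sigma> h) (B \<inter> C)"
    using finite_C by (simp add: sum_distrib_left measure_measure_pmf_finite)
  also have "measure_pmf.prob (next_pmf M \<sigma> h) (B \<inter> C) = measure_pmf.prob (next_pmf M \<sigma> h) B"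
  proof -
    have "B \<inter> C \<inter> set_pmf (next_pmf M \<sigma> h) = B \<inter> set_pmf (next_pmf M \<sigma> h)"
      using next_pmf(1)[OF mdp_M scheduler, of h] by blast
    then show ?thesis by (metis measure_Int_set_pmf)
  qed
  finally show ?thesis .
qed

text \<open>Summing out the action removes the scheduler: the first marginal of
  \<open>next_pmf\<close> is the transition distribution itself.\<close>

lemma prob_next_state:
  "\<P>(\<omega> in \<mu>. history (length h) \<omega> = h \<and> fst (\<omega> (length h)) \<in> T) =
     cylinder_prob M \<sigma> h *
       (if h = [] then indicator T (initial M) else tprob M (fst (last h)) (snd (last h)) T)"
proof (cases "cylinder_prob M \<sigma> h = 0")
  case True
  then show ?thesis using prob_next[of h "T \<times> UNIV"] by (simp add: mem_Times_iff)
next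
  case False
  have enabled: "transition M (fst (last h)) (snd (last h)) \<noteq> None" if "h \<noteq> []"
    using cylinder_prob_path[OF mdp_M scheduler False] that by (auto simp: enabled_def split: prod.splits)
  have "map_pmf fst (next_pmf M \<sigma> h) = (if h = [] then return_pmf (initial M)
         else the (transition M (fst (last h)) (snd (last h))))" (is "_ = ?p")
    using False by (simp add: next_pmf_def map_bind_pmf map_pmf_comp bind_return_pmf')
  then have "measure_pmf.prob (next_pmf M \<sigma> h) (T \<times> UNIV) = measure_pmf.prob ?p T"
    using measure_map_pmf[of fst "next_pmf M \<sigma> h" T] by (simp add: vimage_fst)
  then show ?thesis
    using prob_next[of h "T \<times> UNIV"] enabled
    by (auto simp: mem_Times_iff tprob_def indicator_def)
qed

lemma AE_infinite_paths: "AE \<omega> in \<mu>. \<omega> \<in> infinite_paths M \<and> fst (\<omega> 0) = initial M"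
  using AE_cylinder_prob_pos
proof eventually_elim
  fix \<omega> assume pos: "\<forall>n. cylinder_prob M \<sigma> (history n \<omega>) > 0"
  have "\<omega> n \<in> enabled M" for n
    using cylinder_prob_support[of "history (Suc n) \<omega>"] pos[rule_format, of "Suc n"]
    by (simp add: history_Suc)
  moreover have "tprob M (fst (\<omega> n)) (snd (\<omega> n)) {fst (\<omega> (Suc n))} > 0" for n
  proof -
    have "tprob M (fst (\<omega> n)) (snd (\<omega> n)) {fst (\<omega> (Suc n))} \<noteq> 0"
      using pos[rule_format, of "Suc (Suc n)"] cylinder_prob_snoc[of M \<sigma> "history (Suc n) \<omega>"
          "fst (\<omega> (Suc n))" "snd (\<omega> (Suc n))"]
      by (auto simp: history_Suc[of "Suc n"])
    moreover have "tprob M (fst (\<omega> n)) (snd (\<omega> n)) {fst (\<omega> (Suc n))} \<ge> 0"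
      by (simp add: tprob_def split: option.split)
    ultimately show ?thesis by simp
  qed
  moreover have "fst (\<omega> 0) = initial M"
    using pos[rule_format, of 1] cylinder_prob_snoc[of M \<sigma> "[]" "fst (\<omega> 0)" "snd (\<omega> 0)"]
    by (auto simp: history_Suc split: if_splits)
  ultimately show "\<omega> \<in> infinite_paths M \<and> fst (\<omega> 0) = initial M"
    by (simp add: infinite_paths_def)
qed

text \<open>A conditional Borel--Cantelli lemma. With \<open>r = 1 / (1 - \<delta>)\<close>, the weight
  \<open>r ^ (number of attempts since N)\<close> of the histories without a success since \<open>N\<close> is a
  supermartingale, so \<open>j\<close> unsuccessful attempts have probability at most \<open>(1 - \<delta>) ^ j\<close>.\<close>

lemma AE_infinitely_often:
  assumes \<epsilon>: "0 < \<epsilon>"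
    and step: "\<And>h. Q h \<Longrightarrow> cylinder_prob M \<sigma> h > 0 \<Longrightarrow> \<epsilon> \<le> measure_pmf.prob (next_pmf M \<sigma> h) B"
  shows "AE \<omega> in \<mu>. (\<exists>\<^sub>\<infinity>n. Q (history n \<omega>)) \<longrightarrow> (\<exists>\<^sub>\<infinity>n. Q (history n \<omega>) \<and> \<omega> n \<in> B)"
proof -
  \<comment> \<open>The hypothesis permits \<open>\<epsilon> = 1\<close>; the cap keeps
    \<open>1 - \<delta>\<close> positive, so that its inverse \<open>r\<close> exists.\<close>
  define \<delta> where "\<delta> = min \<epsilon> (1/2)"
  have \<delta>: "0 < \<delta>" "\<delta> < 1" "\<delta> \<le> \<epsilon>"
    using \<epsilon> by (auto simp: \<delta>_def)
  define r where "r = 1 / (1 - \<delta>)"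
  have r: "r \<ge> 1" "r * (1 - \<delta>) = 1" "r > 0"
    using \<delta> by (auto simp: r_def)
  define L where "L n = {h. set h \<subseteq> C \<and> length h = n}" for n
  have fin_L: "finite (L n)" for n
    unfolding L_def using finite_lists_length_eq[OF finite_C] by simp
  have L_Suc: "(\<Sum>h\<in>L (Suc n). f h) = (\<Sum>h\<in>L n. \<Sum>x\<in>C. f (h @ [x]))" for n and f :: "('s \<times> 'a) list \<Rightarrow> real"
  proof -
    have "L (Suc n) = (\<lambda>(h, x). h @ [x]) ` (L n \<times> C)"
    proof (intro set_eqI iffI)
      fix g assume "g \<in> L (Suc n)"
      then have g: "g \<noteq> []" "set g \<subseteq> C" "length g = Suc n" by (auto simp: L_def)
      then have "g = butlast g @ [last g]" "butlast g \<in> L n" "last g \<in> C"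
        using last_in_set[of g] by (auto simp: L_def simp del: mem_Sigma_iff last_in_set dest: in_set_butlastD)
      then show "g \<in> (\<lambda>(h, x). h @ [x]) ` (L n \<times> C)"
        by (metis (no_types, lifting) SigmaI case_prod_conv image_eqI)
    qed (auto simp: L_def)
    moreover have "inj_on (\<lambda>(h, x). h @ [x]) (L n \<times> C)"
      by (auto simp: inj_on_def)
    ultimately show ?thesis
      by (simp add: sum.reindex sum.cartesian_product case_prod_unfold del: mem_Sigma_iff)
  qed
  \<comment> \<open>If the claim fails, some time \<open>N\<close> is followed by infinitely many
    attempts and no success. There are countably many \<open>N\<close>, so it is enough to exclude
    one fixed \<open>N\<close>.\<close>
  have fails: "AE \<omega> in \<mu>. \<not> ((\<forall>n\<ge>N. Q (history n \<omega>) \<longrightarrow> \<omega> n \<notin> B) \<and> (\<exists>\<^sub>\<infinity>n. Q (history n \<omega>)))" for N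
  proof -
    define good where "good h \<longleftrightarrow> (\<forall>i. N \<le> i \<and> i < length h \<longrightarrow> Q (take i h) \<longrightarrow> h ! i \<notin> B)" for h
    define c where "c h = card {i. N \<le> i \<and> i < length h \<and> Q (take i h)}" for h :: "('s \<times> 'a) list"
    define g where "g h = (if good h then r ^ c h else 0)" for h
    have good_snoc: "good (h @ [x]) \<longleftrightarrow> good h \<and> (N \<le> length h \<longrightarrow> Q h \<longrightarrow> x \<notin> B)" for h x
      by (auto simp: good_def less_Suc_eq nth_append)
    have c_snoc: "c (h @ [x]) = (if N \<le> length h \<and> Q h then Suc (c h) else c h)" for h x
    proof -
      have "{i. N \<le> i \<and> i < length (h @ [x]) \<and> Q (take i (h @ [x]))} =
          (if N \<le> length h \<and> Q h then insert (length h) {i. N \<le> i \<and> i < length h \<and> Q (take i h)}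
           else {i. N \<le> i \<and> i < length h \<and> Q (take i h)})"
        by (auto simp: less_Suc_eq)
      then show ?thesis by (simp add: c_def)
    qed
    have g0: "0 \<le> g h" for h
      using r by (simp add: g_def)
    have sum_le1: "(\<Sum>x\<in>A. pmf (next_pmf M \<sigma> h) x) \<le> 1" if "A \<subseteq> C" for h A
      using that finite_C by (subst measure_measure_pmf_finite[symmetric]) (auto intro: finite_subset)
    have step_le: "(\<Sum>x\<in>C. cylinder_prob M \<sigma> (h @ [x]) * g (h @ [x])) \<le> cylinder_prob M \<sigma> h * g h" for h
    proof (cases "cylinder_prob M \<sigma> h > 0")
      case False
      then have "cylinder_prob M \<sigma> h = 0" using cylinder_prob_nonneg[of M \<sigma> h] by simp
      then show ?thesis by (simp add: next_pmf(2)[OF mdp_M scheduler])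
    next
      case pos: True
      have "(\<Sum>x\<in>C. pmf (next_pmf M \<sigma> h) x * g (h @ [x])) \<le> g h"
      proof (cases "N \<le> length h \<and> Q h")
        case True
        \<comment> \<open>At an attempt, success sets the weight to 0 and failure multiplies it by
          \<open>r\<close>. Failure has probability at most \<open>1 - \<delta>\<close>, which
          cancels \<open>r\<close>.\<close>
        have "(\<Sum>x\<in>C. pmf (next_pmf M \<sigma> h) x * g (h @ [x])) =
            (\<Sum>x\<in>C - B. pmf (next_pmf M \<sigma> h) x * (r * g h))"
          using True finite_C by (intro sum.mono_neutral_cong_right)
            (auto simp: g_def good_snoc c_snoc)
        also have "\<dots> = (\<Sum>x\<in>C - B. pmf (next_pmf M \<sigma> h) x) * (r * g h)"
          by (simp add: sum_distrib_right)
        also have "(\<Sum>x\<in>C - B. pmf (next_pmf M \<sigma> h) x) = measure_pmf.prob (next_pmf M \<sigma> h) (C - B)"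
          using finite_C by (simp add: measure_measure_pmf_finite)
        also have "\<dots> * (r * g h) \<le> (1 - \<delta>) * (r * g h)"
        proof (rule mult_right_mono)
          have "measure_pmf.prob (next_pmf M \<sigma> h) (C - B) \<le> measure_pmf.prob (next_pmf M \<sigma> h) (- B)"
            by (rule measure_pmf.finite_measure_mono) auto
          also have "\<dots> = 1 - measure_pmf.prob (next_pmf M \<sigma> h) B"
            using measure_pmf.prob_compl[of B "next_pmf M \<sigma> h"] by (simp add: Compl_eq_Diff_UNIV)
          also have "\<dots> \<le> 1 - \<delta>" using step[of h] True pos \<delta> by simp
          finally show "measure_pmf.prob (next_pmf M \<sigma> h) (C - B) \<le> 1 - \<delta>" .
          show "0 \<le> r * g h" using r g0[of h] by simp
        qed
        also have "\<dots> = (r * (1 - \<delta>)) * g h" by (simp only: mult_ac)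
        also have "\<dots> = g h" by (simp only: r(2) mult_1)
        finally show ?thesis .
      next
        case False
        then have "(\<Sum>x\<in>C. pmf (next_pmf M \<sigma> h) x * g (h @ [x])) = (\<Sum>x\<in>C. pmf (next_pmf M \<sigma> h) x) * g h"
          unfolding sum_distrib_right by (intro sum.cong) (auto simp: g_def good_snoc c_snoc)
        also have "\<dots> \<le> 1 * g h"
          using sum_le1[of C h] g0[of h] by (intro mult_right_mono) auto
        finally show ?thesis by simp
      qed
      then have "cylinder_prob M \<sigma> h * (\<Sum>x\<in>C. pmf (next_pmf M \<sigma> h) x * g (h @ [x])) \<le> cylinder_prob M \<sigma> h * g h"
        using pos by simp
      then show ?thesis
        by (simp add: next_pmf(2)[OF mdp_M scheduler] sum_distrib_left mult.assoc)
    qed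
    have V: "(\<Sum>h\<in>L n. cylinder_prob M \<sigma> h * g h) \<le> 1" for n
    proof (induction n)
      case 0
      have "L 0 = {[]}" by (auto simp: L_def)
      then show ?case by (simp add: cylinder_prob_Nil g_def good_def c_def)
    next
      case (Suc n)
      have "(\<Sum>h\<in>L (Suc n). cylinder_prob M \<sigma> h * g h) \<le> (\<Sum>h\<in>L n. cylinder_prob M \<sigma> h * g h)"
        unfolding L_Suc by (intro sum_mono step_le)
      with Suc show ?case by simp
    qed
    have bound: "\<P>(\<omega> in \<mu>. good (history n \<omega>) \<and> j \<le> c (history n \<omega>)) \<le> (1 - \<delta>) ^ j" for n j
    proof -
      let ?S = "{h \<in> L n. good h \<and> j \<le> c h}"
      have "\<P>(\<omega> in \<mu>. good (history n \<omega>) \<and> j \<le> c (history n \<omega>)) =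
          (\<Sum>h\<in>?S. \<P>(\<omega> in \<mu>. history n \<omega> = h))"
      proof (rule prob_sum)
        have "history n \<omega> \<in> L n" if "\<omega> \<in> space \<mu>" for \<omega>
          using set_history_subset[OF that] by (simp add: L_def)
        then show "AE \<omega> in \<mu>. (\<forall>h\<in>?S. history n \<omega> = h \<longrightarrow> good (history n \<omega>) \<and> j \<le> c (history n \<omega>)) \<and>
            (good (history n \<omega>) \<and> j \<le> c (history n \<omega>) \<longrightarrow> (\<exists>!h. h \<in> ?S \<and> history n \<omega> = h))"
          by (intro AE_I2) auto
      qed (use fin_L in \<open>auto intro: pred_history[unfolded pred_def]\<close>)
      also have "\<dots> = (\<Sum>h\<in>?S. cylinder_prob M \<sigma> h)"
        by (intro sum.cong) (auto simp: L_def simp flip: prob_history)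
      \<comment> \<open>Markov's inequality: on \<open>?S\<close> the weight is at least
        \<open>r ^ j\<close>, the inverse of \<open>(1 - \<delta>) ^ j\<close>.\<close>
      also have "\<dots> \<le> (\<Sum>h\<in>?S. (1 - \<delta>) ^ j * (cylinder_prob M \<sigma> h * g h))"
      proof (rule sum_mono)
        fix h assume h: "h \<in> ?S"
        have "(1 - \<delta>) ^ j * r ^ j = 1"
          using r(2) by (simp add: mult.commute flip: power_mult_distrib)
        moreover have "(1 - \<delta>) ^ j * r ^ j \<le> (1 - \<delta>) ^ j * r ^ c h"
          using h r \<delta> by (intro mult_left_mono power_increasing) auto
        ultimately have "1 \<le> (1 - \<delta>) ^ j * g h"
          using h by (simp add: g_def)
        from mult_left_mono[OF this cylinder_prob_nonneg[of M \<sigma> h]]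
        show "cylinder_prob M \<sigma> h \<le> (1 - \<delta>) ^ j * (cylinder_prob M \<sigma> h * g h)"
          by (simp add: mult_ac)
      qed
      also have "\<dots> \<le> (\<Sum>h\<in>L n. (1 - \<delta>) ^ j * (cylinder_prob M \<sigma> h * g h))"
        using fin_L cylinder_prob_nonneg[of M \<sigma>] g0 \<delta> by (intro sum_mono2) auto
      also have "\<dots> \<le> (1 - \<delta>) ^ j * 1"
        unfolding sum_distrib_left[symmetric] using V[of n] \<delta> by (intro mult_left_mono) auto
      finally show ?thesis by simp
    qed
    define D where "D = {\<omega>\<in>space \<mu>. (\<forall>n. good (history n \<omega>)) \<and> (\<exists>\<^sub>\<infinity>n. Q (history n \<omega>))}"
    have [measurable]: "D \<in> sets \<mu>"
      unfolding D_def INFM_nat_le by measurable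
    have D_le: "prob D \<le> (1 - \<delta>) ^ j" for j
    proof -
      \<comment> \<open>These events increase to \<open>D\<close>, since infinitely many attempts
        push the counter past every \<open>j\<close>. The bound at finite times passes to the
        limit.\<close>
      let ?A = "\<lambda>n. {\<omega>\<in>D. j \<le> c (history n \<omega>)}"
      have A_meas: "?A n \<in> sets \<mu>" for n
      proof -
        have "?A n = D \<inter> {\<omega>\<in>space \<mu>. j \<le> c (history n \<omega>)}"
          by (auto simp: D_def)
        also have "\<dots> \<in> sets \<mu>"
          using pred_history[of "\<lambda>h. j \<le> c h" n, unfolded pred_def] by auto
        finally show ?thesis .
      qed
      have c_Suc: "c (history (Suc n) \<omega>) = (if N \<le> n \<and> Q (history n \<omega>) then Suc (c (history n \<omega>)) else c (history n \<omega>))" for n \<omega>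
        by (simp add: history_Suc c_snoc)
      have c_mono: "c (history n \<omega>) \<le> c (history m \<omega>)" if "n \<le> m" for n m \<omega>
        using that by (induction m rule: dec_induct) (auto simp: c_Suc)
      have "incseq ?A"
      proof (intro incseq_SucI subsetI)
        fix n \<omega> assume "\<omega> \<in> ?A n"
        then show "\<omega> \<in> ?A (Suc n)"
          using c_mono[of n "Suc n" \<omega>] by (auto simp del: upt_Suc)
      qed
      then have "(\<lambda>n. prob (?A n)) \<longlonglongrightarrow> prob (\<Union>n. ?A n)"
        by (rule finite_Lim_measure_incseq[rotated]) (use A_meas in blast)
      moreover have "(\<Union>n. ?A n) = D"
      proof -
        have "\<exists>n. j \<le> c (history n \<omega>)" if \<omega>: "\<omega> \<in> D" for \<omega>
        proof (induction j)
          case (Suc j)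
          then obtain n where n: "j \<le> c (history n \<omega>)" by blast
          obtain m where m: "m \<ge> max n N" "Q (history m \<omega>)"
            using \<omega> unfolding D_def INFM_nat_le by blast
          then have "Suc j \<le> c (history (Suc m) \<omega>)"
            using n c_mono[of n m \<omega>] by (simp add: c_Suc)
          then show ?case ..
        qed simp
        then show ?thesis by auto
      qed
      moreover have "prob (?A n) \<le> (1 - \<delta>) ^ j" for n
      proof -
        have "prob (?A n) \<le> \<P>(\<omega> in \<mu>. good (history n \<omega>) \<and> j \<le> c (history n \<omega>))"
          using pred_history[of "\<lambda>h. good h \<and> j \<le> c h" n, unfolded pred_def]
          by (intro finite_measure_mono) (auto simp: D_def)
        with bound[of n j] show ?thesis by simp
      qed
      ultimately show ?thesis
        by (auto intro: LIMSEQ_le_const2)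
    qed
    have "prob D \<le> 0"
    proof (rule LIMSEQ_le_const[of "\<lambda>j. (1 - \<delta>) ^ j"])
      show "(\<lambda>j. (1 - \<delta>) ^ j) \<longlonglongrightarrow> 0"
        using \<delta> by (intro LIMSEQ_realpow_zero) auto
    qed (use D_le in auto)
    then have "D \<in> null_sets \<mu>"
      by (auto simp: null_sets_def emeasure_eq_measure measure_le_0_iff)
    then show ?thesis
      by (rule AE_I') (auto simp: D_def good_def)
  qed
  then have "AE \<omega> in \<mu>. \<forall>N. \<not> ((\<forall>n\<ge>N. Q (history n \<omega>) \<longrightarrow> \<omega> n \<notin> B) \<and> (\<exists>\<^sub>\<infinity>n. Q (history n \<omega>)))"
    unfolding AE_all_countable using fails by blast
  then show ?thesis
    by eventually_elim (auto simp: INFM_nat_le)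
qed

end

section \<open>End components and the MEC quotient\<close>

lemma infinite_path_step:
  assumes "\<omega> \<in> infinite_paths M"
  shows "\<omega> n \<in> enabled M" "tprob M (fst (\<omega> n)) (snd (\<omega> n)) {fst (\<omega> (Suc n))} > 0"
  using assms by (auto simp: infinite_paths_def)

lemma tprob_nonneg: "0 \<le> tprob M s a T"
  by (simp add: tprob_def split: option.split)

lemma tprob_le_1: "tprob M s a T \<le> 1"
  by (simp add: tprob_def split: option.split)

lemma tprob_eq_1:
  assumes M: "mdp M" and sa: "(s, a) \<in> enabled M"
    and T: "\<And>t. t \<in> states M \<Longrightarrow> tprob M s a {t} > 0 \<Longrightarrow> t \<in> T"
  shows "tprob M s a T = 1"
proof -
  obtain p where p: "transition M s a = Some p"
    using sa by (auto simp: enabled_def)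
  then have "set_pmf p \<subseteq> states M" using M unfolding mdp_def by blast
  then have "set_pmf p \<subseteq> T"
    using T p by (auto simp: tprob_def measure_pmf_single pmf_positive)
  then have "AE x in measure_pmf p. x \<in> T" by (auto simp: AE_measure_pmf_iff)
  then show ?thesis
    using p by (simp add: tprob_def measure_pmf.prob_eq_1)
qed

lemma ex_successor:
  assumes "mdp M" "(s, a) \<in> enabled M"
  shows "\<exists>t\<in>states M. tprob M s a {t} > 0"
proof (rule ccontr)
  assume "\<not> ?thesis"
  then have "tprob M s a {} = 1"
    by (intro tprob_eq_1[OF assms]) auto
  then show False by (auto simp: tprob_def split: option.splits)
qed

text \<open>A pair visited infinitely often tries each of its successors with a fixed positive
  probability, so by \<open>AE_infinitely_often\<close> all of them recur; this closes the limit set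
  under transitions. Strong connectivity comes from the path itself: once only limit pairs occur,
  the stretch between two visits is a walk in the graph.\<close>

lemma (in scheduled) AE_end_component: "AE \<omega> in \<mu>. end_component M (limit_pairs \<omega>)"
proof -
  let ?X = "{((s, a), t). tprob M s a {t} > 0 \<and> (s, a) \<in> C \<and> t \<in> states M}"
  have "AE \<omega> in \<mu>. \<forall>x\<in>?X. (\<exists>\<^sub>\<infinity>n. history n \<omega> \<noteq> [] \<and> last (history n \<omega>) = fst x) \<longrightarrow>
      (\<exists>\<^sub>\<infinity>n. (history n \<omega> \<noteq> [] \<and> last (history n \<omega>) = fst x) \<and> \<omega> n \<in> {snd x} \<times> UNIV)"
  proof (rule AE_ball_countable')
    show "countable ?X"
      by (rule countable_finite, rule finite_subset[of _ "C \<times> states M"])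
        (use mdp_M in \<open>auto simp: mdp_def\<close>)
    fix x assume "x \<in> ?X"
    then obtain s a t where x: "x = ((s, a), t)" "tprob M s a {t} > 0" by auto
    have "tprob M s a {t} \<le> measure_pmf.prob (next_pmf M \<sigma> h) ({t} \<times> UNIV)"
      if h: "h \<noteq> []" "last h = (s, a)" and pos: "cylinder_prob M \<sigma> h > 0" for h
    proof -
      have "cylinder_prob M \<sigma> h * measure_pmf.prob (next_pmf M \<sigma> h) ({t} \<times> UNIV) =
          cylinder_prob M \<sigma> h * tprob M s a {t}"
        using prob_next[of h "{t} \<times> UNIV"] prob_next_state[of h "{t}"] h by (simp add: mem_Times_iff)
      with pos show ?thesis by simp
    qed
    then show "AE \<omega> in \<mu>. (\<exists>\<^sub>\<infinity>n. history n \<omega> \<noteq> [] \<and> last (history n \<omega>) = fst x) \<longrightarrow>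
      (\<exists>\<^sub>\<infinity>n. (history n \<omega> \<noteq> [] \<and> last (history n \<omega>) = fst x) \<and> \<omega> n \<in> {snd x} \<times> UNIV)"
      using x by (intro AE_infinitely_often[where \<epsilon>="tprob M s a {t}" and Q="\<lambda>h. h \<noteq> [] \<and> last h = fst x"]) auto
  qed
  with AE_infinite_paths AE_space show ?thesis
  proof eventually_elim
    fix \<omega>
    assume path: "\<omega> \<in> infinite_paths M \<and> fst (\<omega> 0) = initial M" and "\<omega> \<in> space \<mu>"
      and io: "\<forall>x\<in>?X. (\<exists>\<^sub>\<infinity>n. history n \<omega> \<noteq> [] \<and> last (history n \<omega>) = fst x) \<longrightarrow>
        (\<exists>\<^sub>\<infinity>n. (history n \<omega> \<noteq> [] \<and> last (history n \<omega>) = fst x) \<and> \<omega> n \<in> {snd x} \<times> UNIV)"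
    let ?L = "limit_pairs \<omega>"
    have en: "\<omega> n \<in> enabled M" for n
      using path infinite_path_step by blast
    have sub: "?L \<subseteq> enabled M"
    proof
      fix x assume "x \<in> ?L"
      then obtain n where "\<omega> n = x" by (auto simp: limit_pairs_def INFM_nat_le)
      then show "x \<in> enabled M" using en[of n] by simp
    qed
    have fin: "finite (enabled M)"
      using enabled_subset finite_C by (rule finite_subset)
    obtain n0 where n0: "\<And>n. n \<ge> n0 \<Longrightarrow> \<omega> n \<in> ?L"
      using eventually_limit_pairs[of "enabled M" \<omega>] fin en by blast
    have closed: "t \<in> fst ` ?L" if sa: "(s, a) \<in> ?L" and t: "tprob M s a {t} > 0" "t \<in> states M" for s a t
    proof -
      have "\<exists>\<^sub>\<infinity>n. history n \<omega> \<noteq> [] \<and> last (history n \<omega>) = (s, a)"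
        unfolding INFM_nat_le
      proof
        fix m
        obtain n where "n \<ge> m" "\<omega> n = (s, a)"
          using sa by (auto simp: limit_pairs_def INFM_nat_le)
        then show "\<exists>n\<ge>m. history n \<omega> \<noteq> [] \<and> last (history n \<omega>) = (s, a)"
          by (intro exI[of _ "Suc n"]) auto
      qed
      moreover have "((s, a), t) \<in> ?X"
        using sa t sub enabled_subset by auto
      ultimately have "\<exists>\<^sub>\<infinity>n. \<omega> n \<in> {t} \<times> UNIV"
        using io by (fastforce elim: frequently_mono[rotated])
      then obtain n where "n \<ge> n0" "fst (\<omega> n) = t"
        by (auto simp: INFM_nat_le mem_Times_iff)
      then show ?thesis using n0[of n] by auto
    qed
    have edge: "(fst (\<omega> n), fst (\<omega> (Suc n))) \<in> ec_edges M ?L" if "n \<ge> n0" for n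
    proof -
      have "tprob M (fst (\<omega> n)) (snd (\<omega> n)) {fst (\<omega> (Suc n))} > 0"
        using infinite_path_step(2) path by blast
      moreover have "(fst (\<omega> n), snd (\<omega> n)) \<in> ?L" "\<omega> (Suc n) \<in> ?L"
        using n0 that by simp_all
      ultimately show ?thesis
        unfolding ec_edges_def by (auto intro!: exI[of _ "snd (\<omega> n)"])
    qed
    have edges: "(fst (\<omega> n), fst (\<omega> m)) \<in> (ec_edges M ?L)\<^sup>*" if "n0 \<le> n" "n \<le> m" for n m
      using that(2)
    proof (induction m rule: dec_induct)
      case (step m)
      then show ?case using edge[of m] that(1) by (meson le_trans rtrancl.rtrancl_into_rtrancl)
    qed simp
    show "end_component M ?L"
      unfolding end_component_def
    proof (intro conjI ballI)
      show "?L \<noteq> {}" using n0[of n0] by auto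
      show "?L \<subseteq> enabled M" by (rule sub)
      show "case x of (s, a) \<Rightarrow> tprob M s a (fst ` ?L) = 1" if "x \<in> ?L" for x
        using that sub closed by (auto intro!: tprob_eq_1[OF mdp_M])
      fix s t assume "s \<in> fst ` ?L" "t \<in> fst ` ?L"
      then obtain a b where ab: "(s, a) \<in> ?L" "(t, b) \<in> ?L" by auto
      then obtain n where n: "n \<ge> n0" "\<omega> n = (s, a)"
        by (auto simp: limit_pairs_def INFM_nat_le)
      obtain m where m: "m \<ge> n" "\<omega> m = (t, b)"
        using ab by (auto simp: limit_pairs_def INFM_nat_le)
      show "(s, t) \<in> (ec_edges M ?L)\<^sup>*"
        using edges[of n m] n m by simp
    qed
  qed
qed

lemma ex_MEC_superset:
  assumes "mdp M" "end_component M E"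
  shows "\<exists>E'. MEC M E' \<and> E \<subseteq> E'"
proof -
  have "finite (enabled M)"
    by (rule finite_subset[of _ "states M \<times> actions M"]) (use assms in \<open>auto simp: enabled_def mdp_def\<close>)
  then have "finite {E. end_component M E}"
    by (auto intro: finite_subset[of _ "Pow (enabled M)"] simp: end_component_def)
  from finite_has_maximal2[OF this, of E] assms(2) obtain E' where
    "end_component M E'" "E \<subseteq> E'" "\<forall>F. end_component M F \<longrightarrow> E' \<subseteq> F \<longrightarrow> F = E'"
    by auto
  then show ?thesis by (auto simp: MEC_def)
qed

lemma class_of_eq:
  assumes "partition_on S D" "d \<in> D" "s \<in> d"
  shows "class_of D s = d"
proof -
  have "s \<in> S" using assms by (auto simp: partition_on_def)
  from class_of[OF assms(1) this] show ?thesis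
    using assms disjointD[of D d "class_of D s"] by (auto simp: partition_on_def)
qed

section \<open>MEC classes and their exits\<close>

abbreviation mec_class :: "('s, 'a) mdp \<Rightarrow> 's \<Rightarrow> 's set" where
  "mec_class M \<equiv> class_of (mec_partition M)"

definition exits :: "('s, 'a) mdp \<Rightarrow> ('s \<times> 'a) set" where
  "exits M = quotient_enabled M (mec_partition M)"

lemma mec_class_MEC: "MEC M E \<Longrightarrow> s \<in> fst ` E \<Longrightarrow> mec_class M s = fst ` E"
  by (rule class_of_eq[OF partition_on_mec_partition]) (auto simp: mec_partition_def)

lemma mem_mec_class: "s \<in> states M \<Longrightarrow> s \<in> mec_class M s"
  by (rule class_of[OF partition_on_mec_partition])

lemma mec_class_in: "s \<in> states M \<Longrightarrow> mec_class M s \<in> mec_partition M"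
  by (rule class_of[OF partition_on_mec_partition])

lemma mec_class_eq: "t \<in> mec_class M s \<Longrightarrow> s \<in> states M \<Longrightarrow> mec_class M t = mec_class M s"
  using class_of_eq[OF partition_on_mec_partition mec_class_in] .

lemma exits_enabled: "exits M \<subseteq> enabled M"
  by (auto simp: exits_def quotient_enabled_def)

lemma MEC_no_exit: "MEC M E \<Longrightarrow> E \<inter> exits M = {}"
  using mec_class_MEC[of M E]
  by (fastforce simp: exits_def quotient_enabled_def MEC_def end_component_def)

lemma non_exit_class:
  assumes "(s, a) \<in> enabled M" "(s, a) \<notin> exits M" "tprob M s a {t} > 0"
  shows "mec_class M t = mec_class M s"
proof -
  have "tprob M s a (mec_class M s) = 1"
    using assms tprob_le_1[of M s a "mec_class M s"] by (simp add: exits_def quotient_enabled_def)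
  from tprob_pos_mem[OF this assms(3)] show ?thesis
    using assms(1) by (intro mec_class_eq) (auto simp: enabled_def)
qed

text \<open>The class of such a state is a singleton, so a non-exit would be a self-loop of
  probability 1. That alone is an end component and would lie in a MEC.\<close>

lemma non_MEC_exit:
  assumes M: "mdp M" and sa: "(s, a) \<in> enabled M" and s: "\<And>E. MEC M E \<Longrightarrow> s \<notin> fst ` E"
  shows "(s, a) \<in> exits M" "mec_class M s = {s}"
proof -
  have S: "s \<in> states M" using sa by (auto simp: enabled_def)
  then show "mec_class M s = {s}"
    using s by (intro class_of_eq[OF partition_on_mec_partition]) (auto simp: mec_partition_def)
  then have "tprob M s a {s} = 1" if "(s, a) \<notin> exits M"
    using that sa tprob_le_1[of M s a "{s}"] by (simp add: exits_def quotient_enabled_def)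
  then have "end_component M {(s, a)}" if "(s, a) \<notin> exits M"
    using that sa by (auto simp: end_component_def)
  then show "(s, a) \<in> exits M"
    using ex_MEC_superset[OF M] s by force
qed

lemma class_achievable_MEC:
  assumes "(d, I) \<in> achievable M k P"
  obtains E where "MEC M E" "d = fst ` E"
  using assms by (auto simp: achievable_def)

definition quot_pair :: "('s, 'a) mdp \<Rightarrow> 's \<times> 'a \<Rightarrow> 's qstate \<times> 'a qaction" where
  "quot_pair M x = (Cls (mec_class M (fst x)), Act (snd x))"

text \<open>The quotient forgets the source state of an exit, but with disjoint actions the action
  still identifies it. This is what makes the next class depend on the quotient history
  only.\<close>

lemma quot_pair_inj:
  assumes "disjoint_actions M" "x \<in> enabled M" "y \<in> enabled M" "quot_pair M x = quot_pair M y"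
  shows "x = y"
  using assms by (cases x; cases y) (auto simp: quot_pair_def disjoint_actions_def)

section \<open>Enabled pairs and transitions of the quotient\<close>

locale rabin_mdp =
  fixes M :: "('s, 'a) mdp" and k :: nat and P :: "nat \<Rightarrow> ('s set \<times> 's set) set"
  assumes M: "mdp M" and dis: "disjoint_actions M"
    and P: "i \<in> {1..k} \<Longrightarrow> P i \<subseteq> Pow (states M) \<times> Pow (states M)"
begin

abbreviation "Mh \<equiv> mec_quotient M k P"

lemma transition_quot_pair:
  assumes "x \<in> exits M"
  shows "transition Mh (fst (quot_pair M x)) (snd (quot_pair M x)) =
    map_option (map_pmf (\<lambda>t. Cls (mec_class M t))) (transition M (fst x) (snd x))"
proof -
  obtain s a where x: "x = (s, a)" by (cases x)
  have sa: "(s, a) \<in> quotient_enabled M (mec_partition M)"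
    using assms x by (simp add: exits_def)
  then have "(s, a) \<in> enabled M" by (simp add: quotient_enabled_def)
  then have "t = s" if "(t, a) \<in> quotient_enabled M (mec_partition M)" for t
    using that dis by (auto simp: disjoint_actions_def quotient_enabled_def)
  then have "(THE t. (t, a) \<in> quotient_enabled M (mec_partition M) \<and> mec_class M t = mec_class M s) = s"
    using sa by blast
  then show ?thesis
    using sa by (auto simp: x quot_pair_def mec_quotient_def quotient_def)
qed

lemma enabled_Act: "(Cls d, Act a) \<in> enabled Mh \<longleftrightarrow> (\<exists>x\<in>exits M. (Cls d, Act a) = quot_pair M x)"
proof -
  have "(\<exists>s. (s, a) \<in> exits M \<and> mec_class M s = d) \<Longrightarrow> d \<in> mec_partition M \<and> a \<in> actions M"
    using mec_class_in exits_enabled by (fastforce simp: enabled_def)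
  moreover have "transition M (THE s. (s, a) \<in> exits M \<and> mec_class M s = d) a \<noteq> None"
    if "(s, a) \<in> exits M" "mec_class M s = d" for s
  proof -
    have "t = s" if "(t, a) \<in> exits M" for t
      using that \<open>(s, a) \<in> exits M\<close> dis exits_enabled unfolding disjoint_actions_def by blast
    then have "(THE s. (s, a) \<in> exits M \<and> mec_class M s = d) = s"
      using that by blast
    then show ?thesis using that exits_enabled[of M] by (auto simp: enabled_def)
  qed
  moreover have "(\<exists>x\<in>exits M. (Cls d, Act a) = quot_pair M x) \<longleftrightarrow> (\<exists>s. (s, a) \<in> exits M \<and> mec_class M s = d)"
    by (force simp: quot_pair_def)
  ultimately show ?thesis
    by (auto simp: enabled_def mec_quotient_def quotient_def simp flip: exits_def split: if_splits)
qed

lemma enabled_Tau: "(Cls d, Tau I) \<in> enabled Mh \<longleftrightarrow> (d, I) \<in> achievable M k P"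
proof -
  have "d \<in> mec_partition M \<and> I \<subseteq> {1..k}" if "(d, I) \<in> achievable M k P"
    using that by (auto simp: achievable_def mec_partition_def)
  then show ?thesis
    by (auto simp: enabled_def mec_quotient_def quotient_def)
qed

lemma enabled_Bot: "(Bot I, m) \<in> enabled Mh \<longleftrightarrow> m = Tau I \<and> I \<subseteq> {1..k}"
  by (cases m) (auto simp: enabled_def mec_quotient_def quotient_def split: if_splits)

lemma tprob_Tau: "tprob Mh (Cls d) (Tau I) {q} = (if (d, I) \<in> achievable M k P \<and> q = Bot I then 1 else 0)"
  by (auto simp: tprob_def mec_quotient_def quotient_def indicator_def)

lemma tprob_Bot: "(Bot I, m) \<in> enabled Mh \<Longrightarrow> tprob Mh (Bot I) m {q} = (if q = Bot I then 1 else 0)"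
  by (auto simp: enabled_Bot) (auto simp: tprob_def mec_quotient_def quotient_def indicator_def)

lemma tprob_Act_Bot: "tprob Mh (Cls d) (Act a) {Bot I} = 0"
  by (auto simp: vimage_def tprob_def mec_quotient_def quotient_def split: option.split)

text \<open>A MEC always offers \<open>Tau {}\<close>, whose condition is vacuous, and a state in no
  MEC has only exits, all of which survive. Schedulers built from conditional probabilities must
  answer in every state, including those of probability 0, hence the interest in deadlocks.\<close>

lemma deadlock_free_quotient:
  assumes "\<And>s. s \<in> states M \<Longrightarrow> \<exists>a. (s, a) \<in> enabled M" and q: "q \<in> states Mh"
  shows "\<exists>m. (q, m) \<in> enabled Mh"
proof (cases q)
  case (Bot I)
  then have "I \<subseteq> {1..k}" using q by (auto simp: mec_quotient_def quotient_def)
  then show ?thesis using Bot enabled_Bot by blast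
next
  case (Cls d)
  then have d: "d \<in> mec_partition M" using q by (auto simp: mec_quotient_def quotient_def)
  show ?thesis
  proof (cases "\<exists>E. MEC M E \<and> d = fst ` E")
    case True
    then have "(d, {}) \<in> achievable M k P"
      by (auto simp: achievable_def MEC_def)
    then show ?thesis using Cls enabled_Tau by blast
  next
    case False
    then obtain s where s: "d = {s}" "s \<in> states M" "\<And>E. MEC M E \<Longrightarrow> s \<notin> fst ` E"
      using d by (auto simp: mec_partition_def)
    then obtain a where "(s, a) \<in> enabled M" using assms(1) by blast
    from non_MEC_exit[OF M this s(3)] s(1) have "(Cls d, Act a) \<in> enabled Mh"
      unfolding enabled_Act by (intro bexI[of _ "(s, a)"]) (auto simp: quot_pair_def)
    then show ?thesis using Cls by blast
  qed
qed

text \<open>A state of a MEC has an action anyway. Outside the MECs no \<open>Tau\<close> is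
  available, so the quotient action of the singleton class stems from an exit of that very
  state.\<close>

lemma quotient_deadlock_free:
  assumes "\<And>q. q \<in> states Mh \<Longrightarrow> \<exists>m. (q, m) \<in> enabled Mh" and s: "s \<in> states M"
  shows "\<exists>a. (s, a) \<in> enabled M"
proof (cases "\<exists>E. MEC M E \<and> s \<in> fst ` E")
  case True
  then show ?thesis by (fastforce simp: MEC_def end_component_def)
next
  case False
  then have cls: "mec_class M s = {s}"
    using s by (intro class_of_eq[OF partition_on_mec_partition]) (auto simp: mec_partition_def)
  have "Cls {s} \<in> states Mh"
    using mec_class_in[OF s] cls by (auto simp: mec_quotient_def quotient_def)
  from assms(1)[OF this] obtain m where m: "(Cls {s}, m) \<in> enabled Mh" ..
  show ?thesis
  proof (cases m)
    case (Act a)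
    then obtain x where "x \<in> exits M" "quot_pair M x = (Cls {s}, Act a)"
      using m enabled_Act by metis
    then have "fst x = s" "x \<in> enabled M"
      using exits_enabled[of M] mem_mec_class[of "fst x" M] by (auto simp: quot_pair_def enabled_def)
    then show ?thesis by (metis prod.collapse)
  next
    case (Tau I)
    then show ?thesis
      using m False enabled_Tau by (metis class_achievable_MEC singletonI)
  qed
qed

end

text \<open>Finite paths may start anywhere, so a scheduler has to answer in all states and not just
  in those reachable from the initial one.\<close>

lemma scheduler_deadlock_free:
  assumes "scheduler M \<sigma>" "s \<in> states M"
  shows "\<exists>a. (s, a) \<in> enabled M"
proof -
  have "finite_path M [] s" using assms(2) by (rule finite_path.start)
  then have "set_pmf (\<sigma> [] s) \<subseteq> {a. (s, a) \<in> enabled M}"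
    using assms(1) unfolding scheduler_def by blast
  then show ?thesis using set_pmf_not_empty[of "\<sigma> [] s"] by blast
qed

section \<open>Schedulers from path measures\<close>

text \<open>Conditional probabilities without division: the weights are normalised, and when their
  sum is 0 every distribution on \<open>A\<close> satisfies the equation.\<close>

lemma ex_pmf_proportional:
  fixes f :: "'a \<Rightarrow> real"
  assumes A: "finite A" "A \<noteq> {}" and f: "\<And>a. a \<in> A \<Longrightarrow> 0 \<le> f a"
  shows "\<exists>p. set_pmf p \<subseteq> A \<and> (\<forall>a\<in>A. f a = (\<Sum>b\<in>A. f b) * pmf p a)"
proof (cases "(\<Sum>b\<in>A. f b) = 0")
  case True
  then have "f a = 0" if "a \<in> A" for a
    using sum_nonneg_eq_0_iff[OF A(1)] f that by auto
  then show ?thesis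
    using True A by (intro exI[of _ "pmf_of_set A"]) auto
next
  case False
  define c where "c = (\<Sum>b\<in>A. f b)"
  define g where "g a = (if a \<in> A then f a / c else 0)" for a
  have "c \<ge> 0" unfolding c_def using f by (rule sum_nonneg)
  with False have c: "c > 0" by (simp add: c_def)
  have g: "0 \<le> g a" for a using f c by (simp add: g_def)
  have "(\<integral>\<^sup>+ a. ennreal (g a) \<partial>count_space UNIV) = (\<Sum>a\<in>A. ennreal (g a))"
    using A by (intro nn_integral_count_space') (auto simp: g_def)
  also have "\<dots> = ennreal (\<Sum>a\<in>A. g a)"
    using g by (intro sum_ennreal) auto
  also have "(\<Sum>a\<in>A. g a) = (\<Sum>a\<in>A. f a) / c"
    unfolding sum_divide_distrib by (intro sum.cong) (auto simp: g_def)
  also have "\<dots> = 1" using c by (simp add: c_def)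
  finally have pmf: "pmf (embed_pmf g) a = g a" for a
    using g by (intro pmf_embed_pmf) auto
  then have "set_pmf (embed_pmf g) \<subseteq> A"
    by (auto simp: set_pmf_iff g_def split: if_splits)
  moreover have "f a = c * pmf (embed_pmf g) a" if "a \<in> A" for a
    using that c by (simp add: pmf g_def)
  ultimately show ?thesis by (auto simp: c_def)
qed

lemma finite_path_state:
  assumes "mdp M" "finite_path M h s"
  shows "s \<in> states M"
  using assms(2)
proof cases
  case (step h s' a)
  then obtain p where p: "transition M s' a = Some p" "s \<in> set_pmf p"
    by (auto simp: tprob_def measure_pmf_single set_pmf_iff split: option.splits)
  then show ?thesis using assms(1) unfolding mdp_def by blast
qed

text \<open>The scheduler is the conditional law of the action given the history and the current
  state. The cylinder recursion multiplies exactly a state factor, given by the assumption on the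
  next state, and this action factor, so uniqueness of the path measure applies. Any extra memory
  behind \<open>\<nu>\<close> is thereby averaged out.\<close>

lemma ex_scheduler_path_measure:
  assumes M: "mdp M" and "prob_space \<nu>" and sets: "sets \<nu> = sets (path_space M)"
    and init: "AE \<omega> in \<nu>. fst (\<omega> 0) = initial M"
    and en: "AE \<omega> in \<nu>. \<forall>n. \<omega> n \<in> enabled M"
    and step: "\<And>h t. h \<noteq> [] \<Longrightarrow>
      \<P>(\<omega> in \<nu>. history (length h) \<omega> = h \<and> fst (\<omega> (length h)) = t) =
      \<P>(\<omega> in \<nu>. history (length h) \<omega> = h) * tprob M (fst (last h)) (snd (last h)) {t}"
    and df: "\<And>s. s \<in> states M \<Longrightarrow> \<exists>a. (s, a) \<in> enabled M"
  shows "\<exists>\<sigma>. scheduler M \<sigma> \<and> path_measure M \<sigma> = \<nu>"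
proof -
  interpret prob_space \<nu> by fact
  define C where "C = states M \<times> actions M"
  have fin: "finite C" using M by (auto simp: mdp_def C_def)
  have [measurable_cong]: "sets \<nu> = sets (PiM UNIV (\<lambda>_. count_space C))"
    by (simp add: sets path_space_def C_def)
  have [measurable]: "history n \<in> \<nu> \<rightarrow>\<^sub>M count_space UNIV" for n
    using measurable_history[OF countable_finite[OF fin], of n] by (simp cong: measurable_cong_sets)
  have pred: "Measurable.pred \<nu> (\<lambda>\<omega>. R (history n \<omega>))" for R n
    by (rule pred_count_space) measurable
  have pred2 [measurable]: "Measurable.pred \<nu> (\<lambda>\<omega>. R (history n \<omega>) (\<omega> n))" for R n
    using pred[of "\<lambda>h. R (take n h) (last h)" "Suc n"] by simp
  define A where "A s = {a. (s, a) \<in> enabled M}" for s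
  have fin_A: "finite (A s)" for s
    by (rule finite_subset[of _ "actions M"]) (use M in \<open>auto simp: A_def enabled_def mdp_def\<close>)
  define w where "w h s = \<P>(\<omega> in \<nu>. history (length h) \<omega> = h \<and> fst (\<omega> (length h)) = s)" for h s
  define f where "f h s a = \<P>(\<omega> in \<nu>. history (length h) \<omega> = h \<and> \<omega> (length h) = (s, a))" for h s a
  have w_sum: "w h s = (\<Sum>a\<in>A s. f h s a)" for h s
    unfolding w_def f_def
  proof (rule prob_sum)
    show "AE \<omega> in \<nu>. (\<forall>a\<in>A s. history (length h) \<omega> = h \<and> \<omega> (length h) = (s, a) \<longrightarrow>
          history (length h) \<omega> = h \<and> fst (\<omega> (length h)) = s) \<and>
        (history (length h) \<omega> = h \<and> fst (\<omega> (length h)) = s \<longrightarrow>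
         (\<exists>!a. a \<in> A s \<and> history (length h) \<omega> = h \<and> \<omega> (length h) = (s, a)))"
      using en
    proof eventually_elim
      case (elim \<omega>)
      from elim[rule_format, of "length h"] show ?case
        by (cases "\<omega> (length h)") (auto simp: A_def)
    qed
  qed (simp_all add: fin_A pred2[unfolded pred_def])
  \<comment> \<open>Finite paths end in \<open>states M\<close>, so nothing is demanded of the
    distribution elsewhere.\<close>
  have "\<exists>p. s \<in> states M \<longrightarrow> set_pmf p \<subseteq> A s \<and> (\<forall>a\<in>A s. f h s a = w h s * pmf p a)" for h s
  proof (cases "s \<in> states M")
    case True
    then have "A s \<noteq> {}" using df by (auto simp: A_def)
    from ex_pmf_proportional[OF fin_A this, of "f h s"] show ?thesis
      by (auto simp: w_sum f_def)
  qed simp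
  then have "\<forall>h s. \<exists>p. s \<in> states M \<longrightarrow> set_pmf p \<subseteq> A s \<and> (\<forall>a\<in>A s. f h s a = w h s * pmf p a)"
    by blast
  then obtain \<sigma> where \<sigma>: "\<And>h s. s \<in> states M \<Longrightarrow> set_pmf (\<sigma> h s) \<subseteq> A s"
    "\<And>h s a. s \<in> states M \<Longrightarrow> a \<in> A s \<Longrightarrow> f h s a = w h s * pmf (\<sigma> h s) a"
    by metis
  have sched: "scheduler M \<sigma>"
    using \<sigma>(1) finite_path_state[OF M] by (fastforce simp: scheduler_def A_def)
  have f_eq: "f h s a = w h s * pmf (\<sigma> h s) a" if s: "s \<in> states M" for h s a
  proof (cases "a \<in> A s")
    case False
    have "AE \<omega> in \<nu>. \<not> (history (length h) \<omega> = h \<and> \<omega> (length h) = (s, a))"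
      using en
    proof eventually_elim
      case (elim \<omega>)
      from elim[rule_format, of "length h"] False show ?case by (auto simp: A_def)
    qed
    then have "f h s a = 0"
      unfolding f_def by (subst prob_Collect_eq_0) (auto intro: pred2[unfolded pred_def])
    moreover have "pmf (\<sigma> h s) a = 0"
      using False \<sigma>(1)[OF s] by (meson set_pmf_iff subsetD)
    ultimately show ?thesis by simp
  qed (use \<sigma>(2) s in blast)
  have cyl: "cylinder M h = {\<omega>\<in>space \<nu>. history (length h) \<omega> = h}" for h
    using sets_eq_imp_space_eq[OF sets] by (auto simp: cylinder_def history_eq_iff)
  have "Sigma_Algebra.measure \<nu> (cylinder M h) = cylinder_prob M \<sigma> h" if "h \<in> lists C" for h
    using that
  proof (induction h rule: rev_induct)
    case Nil
    then show ?case by (simp add: cyl cylinder_prob_Nil prob_space)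
  next
    case (snoc x h)
    obtain s a where x: "x = (s, a)" by (cases x)
    have s: "s \<in> states M" using snoc.prems by (simp add: C_def x)
    have w: "w h s = cylinder_prob M \<sigma> h * (if h = [] then (if s = initial M then 1 else 0)
       else tprob M (fst (last h)) (snd (last h)) {s})"
    proof (cases "h = []")
      case True
      have "\<P>(\<omega> in \<nu>. fst (\<omega> 0) = s) = (if s = initial M then 1 else 0)"
      proof (cases "s = initial M")
        case True
        then have "\<P>(\<omega> in \<nu>. fst (\<omega> 0) = s) = 1"
          using init pred2[of "\<lambda>_ x. fst x = s" 0] by (subst prob_Collect_eq_1) auto
        then show ?thesis using True by simp
      next
        case False
        then have "AE \<omega> in \<nu>. fst (\<omega> 0) \<noteq> s"
          using init by auto
        then have "\<P>(\<omega> in \<nu>. fst (\<omega> 0) = s) = 0"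
          using pred2[of "\<lambda>_ x. fst x = s" 0] by (subst prob_Collect_eq_0) auto
        then show ?thesis using False by simp
      qed
      then show ?thesis using True by (simp add: w_def cylinder_prob_Nil)
    next
      case False
      then show ?thesis
        using step[OF False, of s] snoc by (simp add: w_def cyl)
    qed
    have "Sigma_Algebra.measure \<nu> (cylinder M (h @ [x])) = f h s a"
      unfolding cyl f_def by (simp add: history_Suc x)
    then show ?case
      using f_eq[OF s, of h a] w by (simp add: x cylinder_prob_snoc)
  qed
  then have "is_path_measure M \<sigma> \<nu>"
    using \<open>prob_space \<nu>\<close> sets by (simp add: is_path_measure_def C_def)
  then have "path_measure M \<sigma> = \<nu>"
    using path_measure_unique[OF M] is_path_measure_path_measure[OF M sched] by blast
  with sched show ?thesis by blast
qed

section \<open>Measurability of reachability and finiteness of the exits\<close>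

lemma (in scheduled) reach_measurable: "reach M G \<in> sets \<mu>"
proof -
  have "reach M G = {\<omega> \<in> space \<mu>. (\<forall>n. \<omega> n \<in> enabled M \<and>
      tprob M (fst (\<omega> n)) (snd (\<omega> n)) {fst (\<omega> (Suc n))} > 0) \<and> (\<exists>n. fst (\<omega> n) \<in> G)}"
    using enabled_subset by (auto simp: reach_def infinite_paths_def space_\<mu> simp del: mem_Sigma_iff)
  also have "\<dots> \<in> sets \<mu>"
    unfolding pred_def[symmetric]
    by (intro pred_intros_logic pred_intros_countable pred_coordinate
        pred_coordinate2[of "\<lambda>x y. tprob M (fst x) (snd x) {fst y} > 0"])
  finally show ?thesis .
qed

lemma (in scheduled) AE_eventually_MEC:
  "AE \<omega> in \<mu>. \<exists>E n0. MEC M E \<and> limit_pairs \<omega> \<subseteq> E \<and> (\<forall>n\<ge>n0. \<omega> n \<in> limit_pairs \<omega>)"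
  using AE_end_component AE_space
proof eventually_elim
  fix \<omega> assume "end_component M (limit_pairs \<omega>)" "\<omega> \<in> space \<mu>"
  then obtain E where "MEC M E" "limit_pairs \<omega> \<subseteq> E"
    using ex_MEC_superset[OF mdp_M] by blast
  moreover obtain n0 where "\<forall>n\<ge>n0. \<omega> n \<in> limit_pairs \<omega>"
    using eventually_limit_pairs[OF finite_C, of \<omega>] \<open>\<omega> \<in> space \<mu>\<close> unfolding space_\<mu> by blast
  ultimately show "\<exists>E n0. MEC M E \<and> limit_pairs \<omega> \<subseteq> E \<and> (\<forall>n\<ge>n0. \<omega> n \<in> limit_pairs \<omega>)"
    by blast
qed

lemma (in scheduled) AE_eventually_no_exit: "AE \<omega> in \<mu>. \<exists>n0. \<forall>n\<ge>n0. \<omega> n \<notin> exits M"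
  using AE_eventually_MEC by eventually_elim (use MEC_no_exit in blast)

section \<open>Exit traces\<close>

definition exit_trace :: "('s, 'a) mdp \<Rightarrow> ('s \<times> 'a) list \<Rightarrow> ('s qstate \<times> 'a qaction) list" where
  "exit_trace M h = map (quot_pair M) (filter (\<lambda>x. x \<in> exits M) h)"

text \<open>Every trace is attained at most once by a fresh history, namely right after its last exit.\<close>

definition fresh :: "('s, 'a) mdp \<Rightarrow> ('s \<times> 'a) list \<Rightarrow> bool" where
  "fresh M h \<longleftrightarrow> h = [] \<or> last h \<in> exits M"

definition cls :: "('s, 'a) mdp \<Rightarrow> 's \<Rightarrow> 's qstate" where
  "cls M s = Cls (mec_class M s)"

definition exited :: "('s, 'a) mdp \<Rightarrow> ('s qstate \<times> 'a qaction) list \<Rightarrow> (nat \<Rightarrow> 's \<times> 'a) \<Rightarrow> nat \<Rightarrow> bool" where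
  "exited M hh \<omega> n \<longleftrightarrow> fresh M (history n \<omega>) \<and> exit_trace M (history n \<omega>) = hh"

text \<open>What the quotient sees next from time \<open>n\<close> on: the action of the next exit
  or, if there is none, a sink label. \<open>J\<close> is a separate argument because in one
  direction it is not a function of the path of \<open>M\<close>.\<close>

fun next_label :: "('s, 'a) mdp \<Rightarrow> (nat \<Rightarrow> 's \<times> 'a) \<Rightarrow> nat set \<Rightarrow> nat \<Rightarrow> 'a qaction \<Rightarrow> bool" where
  "next_label M \<omega> J n (Act b) \<longleftrightarrow>
     (\<exists>j\<ge>n. \<omega> j \<in> exits M \<and> snd (\<omega> j) = b \<and> (\<forall>i. n \<le> i \<and> i < j \<longrightarrow> \<omega> i \<notin> exits M))"
| "next_label M \<omega> J n (Tau I) \<longleftrightarrow> (\<forall>j\<ge>n. \<omega> j \<notin> exits M) \<and> J = I"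

text \<open>Since the time \<open>n\<close> is unique, these two events play the roles of "quotient
  history \<open>hh\<close>, now in state \<open>q\<close>" and "quotient history \<open>hh\<close>,
  now in \<open>q\<close> and about to take \<open>m\<close>".\<close>

definition entered where
  "entered M hh q \<omega> \<longleftrightarrow> (\<exists>n. exited M hh \<omega> n \<and> cls M (fst (\<omega> n)) = q)"

definition labelled where
  "labelled M hh q m \<omega> J \<longleftrightarrow>
     (\<exists>n. exited M hh \<omega> n \<and> cls M (fst (\<omega> n)) = q \<and> next_label M \<omega> J n m)"

lemma exit_trace_simps [simp]:
  "exit_trace M [] = []"
  "exit_trace M (h @ [x]) = (if x \<in> exits M then exit_trace M h @ [quot_pair M x] else exit_trace M h)"
  by (auto simp: exit_trace_def)

lemma exit_trace_history_mono:
  "n \<le> m \<Longrightarrow> length (exit_trace M (history n \<omega>)) \<le> length (exit_trace M (history m \<omega>))"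
  by (induction m rule: dec_induct) (auto simp: history_Suc)

lemma exit_trace_no_exit:
  "n \<le> m \<Longrightarrow> (\<And>i. n \<le> i \<Longrightarrow> i < m \<Longrightarrow> \<omega> i \<notin> exits M) \<Longrightarrow>
    exit_trace M (history m \<omega>) = exit_trace M (history n \<omega>)"
  by (induction m rule: dec_induct) (auto simp: history_Suc)

lemma fresh_history: "fresh M (history n \<omega>) \<longleftrightarrow> n = 0 \<or> \<omega> (n - 1) \<in> exits M"
  by (cases n) (auto simp: fresh_def history_Suc)

text \<open>Between two fresh times the later one is preceded by an exit, which makes its trace
  strictly longer.\<close>

lemma exited_unique:
  assumes "exited M hh \<omega> n" "exited M hh \<omega> m"
  shows "n = m"
proof -
  have False if "exited M hh \<omega> n" "exited M hh \<omega> m" "n < m" for n m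
  proof -
    obtain m' where m: "m = Suc m'" "n \<le> m'" using \<open>n < m\<close> by (cases m) auto
    have "\<omega> m' \<in> exits M" using that m by (auto simp: exited_def fresh_history)
    then have "length hh = Suc (length (exit_trace M (history m' \<omega>)))"
      using that(2) m by (auto simp: exited_def history_Suc)
    then show False
      using exit_trace_history_mono[OF m(2), of M \<omega>] that(1) by (simp add: exited_def)
  qed
  then show ?thesis using assms by (metis linorder_neqE_nat)
qed

text \<open>The time sought is the one right after the last exit before \<open>j\<close>, or 0 if
  there was no exit.\<close>

lemma ex_last_fresh:
  "\<exists>n\<le>j. exited M (exit_trace M (history j \<omega>)) \<omega> n \<and> (\<forall>i. n \<le> i \<and> i < j \<longrightarrow> \<omega> i \<notin> exits M)"
proof (induction j)
  case 0
  show ?case by (auto simp: exited_def fresh_history)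
next
  case (Suc j)
  show ?case
  proof (cases "\<omega> j \<in> exits M")
    case True
    then show ?thesis by (intro exI[of _ "Suc j"]) (auto simp: exited_def fresh_history)
  next
    case False
    obtain n where n: "n \<le> j" "exited M (exit_trace M (history j \<omega>)) \<omega> n"
      "\<forall>i. n \<le> i \<and> i < j \<longrightarrow> \<omega> i \<notin> exits M"
      using Suc by blast
    with False show ?thesis
      by (intro exI[of _ n]) (auto simp: history_Suc less_Suc_eq)
  qed
qed

lemma class_no_exit:
  assumes "\<omega> \<in> infinite_paths M"
  shows "n \<le> m \<Longrightarrow> (\<And>i. n \<le> i \<Longrightarrow> i < m \<Longrightarrow> \<omega> i \<notin> exits M) \<Longrightarrow>
    mec_class M (fst (\<omega> m)) = mec_class M (fst (\<omega> n))"
proof (induction m rule: dec_induct)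
  case (step m)
  have "mec_class M (fst (\<omega> (Suc m))) = mec_class M (fst (\<omega> m))"
    using infinite_path_step[OF assms, of m] step by (intro non_exit_class[of _ "snd (\<omega> m)"]) auto
  with step show ?case by simp
qed simp

lemma exited_snoc:
  "exited M (hh @ [z]) \<omega> n \<longleftrightarrow> (\<exists>j. n = Suc j \<and> \<omega> j \<in> exits M \<and> quot_pair M (\<omega> j) = z \<and>
     exit_trace M (history j \<omega>) = hh)"
  by (cases n) (auto simp: exited_def fresh_def history_Suc)

text \<open>The class at entry equals the class at the next exit, because no step in between leaves
  it. Hence the state recorded in the trace is the one that the quotient entered.\<close>

lemma exited_snoc_iff_labelled:
  assumes "\<omega> \<in> infinite_paths M"
  shows "(\<exists>n. exited M (hh @ [(q, Act b)]) \<omega> n) \<longleftrightarrow> labelled M hh q (Act b) \<omega> J"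
proof
  assume "\<exists>n. exited M (hh @ [(q, Act b)]) \<omega> n"
  then obtain j where j: "\<omega> j \<in> exits M" "quot_pair M (\<omega> j) = (q, Act b)" "exit_trace M (history j \<omega>) = hh"
    by (auto simp: exited_snoc)
  obtain n where n: "n \<le> j" "exited M hh \<omega> n" "\<forall>i. n \<le> i \<and> i < j \<longrightarrow> \<omega> i \<notin> exits M"
    using ex_last_fresh[of j M \<omega>] j(3) by auto
  have "cls M (fst (\<omega> n)) = q"
    using class_no_exit[OF assms n(1)] n(3) j(2) by (auto simp: cls_def quot_pair_def)
  then show "labelled M hh q (Act b) \<omega> J"
    using n j by (auto simp: labelled_def quot_pair_def)
next
  assume "labelled M hh q (Act b) \<omega> J"
  then obtain n j where n: "exited M hh \<omega> n" "cls M (fst (\<omega> n)) = q"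
    and j: "n \<le> j" "\<omega> j \<in> exits M" "snd (\<omega> j) = b" "\<forall>i. n \<le> i \<and> i < j \<longrightarrow> \<omega> i \<notin> exits M"
    by (auto simp: labelled_def)
  have "exit_trace M (history j \<omega>) = hh"
    using exit_trace_no_exit[OF j(1)] j(4) n(1) by (auto simp: exited_def)
  moreover have "quot_pair M (\<omega> j) = (q, Act b)"
    using class_no_exit[OF assms j(1)] j(3,4) n(2) by (auto simp: cls_def quot_pair_def)
  ultimately show "\<exists>n. exited M (hh @ [(q, Act b)]) \<omega> n"
    using j(2) by (intro exI[of _ "Suc j"]) (auto simp: exited_snoc)
qed

text \<open>\<open>Tau\<close> means that no exit follows; a later fresh time would have one right
  before it.\<close>

lemma labelled_Tau_unique:
  assumes "labelled M hh q (Tau I) \<omega> J" "labelled M hh' q' (Tau I') \<omega> J"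
  shows "hh = hh' \<and> q = q' \<and> I = I'"
proof -
  obtain n n' where n: "exited M hh \<omega> n" "cls M (fst (\<omega> n)) = q" "\<forall>j\<ge>n. \<omega> j \<notin> exits M" "J = I"
    and n': "exited M hh' \<omega> n'" "cls M (fst (\<omega> n')) = q'" "\<forall>j\<ge>n'. \<omega> j \<notin> exits M" "J = I'"
    using assms by (auto simp: labelled_def)
  have "\<not> n < n'" "\<not> n' < n"
    using n(1,3) n'(1,3) by (auto simp: exited_def fresh_history)
  then have "n = n'" by simp
  then show ?thesis using n n' by (simp add: exited_def)
qed

lemma entered_labelled_unique:
  assumes "labelled M hh q m \<omega> J" "labelled M hh q m' \<omega> J"
  shows "m = m'"
proof -
  obtain n n' where n: "exited M hh \<omega> n" "next_label M \<omega> J n m"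
    "exited M hh \<omega> n'" "next_label M \<omega> J n' m'"
    using assms unfolding labelled_def by blast
  then have "n' = n" by (blast intro: exited_unique)
  with n(2,4) have lab: "next_label M \<omega> J n m" "next_label M \<omega> J n m'" by simp_all
  show ?thesis
  proof (cases m; cases m')
    fix b b' assume m: "m = Act b" "m' = Act b'"
    obtain j where j: "n \<le> j" "\<omega> j \<in> exits M" "snd (\<omega> j) = b" "\<forall>i. n \<le> i \<and> i < j \<longrightarrow> \<omega> i \<notin> exits M"
      using lab(1) m by auto
    obtain j' where j': "n \<le> j'" "\<omega> j' \<in> exits M" "snd (\<omega> j') = b'" "\<forall>i. n \<le> i \<and> i < j' \<longrightarrow> \<omega> i \<notin> exits M"
      using lab(2) m by auto
    have "\<not> j < j'" "\<not> j' < j" using j j' by blast+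
    then show "m = m'" using j(3) j'(3) m by simp
  qed (use lab in auto)
qed

lemma ex_next_label: "\<exists>m. next_label M \<omega> J n m"
proof (cases "\<exists>j\<ge>n. \<omega> j \<in> exits M")
  case True
  define j where "j = (LEAST j. j \<ge> n \<and> \<omega> j \<in> exits M)"
  have "j \<ge> n \<and> \<omega> j \<in> exits M" unfolding j_def by (rule LeastI_ex) (use True in blast)
  moreover have "\<omega> i \<notin> exits M" if "n \<le> i" "i < j" for i
    using that not_less_Least[of i "\<lambda>j. j \<ge> n \<and> \<omega> j \<in> exits M"] by (auto simp: j_def)
  ultimately have "next_label M \<omega> J n (Act (snd (\<omega> j)))" by auto
  then show ?thesis by blast
next
  case False
  then have "next_label M \<omega> J n (Tau J)" by auto
  then show ?thesis by blast
qed

section \<open>The law of the exit traces\<close>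

lemma (in rabin_mdp) tprob_quot_pair_cls:
  assumes "x \<in> exits M"
  shows "tprob Mh (fst (quot_pair M x)) (snd (quot_pair M x)) {q} =
    tprob M (fst x) (snd x) {t. cls M t = q}"
  unfolding tprob_def transition_quot_pair[OF assms]
  by (simp add: vimage_def cls_def split: option.split)

text \<open>Countable additivity carries a proportionality from the cells to their union. Two
  measures are allowed because it serves both inside one space, where \<open>c\<close> is the
  probability of a state or a label, and between the two path spaces, where \<open>c\<close> is
  1.\<close>

lemma measure_UN_scale:
  assumes N: "finite_measure N" and N': "finite_measure N'" and I: "countable I"
    and A: "\<And>i. i \<in> I \<Longrightarrow> A i \<in> sets N" "disjoint_family_on A I"
    and B: "\<And>i. i \<in> I \<Longrightarrow> B i \<in> sets N'" "disjoint_family_on B I"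
    and c: "0 \<le> c"
    and eq: "\<And>i. i \<in> I \<Longrightarrow> Sigma_Algebra.measure N (A i) = Sigma_Algebra.measure N' (B i) * c"
  shows "Sigma_Algebra.measure N (\<Union>i\<in>I. A i) = Sigma_Algebra.measure N' (\<Union>i\<in>I. B i) * c"
proof -
  have "emeasure N (\<Union>i\<in>I. A i) = (\<integral>\<^sup>+i. emeasure N (A i) \<partial>count_space I)"
    using A I by (intro emeasure_UN_countable)
  also have "\<dots> = (\<integral>\<^sup>+i. emeasure N' (B i) * ennreal c \<partial>count_space I)"
    using eq c by (intro nn_integral_cong)
      (simp add: finite_measure.emeasure_eq_measure[OF N] finite_measure.emeasure_eq_measure[OF N'] ennreal_mult')
  also have "\<dots> = (\<integral>\<^sup>+i. emeasure N' (B i) \<partial>count_space I) * ennreal c"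
    by (intro nn_integral_multc) simp
  also have "(\<integral>\<^sup>+i. emeasure N' (B i) \<partial>count_space I) = emeasure N' (\<Union>i\<in>I. B i)"
    using B I by (intro emeasure_UN_countable[symmetric])
  finally show ?thesis
    using c by (simp add: finite_measure.emeasure_eq_measure[OF N] finite_measure.emeasure_eq_measure[OF N']
        flip: ennreal_mult')
qed

text \<open>\<open>J\<close> is the label of the sink to be entered after the last exit: the set of Rabin properties
  satisfied by the path, or the label to which the scheduler has committed itself.\<close>

locale observed = rabin_mdp M k P + S: scheduled M \<sigma> + prob_space \<Omega>
  for M :: "('s, 'a) mdp" and k P \<sigma> and \<Omega> :: "'x measure" +
  fixes W :: "'x \<Rightarrow> nat \<Rightarrow> 's \<times> 'a" and J :: "'x \<Rightarrow> nat set"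
  assumes W_measurable [measurable]: "W \<in> \<Omega> \<rightarrow>\<^sub>M S.\<mu>"
    and distr_W: "distr \<Omega> S.\<mu> W = S.\<mu>"
    and J_measurable [measurable]: "J \<in> \<Omega> \<rightarrow>\<^sub>M count_space UNIV"
begin

lemma pred_W: "Measurable.pred \<Omega> (\<lambda>y. R (history n (W y)))"
  by (rule pred_count_space[OF measurable_compose[OF W_measurable S.history_measurable]])

lemma pred_W_next [measurable]: "Measurable.pred \<Omega> (\<lambda>y. R (history n (W y)) (W y n))"
  using pred_W[of "\<lambda>h. R (take n h) (last h)" "Suc n"] by simp

lemma pred_W_nth [measurable]: "Measurable.pred \<Omega> (\<lambda>y. R (W y n))"
  using pred_W_next[of "\<lambda>_. R"] .

lemma pred_J [measurable]: "Measurable.pred \<Omega> (\<lambda>y. R (J y))"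
  by (rule pred_count_space[OF J_measurable])

lemma pred_exited: "Measurable.pred \<Omega> (\<lambda>y. exited M hh (W y) n)"
  unfolding exited_def by (rule pred_W)

lemma pred_ex_exited [measurable]: "Measurable.pred \<Omega> (\<lambda>y. \<exists>n. exited M hh (W y) n)"
  using pred_exited by (rule pred_intros_countable)

lemma pred_entered [measurable]: "Measurable.pred \<Omega> (\<lambda>y. entered M hh q (W y))"
  unfolding entered_def exited_def
  by (rule pred_intros_countable)
    (rule pred_W_next[of "\<lambda>h x. (fresh M h \<and> exit_trace M h = hh) \<and> cls M (fst x) = q"])

lemma pred_next_label: "Measurable.pred \<Omega> (\<lambda>y. next_label M (W y) (J y) n m)"
proof (cases m)
  case (Act b)
  have "Measurable.pred \<Omega> (\<lambda>y. W y j \<in> exits M \<and> snd (W y j) = b)" for j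
    by (rule pred_W_nth)
  moreover have "Measurable.pred \<Omega> (\<lambda>y. W y i \<notin> exits M)" for i
    by (rule pred_W_nth)
  ultimately show ?thesis
    unfolding Act next_label.simps by measurable
next
  case (Tau I)
  have "Measurable.pred \<Omega> (\<lambda>y. W y i \<notin> exits M)" for i
    by (rule pred_W_nth)
  moreover have "Measurable.pred \<Omega> (\<lambda>y. J y = I)"
    by (rule pred_J)
  ultimately show ?thesis
    unfolding Tau next_label.simps by measurable
qed

lemma pred_labelled [measurable]: "Measurable.pred \<Omega> (\<lambda>y. labelled M hh q m (W y) (J y))"
  unfolding labelled_def
proof (intro pred_intros_countable pred_intros_logic)
  show "Measurable.pred \<Omega> (\<lambda>y. exited M hh (W y) n)" for n by (rule pred_exited)
  show "Measurable.pred \<Omega> (\<lambda>y. cls M (fst (W y n)) = q)" for n by (rule pred_W_nth)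
  show "Measurable.pred \<Omega> (\<lambda>y. next_label M (W y) (J y) n m)" for n by (rule pred_next_label)
qed

lemma prob_W:
  assumes "Measurable.pred S.\<mu> Q"
  shows "\<P>(y in \<Omega>. Q (W y)) = \<P>(\<omega> in S.\<mu>. Q \<omega>)"
proof -
  have "\<P>(\<omega> in S.\<mu>. Q \<omega>) = Sigma_Algebra.measure (distr \<Omega> S.\<mu> W) {\<omega> \<in> space S.\<mu>. Q \<omega>}"
    by (simp add: distr_W)
  also have "\<dots> = prob (W -` {\<omega> \<in> space S.\<mu>. Q \<omega>} \<inter> space \<Omega>)"
    using assms by (intro measure_distr W_measurable) (simp add: pred_def)
  also have "W -` {\<omega> \<in> space S.\<mu>. Q \<omega>} \<inter> space \<Omega> = {y \<in> space \<Omega>. Q (W y)}"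
    using measurable_space[OF W_measurable] by auto
  finally show ?thesis by simp
qed

lemma AE_W: "AE \<omega> in S.\<mu>. Q \<omega> \<Longrightarrow> AE y in \<Omega>. Q (W y)"
  by (rule AE_distrD[OF W_measurable]) (subst distr_W)

lemma AE_W_path: "AE y in \<Omega>. W y \<in> infinite_paths M \<and> fst (W y 0) = initial M"
  by (rule AE_W[OF S.AE_infinite_paths])

text \<open>Split according to the history of \<open>M\<close> at the moment of the exit. By
  \<open>quot_pair_inj\<close> all histories in question end with the same pair \<open>x\<close>, so
  the next class has the same law after each of them and the factor can be pulled out.\<close>

lemma prob_entered_snoc:
  assumes x: "x \<in> exits M"
  shows "\<P>(y in \<Omega>. entered M (hh @ [quot_pair M x]) q (W y)) =
    \<P>(y in \<Omega>. \<exists>n. exited M (hh @ [quot_pair M x]) (W y) n) * tprob M (fst x) (snd x) {t. cls M t = q}"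
proof -
  \<comment> \<open>Restricting to enabled pairs makes \<open>H\<close> countable; almost every path
    has only such histories.\<close>
  define H where "H = {h. set h \<subseteq> enabled M \<and> fresh M h \<and> exit_trace M h = hh @ [quot_pair M x]}"
  define A where "A h = {y \<in> space \<Omega>. history (length h) (W y) = h \<and> cls M (fst (W y (length h))) = q}" for h
  define B where "B h = {y \<in> space \<Omega>. history (length h) (W y) = h}" for h
  let ?c = "tprob M (fst x) (snd x) {t. cls M t = q}"
  have "H \<subseteq> lists S.C"
    using S.enabled_subset by (auto simp: H_def in_lists_conv_set)
  then have count: "countable H"
    using countable_lists[OF countable_finite[OF S.finite_C]] by (rule countable_subset)
  have A_meas: "A h \<in> events" for h
    unfolding A_def using pred_W_next[of "\<lambda>g x. g = h \<and> cls M (fst x) = q" "length h"] by (simp add: pred_def)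
  have B_meas: "B h \<in> events" for h
    unfolding B_def using pred_W[of "\<lambda>g. g = h" "length h"] by (simp add: pred_def)
  have uniq: "h = h'" if "h \<in> H" "h' \<in> H" "y \<in> B h" "y \<in> B h'" for h h' y
  proof -
    have "exited M (hh @ [quot_pair M x]) (W y) (length h)" "exited M (hh @ [quot_pair M x]) (W y) (length h')"
      using that by (auto simp: B_def H_def exited_def)
    from exited_unique[OF this] that show ?thesis by (simp add: B_def)
  qed
  have disj_B: "disjoint_family_on B H" and disj_A: "disjoint_family_on A H"
    using uniq by (auto simp: disjoint_family_on_def A_def B_def)
  have AB: "prob (A h) = prob (B h) * ?c" if h: "h \<in> H" for h
  proof -
    have ne: "h \<noteq> []" using h by (auto simp: H_def)
    obtain h' z where hz: "h = h' @ [z]" using ne by (metis append_butlast_last_id)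
    have z: "z \<in> exits M" using h by (auto simp: H_def fresh_def hz)
    have "z \<in> enabled M" "quot_pair M z = quot_pair M x"
      using h z by (auto simp: H_def hz)
    then have "z = x"
      using quot_pair_inj[OF dis] x exits_enabled by blast
    then have last: "last h = x" by (simp add: hz)
    have "prob (A h) = \<P>(\<omega> in S.\<mu>. history (length h) \<omega> = h \<and> fst (\<omega> (length h)) \<in> {t. cls M t = q})"
      unfolding A_def by (subst prob_W[symmetric]) (auto intro!: pred_intros_logic S.pred_history S.pred_coordinate)
    also have "\<dots> = \<P>(\<omega> in S.\<mu>. history (length h) \<omega> = h) * ?c"
      using ne last S.prob_next_state[of h "{t. cls M t = q}"] S.prob_history[of h] by simp
    also have "\<P>(\<omega> in S.\<mu>. history (length h) \<omega> = h) = prob (B h)"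
      unfolding B_def by (subst prob_W[symmetric]) (auto intro!: S.pred_history)
    finally show ?thesis .
  qed
  have UN: "\<Union>(A ` H) \<in> events" "\<Union>(B ` H) \<in> events"
    using A_meas B_meas count by auto
  have eq: "prob (\<Union>(A ` H)) = prob (\<Union>(B ` H)) * ?c"
    using A_meas B_meas disj_A disj_B tprob_nonneg AB
    by (intro measure_UN_scale finite_measure_axioms count)
  have H_iff: "exited M (hh @ [quot_pair M x]) \<omega> n \<longleftrightarrow> history n \<omega> \<in> H"
    if "\<omega> \<in> infinite_paths M" for \<omega> n
    using infinite_path_step(1)[OF that] by (auto simp: exited_def H_def history_def)
  have "prob (\<Union>(A ` H)) = \<P>(y in \<Omega>. entered M (hh @ [quot_pair M x]) q (W y))"
  proof (rule measure_eq_AE)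
    show "AE y in \<Omega>. y \<in> \<Union>(A ` H) \<longleftrightarrow> y \<in> {y \<in> space \<Omega>. entered M (hh @ [quot_pair M x]) q (W y)}"
      using AE_W_path AE_space
    proof eventually_elim
      case (elim y)
      have "y \<in> \<Union>(A ` H) \<longleftrightarrow> (\<exists>n. history n (W y) \<in> H \<and> cls M (fst (W y n)) = q)"
      proof
        assume "\<exists>n. history n (W y) \<in> H \<and> cls M (fst (W y n)) = q"
        then obtain n where "history n (W y) \<in> H" "cls M (fst (W y n)) = q" by blast
        with elim show "y \<in> \<Union>(A ` H)"
          by (intro UN_I[of "history n (W y)"]) (auto simp: A_def)
      next
        assume "y \<in> \<Union>(A ` H)"
        then obtain h where "h \<in> H" "y \<in> A h" by blast
        then show "\<exists>n. history n (W y) \<in> H \<and> cls M (fst (W y n)) = q"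
          by (intro exI[of _ "length h"]) (simp add: A_def)
      qed
      with elim show ?case by (simp add: entered_def H_iff)
    qed
  qed (use UN in auto)
  moreover have "prob (\<Union>(B ` H)) = \<P>(y in \<Omega>. \<exists>n. exited M (hh @ [quot_pair M x]) (W y) n)"
  proof (rule measure_eq_AE)
    show "AE y in \<Omega>. y \<in> \<Union>(B ` H) \<longleftrightarrow> y \<in> {y \<in> space \<Omega>. \<exists>n. exited M (hh @ [quot_pair M x]) (W y) n}"
      using AE_W_path AE_space
    proof eventually_elim
      case (elim y)
      have "y \<in> \<Union>(B ` H) \<longleftrightarrow> (\<exists>n. history n (W y) \<in> H)"
      proof
        assume "\<exists>n. history n (W y) \<in> H"
        then obtain n where "history n (W y) \<in> H" by blast
        with elim show "y \<in> \<Union>(B ` H)"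
          by (intro UN_I[of "history n (W y)"]) (auto simp: B_def)
      next
        assume "y \<in> \<Union>(B ` H)"
        then obtain h where "h \<in> H" "y \<in> B h" by blast
        then show "\<exists>n. history n (W y) \<in> H"
          by (intro exI[of _ "length h"]) (simp add: B_def)
      qed
      also have "\<dots> \<longleftrightarrow> (\<exists>n. exited M (hh @ [quot_pair M x]) (W y) n)"
        using H_iff elim by blast
      finally show ?case using elim by simp
    qed
  qed (use UN in auto)
  ultimately show ?thesis using eq by simp
qed

text \<open>The state factor in the recursion \<open>cylinder_prob_snoc\<close> of the
  quotient.\<close>

definition quot_step :: "('s qstate \<times> 'a qaction) list \<Rightarrow> 's qstate \<Rightarrow> real" where
  "quot_step hh q = (if hh = [] then (if q = initial Mh then 1 else 0)
     else tprob Mh (fst (last hh)) (snd (last hh)) {q})"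

lemma prob_entered:
  "\<P>(y in \<Omega>. entered M hh q (W y)) = \<P>(y in \<Omega>. \<exists>n. exited M hh (W y) n) * quot_step hh q"
proof (cases hh rule: rev_cases)
  case Nil
  have ex0: "exited M [] \<omega> 0" for \<omega>
    by (simp add: exited_def fresh_def)
  have ent: "entered M [] q \<omega> \<longleftrightarrow> cls M (fst (\<omega> 0)) = q" for \<omega> q
    using ex0 exited_unique[OF ex0] by (fastforce simp: entered_def)
  have init: "initial Mh = cls M (initial M)"
    by (simp add: mec_quotient_def quotient_def cls_def)
  have "\<P>(y in \<Omega>. entered M [] q (W y)) = (if q = initial Mh then 1 else 0)"
  proof (cases "q = initial Mh")
    case True
    have "AE y in \<Omega>. entered M [] q (W y)"
      using AE_W_path by eventually_elim (simp add: ent True init)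
    then have "\<P>(y in \<Omega>. entered M [] q (W y)) = 1" by (subst prob_Collect_eq_1) auto
    then show ?thesis using True by simp
  next
    case False
    have "AE y in \<Omega>. \<not> entered M [] q (W y)"
      using AE_W_path by eventually_elim (use False in \<open>auto simp: ent init\<close>)
    then have "\<P>(y in \<Omega>. entered M [] q (W y)) = 0" by (subst prob_Collect_eq_0) auto
    then show ?thesis using False by simp
  qed
  moreover have "\<P>(y in \<Omega>. \<exists>n. exited M [] (W y) n) = 1"
    using ex0 by (subst prob_Collect_eq_1) auto
  ultimately show ?thesis using Nil by (simp add: quot_step_def)
next
  case (snoc hh' z)
  show ?thesis
  proof (cases "\<exists>x\<in>exits M. z = quot_pair M x")
    case True
    then show ?thesis
      using prob_entered_snoc snoc by (auto simp: quot_step_def tprob_quot_pair_cls)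
  next
    case False
    then have "\<not> exited M hh \<omega> n" for \<omega> n
      by (auto simp: snoc exited_snoc)
    then show ?thesis by (simp add: entered_def)
  qed
qed

lemma prob_exited_snoc:
  "\<P>(y in \<Omega>. \<exists>n. exited M (hh @ [(q, Act b)]) (W y) n) = \<P>(y in \<Omega>. labelled M hh q (Act b) (W y) (J y))"
proof (rule prob_eq_AE)
  show "AE y in \<Omega>. (\<exists>n. exited M (hh @ [(q, Act b)]) (W y) n) \<longleftrightarrow> labelled M hh q (Act b) (W y) (J y)"
    using AE_W_path by eventually_elim (simp add: exited_snoc_iff_labelled)
qed (use pred_ex_exited pred_labelled in \<open>simp_all add: pred_def\<close>)

end

section \<open>Quotient histories before the first sink label\<close>

definition act_list :: "('q \<times> 'a qaction) list \<Rightarrow> bool" where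
  "act_list hh \<longleftrightarrow> (\<forall>z\<in>set hh. \<exists>b. snd z = Act b)"

lemma act_list_history: "act_list (history N \<omega>) \<longleftrightarrow> (\<forall>j<N. \<exists>b. snd (\<omega> j) = Act b)"
  unfolding act_list_def all_set_conv_all_nth by simp

lemma act_list_history_Tau:
  fixes \<omega> :: "nat \<Rightarrow> 'q \<times> 'a qaction"
  shows "act_list (history N \<omega>) \<longleftrightarrow> (\<forall>j<N. \<nexists>I. snd (\<omega> j) = Tau I)"
proof -
  have "(\<exists>b. m = Act b) \<longleftrightarrow> (\<nexists>I. m = Tau I)" for m :: "'a qaction"
    by (cases m) auto
  then show ?thesis unfolding act_list_history by simp
qed

lemma (in rabin_mdp) tprob_Act_Bot': "tprob Mh q (Act a) {Bot I} = 0"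
proof (cases q)
  case (Bot I')
  then show ?thesis by (simp add: tprob_def mec_quotient_def quotient_def)
qed (simp add: tprob_Act_Bot)

text \<open>A path of the quotient visits a sink iff it takes some \<open>Tau\<close>, and the sink is determined by
  the first one.\<close>

lemma (in rabin_mdp) reach_Bot_iff:
  assumes path: "\<omega> \<in> infinite_paths Mh" and init: "fst (\<omega> 0) = initial Mh"
  shows "(\<exists>n. fst (\<omega> n) \<in> Bot ` U) \<longleftrightarrow>
    (\<exists>N. act_list (history N \<omega>) \<and> (\<exists>I\<in>U. snd (\<omega> N) = Tau I))"
proof -
  note step = infinite_path_step[OF path]
  have cls: "\<exists>d. fst (\<omega> N) = Cls d" if act: "act_list (history N \<omega>)" for N
  proof (cases N)
    case 0
    then show ?thesis by (simp add: init mec_quotient_def quotient_def)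
  next
    case (Suc N')
    then obtain b where b: "snd (\<omega> N') = Act b"
      using act[unfolded act_list_history, rule_format, of N'] by auto
    have "fst (\<omega> N) \<noteq> Bot I" for I
      using step(2)[of N'] tprob_Act_Bot'[of "fst (\<omega> N')" b I] Suc b by auto
    then show ?thesis by (cases "fst (\<omega> N)") auto
  qed
  have bot: "fst (\<omega> m) = Bot I" if N: "act_list (history N \<omega>)" "snd (\<omega> N) = Tau I" "N < m" for N I m
    using Suc_leI[OF N(3)]
  proof (induction m rule: dec_induct)
    case base
    obtain d where d: "fst (\<omega> N) = Cls d" using cls N by blast
    then show ?case
      using step(2)[of N] N(2) by (cases "fst (\<omega> (Suc N))") (auto simp: tprob_Tau split: if_splits)
  next
    case (step m)
    have "(Bot I, snd (\<omega> m)) \<in> enabled Mh"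
      using infinite_path_step(1)[OF path, of m] step by (metis prod.collapse)
    then show ?case
      using infinite_path_step(2)[OF path, of m] step tprob_Bot[of I "snd (\<omega> m)"] by (auto split: if_splits)
  qed
  show ?thesis
  proof
    assume "\<exists>n. fst (\<omega> n) \<in> Bot ` U"
    then obtain n I where n: "fst (\<omega> n) = Bot I" "I \<in> U" by auto
    define N where "N = (LEAST N. \<exists>I. snd (\<omega> N) = Tau I)"
    have ex: "\<exists>j<n. \<exists>I. snd (\<omega> j) = Tau I"
    proof (rule ccontr)
      assume "\<not> ?thesis"
      then have "act_list (history n \<omega>)"
        unfolding act_list_history_Tau by blast
      then show False using cls n(1) by force
    qed
    then have N: "\<exists>I. snd (\<omega> N) = Tau I"
      unfolding N_def by (intro LeastI_ex[of "\<lambda>N. \<exists>I. snd (\<omega> N) = Tau I"]) blast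
    then obtain I' where I': "snd (\<omega> N) = Tau I'" ..
    have less: "\<nexists>I. snd (\<omega> j) = Tau I" if "j < N" for j
      using that unfolding N_def by (rule not_less_Least)
    then have act: "act_list (history N \<omega>)"
      unfolding act_list_history_Tau by blast
    have "N < n"
    proof (rule ccontr)
      assume "\<not> N < n"
      then show False using ex less by fastforce
    qed
    then have "I' = I" using bot[OF act I'] n(1) by simp
    with act I' n(2) show "\<exists>N. act_list (history N \<omega>) \<and> (\<exists>I\<in>U. snd (\<omega> N) = Tau I)" by blast
  next
    assume "\<exists>N. act_list (history N \<omega>) \<and> (\<exists>I\<in>U. snd (\<omega> N) = Tau I)"
    then show "\<exists>n. fst (\<omega> n) \<in> Bot ` U" using bot lessI by blast
  qed
qed

text \<open>The last assumption says that \<open>\<sigma>h\<close> is the conditional distribution of the next label given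
  the exits so far and the class entered.\<close>

locale coupled = observed M k P \<sigma> \<Omega> W J + H: scheduled "mec_quotient M k P" \<sigma>h
  for M :: "('s, 'a) mdp" and k P \<sigma> and \<Omega> :: "'x measure" and W J \<sigma>h +
  assumes J_subset: "AE y in \<Omega>. J y \<subseteq> {1..k}"
    and prob_labelled: "\<And>hh q m. \<P>(y in \<Omega>. labelled M hh q m (W y) (J y)) =
      \<P>(y in \<Omega>. entered M hh q (W y)) * pmf (\<sigma>h hh q) m"
begin

lemma cylinder_prob_snoc_labelled:
  assumes "cylinder_prob Mh \<sigma>h hh = \<P>(y in \<Omega>. \<exists>n. exited M hh (W y) n)"
  shows "cylinder_prob Mh \<sigma>h (hh @ [(q, m)]) = \<P>(y in \<Omega>. labelled M hh q m (W y) (J y))"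
  unfolding cylinder_prob_snoc prob_labelled prob_entered assms by (simp add: quot_step_def)

text \<open>In each step \<open>prob_entered\<close> supplies the state factor and
  \<open>prob_labelled\<close> the label factor. Words with a \<open>Tau\<close> are excluded, since
  behind it the quotient path has no counterpart in \<open>M\<close>.\<close>

lemma cylinder_prob_exited:
  "act_list hh \<Longrightarrow> cylinder_prob Mh \<sigma>h hh = \<P>(y in \<Omega>. \<exists>n. exited M hh (W y) n)"
proof (induction hh rule: rev_induct)
  case Nil
  have "exited M [] \<omega> 0" for \<omega>
    by (simp add: exited_def fresh_def)
  then have "\<P>(y in \<Omega>. \<exists>n. exited M [] (W y) n) = 1"
    by (subst prob_Collect_eq_1) auto
  then show ?case by (simp add: cylinder_prob_Nil)
next
  case (snoc z hh)
  obtain q b where z: "z = (q, Act b)"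
    using snoc.prems by (cases z) (auto simp: act_list_def)
  have "act_list hh" using snoc.prems by (simp add: act_list_def)
  from cylinder_prob_snoc_labelled[OF snoc.IH[OF this]] show ?case
    by (simp add: z prob_exited_snoc)
qed

text \<open>Both events are split by the quotient history up to the first \<open>Tau\<close>, and
  corresponding cells have the same probability. On the side of \<open>M\<close> the cells exhaust
  almost everything, because there is almost surely a last exit; for \<open>U = UNIV\<close> this
  says that a sink is reached with probability 1.\<close>

lemma prob_reach:
  "Sigma_Algebra.measure H.\<mu> (reach Mh (Bot ` U)) = \<P>(y in \<Omega>. J y \<in> U)"
proof -
  \<comment> \<open>Each word stops at its first \<open>Tau\<close>, so none is a proper prefix of
    another and the cylinders are disjoint.\<close>
  define Z where "Z = {g \<in> lists H.C. g \<noteq> [] \<and> act_list (butlast g) \<and> (\<exists>I\<in>U. snd (last g) = Tau I)}"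
  define A where "A g = {\<omega> \<in> space H.\<mu>. history (length g) \<omega> = g}" for g
  define B where "B g = {y \<in> space \<Omega>. labelled M (butlast g) (fst (last g)) (snd (last g)) (W y) (J y)}" for g
  have count: "countable Z"
    using countable_lists[OF countable_finite[OF H.finite_C]] by (rule countable_subset[rotated]) (auto simp: Z_def)
  have A_meas: "A g \<in> sets H.\<mu>" for g
    unfolding A_def using H.pred_history[of "\<lambda>h. h = g"] by (simp add: pred_def)
  have B_meas: "B g \<in> events" for g
    unfolding B_def using pred_labelled by (simp add: pred_def)
  have mu_eq: "H.prob (A g) = prob (B g)" if "g \<in> Z" for g
  proof -
    have "g = butlast g @ [(fst (last g), snd (last g))]" "act_list (butlast g)"
      using that by (auto simp: Z_def)
    then have "cylinder_prob Mh \<sigma>h g = prob (B g)"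
      using cylinder_prob_snoc_labelled[OF cylinder_prob_exited] unfolding B_def by metis
    then show ?thesis by (simp add: A_def H.prob_history)
  qed
  have A_iff: "\<omega> \<in> A g \<and> g \<in> Z \<longleftrightarrow> \<omega> \<in> space H.\<mu> \<and> (\<exists>N. g = history (Suc N) \<omega> \<and> act_list (history N \<omega>) \<and>
      (\<exists>I\<in>U. snd (\<omega> N) = Tau I))" for \<omega> g
  proof
    assume g: "\<omega> \<in> A g \<and> g \<in> Z"
    then obtain N where "length g = Suc N" by (cases "length g") (auto simp: Z_def)
    then have gN: "g = history (Suc N) \<omega>" using g by (simp add: A_def)
    have "act_list (butlast g)" "\<exists>I\<in>U. snd (last g) = Tau I" "\<omega> \<in> space H.\<mu>"
      using g by (simp_all add: A_def Z_def)
    moreover have "butlast g = history N \<omega>" "last g = \<omega> N"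
      unfolding gN by (simp_all add: history_Suc)
    ultimately have "act_list (history N \<omega>)" "\<exists>I\<in>U. snd (\<omega> N) = Tau I" "\<omega> \<in> space H.\<mu>"
      by simp_all
    with gN show "\<omega> \<in> space H.\<mu> \<and> (\<exists>N. g = history (Suc N) \<omega> \<and> act_list (history N \<omega>) \<and>
      (\<exists>I\<in>U. snd (\<omega> N) = Tau I))"
      by blast
  next
    assume r: "\<omega> \<in> space H.\<mu> \<and> (\<exists>N. g = history (Suc N) \<omega> \<and> act_list (history N \<omega>) \<and>
      (\<exists>I\<in>U. snd (\<omega> N) = Tau I))"
    then have "g \<in> lists H.C"
      using H.set_history_subset[of \<omega>] by (auto simp: in_lists_conv_set)
    with r show "\<omega> \<in> A g \<and> g \<in> Z"
      by (auto simp: A_def Z_def history_Suc)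
  qed
  have disj_A: "disjoint_family_on A Z"
  proof -
    have False if "act_list (history N' \<omega>)" "snd (\<omega> N) = Tau I" "N < N'" for \<omega> :: "nat \<Rightarrow> 's qstate \<times> 'a qaction" and N N' I
    proof -
      show False using that unfolding act_list_history_Tau by blast
    qed
    note less = this
    have "g = g'" if g: "g \<in> Z" "g' \<in> Z" "\<omega> \<in> A g" "\<omega> \<in> A g'" for g g' \<omega>
    proof -
      obtain N N' I I' where N: "g = history (Suc N) \<omega>" "act_list (history N \<omega>)" "snd (\<omega> N) = Tau I"
        and N': "g' = history (Suc N') \<omega>" "act_list (history N' \<omega>)" "snd (\<omega> N') = Tau I'"
        using A_iff[of \<omega> g] A_iff[of \<omega> g'] g by blast
      have "\<not> N < N'" "\<not> N' < N"
        using less[OF N'(2) N(3)] less[OF N(2) N'(3)] by blast+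
      then show ?thesis using N(1) N'(1) by simp
    qed
    then show ?thesis unfolding disjoint_family_on_def by blast
  qed
  have disj_B: "disjoint_family_on B Z"
  proof -
    have "g = g'" if g: "g \<in> Z" "g' \<in> Z" and y: "y \<in> B g" "y \<in> B g'" for g g' y
    proof -
      obtain I I' where I: "snd (last g) = Tau I" "snd (last g') = Tau I'"
        using g unfolding Z_def by blast
      have "labelled M (butlast g) (fst (last g)) (Tau I) (W y) (J y)"
        "labelled M (butlast g') (fst (last g')) (Tau I') (W y) (J y)"
        using y I by (simp_all add: B_def)
      from labelled_Tau_unique[OF this] have u: "butlast g = butlast g'" "fst (last g) = fst (last g')" "I = I'"
        by blast+
      have eq: "last g = last g'"
        using u I by (intro prod_eqI) simp_all
      have "g = butlast g @ [last g]" using g by (simp add: Z_def)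
      also have "\<dots> = butlast g' @ [last g']" by (simp only: eq u(1))
      also have "\<dots> = g'" using g by (simp add: Z_def)
      finally show ?thesis .
    qed
    then show ?thesis unfolding disjoint_family_on_def by blast
  qed
  have "Sigma_Algebra.measure H.\<mu> (\<Union>(A ` Z)) = prob (\<Union>(B ` Z))"
    using measure_UN_scale[OF H.finite_measure_axioms finite_measure_axioms count, of A B 1]
      A_meas B_meas disj_A disj_B mu_eq by simp
  moreover have "Sigma_Algebra.measure H.\<mu> (\<Union>(A ` Z)) = Sigma_Algebra.measure H.\<mu> (reach Mh (Bot ` U))"
  proof (rule measure_eq_AE)
    show "AE \<omega> in H.\<mu>. \<omega> \<in> \<Union>(A ` Z) \<longleftrightarrow> \<omega> \<in> reach Mh (Bot ` U)"
      using H.AE_infinite_paths AE_space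
    proof eventually_elim
      case (elim \<omega>)
      have "\<omega> \<in> \<Union>(A ` Z) \<longleftrightarrow> (\<exists>g. \<omega> \<in> A g \<and> g \<in> Z)" by auto
      also have "\<dots> \<longleftrightarrow> (\<exists>N. act_list (history N \<omega>) \<and> (\<exists>I\<in>U. snd (\<omega> N) = Tau I))"
        using elim by (auto simp: A_iff)
      also have "\<dots> \<longleftrightarrow> (\<exists>n. fst (\<omega> n) \<in> Bot ` U)"
        using reach_Bot_iff elim by blast
      finally show ?case using elim by (simp add: reach_def)
    qed
    show "reach Mh (Bot ` U) \<in> sets H.\<mu>" by (rule H.reach_measurable)
  qed (use A_meas count in auto)
  moreover have "prob (\<Union>(B ` Z)) = \<P>(y in \<Omega>. J y \<in> U)"
  proof (rule measure_eq_AE)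
    show "AE y in \<Omega>. y \<in> \<Union>(B ` Z) \<longleftrightarrow> y \<in> {y \<in> space \<Omega>. J y \<in> U}"
      using AE_W_path AE_W[OF S.AE_eventually_no_exit] AE_space J_subset
    proof eventually_elim
      case (elim y)
      obtain n0 where n0: "\<forall>n\<ge>n0. W y n \<notin> exits M" using elim by blast
      show ?case
      proof
        assume "y \<in> \<Union>(B ` Z)"
        then show "y \<in> {y \<in> space \<Omega>. J y \<in> U}"
          by (auto simp: B_def Z_def labelled_def)
      next
        assume y: "y \<in> {y \<in> space \<Omega>. J y \<in> U}"
        obtain n where n: "n \<le> n0" "exited M (exit_trace M (history n0 (W y))) (W y) n"
          "\<forall>i. n \<le> i \<and> i < n0 \<longrightarrow> W y i \<notin> exits M"
          using ex_last_fresh by blast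
        let ?hh = "exit_trace M (history n0 (W y))"
        \<comment> \<open>By \<open>J_subset\<close> the final label is an action of the quotient,
          which puts this word into \<open>Z\<close>.\<close>
        let ?g = "?hh @ [(cls M (fst (W y n)), Tau (J y))]"
        have "next_label M (W y) (J y) n (Tau (J y))"
          using n(3) n0 by (metis next_label.simps(2) not_less)
        then have "y \<in> B ?g"
          using n y by (auto simp: B_def labelled_def)
        moreover have "?g \<in> Z"
        proof -
          have "quot_pair M x \<in> H.C" if "x \<in> exits M" for x
            using that H.enabled_subset enabled_Act by (auto simp: quot_pair_def)
          then have "?hh \<in> lists H.C"
            by (auto simp: exit_trace_def in_lists_conv_set simp del: mem_Sigma_iff)
          moreover have "fst (W y n) \<in> states M"
            using infinite_path_step(1)[of "W y" M n] elim by (auto simp: enabled_def)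
          then have "(cls M (fst (W y n)), Tau (J y)) \<in> H.C"
            using mec_class_in[of "fst (W y n)" M] elim by (auto simp: cls_def mec_quotient_def quotient_def)
          moreover have "act_list ?hh"
            by (auto simp: act_list_def exit_trace_def quot_pair_def)
          ultimately show ?thesis using y by (auto simp: Z_def)
        qed
        ultimately show "y \<in> \<Union>(B ` Z)" by blast
      qed
    qed
  qed (use B_meas count pred_J in \<open>auto simp: pred_def\<close>)
  ultimately show ?thesis by simp
qed

end

section \<open>From the MDP to its quotient\<close>

lemma measurable_index_set:
  assumes K: "finite K" and Q: "\<And>i. i \<in> K \<Longrightarrow> Measurable.pred N (Q i)"
  shows "(\<lambda>x. {i \<in> K. Q i x}) \<in> N \<rightarrow>\<^sub>M count_space UNIV"
proof -
  have "(\<lambda>x. {i \<in> K. Q i x}) \<in> N \<rightarrow>\<^sub>M count_space (Pow K)"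
  proof (subst measurable_count_space_eq2, simp add: K, intro conjI ballI)
    fix I assume "I \<in> Pow K"
    then have "(\<lambda>x. {i \<in> K. Q i x}) -` {I} \<inter> space N = {x \<in> space N. \<forall>i\<in>K. Q i x \<longleftrightarrow> i \<in> I}"
      by auto
    also have "\<dots> \<in> sets N"
      using K Q by (intro sets.sets_Collect_finite_All) (auto simp: pred_def)
    finally show "(\<lambda>x. {i \<in> K. Q i x}) -` {I} \<inter> space N \<in> sets N" .
  qed auto
  from measurable_compose[OF this, of "\<lambda>x. x" "count_space UNIV"] show ?thesis by simp
qed

lemma (in scheduled) rabin_measurable:
  assumes "finite R"
  shows "rabin M R \<in> sets \<mu>"
proof -
  have "rabin M R = {\<omega> \<in> space \<mu>. (\<forall>n. \<omega> n \<in> enabled M \<and>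
      tprob M (fst (\<omega> n)) (snd (\<omega> n)) {fst (\<omega> (Suc n))} > 0) \<and>
      (\<exists>x\<in>R. (\<forall>n. \<exists>m. m \<ge> n \<and> fst (\<omega> m) \<in> fst x) \<and> (\<exists>n. \<forall>m. m \<ge> n \<longrightarrow> fst (\<omega> m) \<in> snd x))}"
    using enabled_subset
    by (auto simp: rabin_def infinite_paths_def space_\<mu> case_prod_unfold simp del: mem_Sigma_iff)
  also have "\<dots> \<in> sets \<mu>"
    unfolding pred_def[symmetric]
    by (intro pred_intros_logic pred_intros_countable pred_intros_finite assms pred_coordinate
        pred_coordinate2[of "\<lambda>x y. tprob M (fst x) (snd x) {fst y} > 0"])
  finally show ?thesis .
qed

text \<open>\<open>streett\<close> is a complement within the infinite paths only, but these have
  full measure.\<close>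

lemma (in scheduled) prob_streett:
  assumes "finite R"
  shows "prob (streett M R) = \<P>(\<omega> in \<mu>. \<omega> \<notin> rabin M R)"
proof (rule measure_eq_AE)
  have inf: "infinite_paths M \<in> sets \<mu>"
    using reach_measurable[of UNIV] by (simp add: reach_def)
  have sub: "rabin M R \<in> sets \<mu>" by (rule rabin_measurable[OF assms])
  show "AE \<omega> in \<mu>. \<omega> \<in> streett M R \<longleftrightarrow> \<omega> \<in> {\<omega> \<in> space \<mu>. \<omega> \<notin> rabin M R}"
    using AE_infinite_paths AE_space by eventually_elim (auto simp: streett_def)
  show "streett M R \<in> sets \<mu>" unfolding streett_def using inf sub by auto
  have "{\<omega> \<in> space \<mu>. \<omega> \<notin> rabin M R} = space \<mu> - rabin M R" by auto
  then show "{\<omega> \<in> space \<mu>. \<omega> \<notin> rabin M R} \<in> sets \<mu>" using sub by auto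
qed

lemma (in rabin_mdp) finite_P: "i \<in> {1..k} \<Longrightarrow> finite (P i)"
  by (rule finite_subset[OF P]) (use M in \<open>auto simp: mdp_def\<close>)

lemma (in rabin_mdp) cls_state: "s \<in> states M \<Longrightarrow> cls M s \<in> states Mh"
  using mec_class_in[of s M] by (auto simp: cls_def mec_quotient_def quotient_def)

text \<open>The quotient scheduler chooses its next label with the conditional probability that the path
  of \<open>M\<close>, given its exits so far, leaves the current class by this action, respectively stays there
  forever and satisfies exactly these Rabin properties.\<close>

lemma (in rabin_mdp) ex_quotient_scheduler:
  assumes \<sigma>: "scheduler M \<sigma>"
  shows "\<exists>\<sigma>h. scheduler Mh \<sigma>h \<and> (\<forall>U. Sigma_Algebra.measure (path_measure Mh \<sigma>h) (reach Mh (Bot ` U)) =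
    \<P>(\<omega> in path_measure M \<sigma>. {i \<in> {1..k}. \<omega> \<in> rabin M (P i)} \<in> U))"
proof -
  interpret S: scheduled M \<sigma> using M \<sigma> by unfold_locales
  define J where "J \<omega> = {i \<in> {1..k}. \<omega> \<in> rabin M (P i)}" for \<omega>
  have J_meas: "J \<in> S.\<mu> \<rightarrow>\<^sub>M count_space UNIV"
    unfolding J_def
  proof (rule measurable_index_set, simp)
    fix i assume "i \<in> {1..k}"
    then have "{\<omega> \<in> space S.\<mu>. \<omega> \<in> rabin M (P i)} = rabin M (P i)"
      using S.rabin_measurable[OF finite_P] sets.sets_into_space by blast
    then show "Measurable.pred S.\<mu> (\<lambda>\<omega>. \<omega> \<in> rabin M (P i))"
      using S.rabin_measurable[OF finite_P] \<open>i \<in> {1..k}\<close> by (simp add: pred_def)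
  qed
  interpret O: observed M k P \<sigma> S.\<mu> "\<lambda>\<omega>. \<omega>" J
    by unfold_locales (use J_meas in \<open>simp_all add: distr_id\<close>)
  have ach: "AE \<omega> in S.\<mu>. \<forall>n. (\<forall>j\<ge>n. \<omega> j \<notin> exits M) \<longrightarrow>
      (mec_class M (fst (\<omega> n)), J \<omega>) \<in> achievable M k P"
    using S.AE_eventually_MEC S.AE_end_component S.AE_infinite_paths
  proof (eventually_elim, intro allI impI)
    fix \<omega> n assume "\<exists>E n0. MEC M E \<and> limit_pairs \<omega> \<subseteq> E \<and> (\<forall>n\<ge>n0. \<omega> n \<in> limit_pairs \<omega>)"
      and ec: "end_component M (limit_pairs \<omega>)" and path: "\<omega> \<in> infinite_paths M \<and> fst (\<omega> 0) = initial M"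
      and no: "\<forall>j\<ge>n. \<omega> j \<notin> exits M"
    then obtain E n0 where E: "MEC M E" "limit_pairs \<omega> \<subseteq> E" and n0: "\<And>n. n \<ge> n0 \<Longrightarrow> \<omega> n \<in> limit_pairs \<omega>"
      by blast
    have "mec_class M (fst (\<omega> n)) = mec_class M (fst (\<omega> (max n n0)))"
      using path no by (intro class_no_exit[symmetric]) auto
    also have "\<dots> = fst ` E"
      using n0[of "max n n0"] E by (intro mec_class_MEC) auto
    finally have cl: "mec_class M (fst (\<omega> n)) = fst ` E" .
    \<comment> \<open>Beyond \<open>n0\<close> every visit to \<open>F\<close> is at a limit state,
      and a limit state recurs after the path has settled in \<open>G\<close>.\<close>
    have "ec_rabin (limit_pairs \<omega>) (P i)" if rabin: "\<omega> \<in> rabin M (P i)" for i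
    proof -
      obtain F G where FG: "(F, G) \<in> P i" "\<forall>n. \<exists>m\<ge>n. fst (\<omega> m) \<in> F" "\<exists>n. \<forall>m\<ge>n. fst (\<omega> m) \<in> G"
        using rabin unfolding rabin_def by blast
      obtain m where "m \<ge> n0" "fst (\<omega> m) \<in> F" using FG(2) by blast
      then have "fst ` limit_pairs \<omega> \<inter> F \<noteq> {}" using n0[of m] by blast
      moreover have "fst ` limit_pairs \<omega> \<subseteq> G"
      proof (intro image_subsetI)
        fix x assume "x \<in> limit_pairs \<omega>"
        moreover obtain n' where "\<forall>m\<ge>n'. fst (\<omega> m) \<in> G" using FG(3) by blast
        ultimately show "fst x \<in> G" unfolding limit_pairs_def INFM_nat_le by blast
      qed
      ultimately show ?thesis using FG(1) unfolding ec_rabin_def by blast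
    qed
    then have "J \<omega> \<subseteq> {1..k}" "\<forall>i\<in>J \<omega>. ec_rabin (limit_pairs \<omega>) (P i)"
      by (auto simp: J_def)
    then show "(mec_class M (fst (\<omega> n)), J \<omega>) \<in> achievable M k P"
      unfolding achievable_def cl using E ec
      by (intro CollectI exI[of _ E] exI[of _ "J \<omega>"] conjI exI[of _ "limit_pairs \<omega>"] refl)
  qed
  have lab_en: "AE \<omega> in S.\<mu>. \<forall>hh q m. labelled M hh q m \<omega> (J \<omega>) \<longrightarrow> (q, m) \<in> enabled Mh"
    using ach S.AE_infinite_paths
  proof (eventually_elim, intro allI impI)
    fix \<omega> hh q m
    assume a: "\<forall>n. (\<forall>j\<ge>n. \<omega> j \<notin> exits M) \<longrightarrow> (mec_class M (fst (\<omega> n)), J \<omega>) \<in> achievable M k P"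
      and path: "\<omega> \<in> infinite_paths M \<and> fst (\<omega> 0) = initial M" and "labelled M hh q m \<omega> (J \<omega>)"
    then obtain n where n: "cls M (fst (\<omega> n)) = q" "next_label M \<omega> (J \<omega>) n m"
      by (auto simp: labelled_def)
    show "(q, m) \<in> enabled Mh"
    proof (cases m)
      case (Act b)
      then obtain j where j: "n \<le> j" "\<omega> j \<in> exits M" "snd (\<omega> j) = b" "\<forall>i. n \<le> i \<and> i < j \<longrightarrow> \<omega> i \<notin> exits M"
        using n(2) by auto
      have "mec_class M (fst (\<omega> j)) = mec_class M (fst (\<omega> n))"
        using path j by (intro class_no_exit) auto
      then have "quot_pair M (\<omega> j) = (q, m)"
        using n(1) j(3) Act by (simp add: quot_pair_def cls_def)
      then show ?thesis
        using j(2) enabled_Act n(1) Act unfolding cls_def by metis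
    next
      case (Tau I)
      then show ?thesis using n a enabled_Tau by (auto simp: cls_def)
    qed
  qed
  define A where "A q = {m. (q, m) \<in> enabled Mh}" for q
  have fin_A: "finite (A q)" for q
    by (rule finite_subset[of _ "actions Mh"])
      (use mdp_mec_quotient[OF M, of k P] in \<open>auto simp: A_def enabled_def mdp_def\<close>)
  define e where "e hh q m = \<P>(\<omega> in S.\<mu>. labelled M hh q m \<omega> (J \<omega>))" for hh q m
  \<comment> \<open>Up to a null set exactly one enabled label follows each entry. The label weights
    thus add up to the entry weight, and \<open>ex_pmf_proportional\<close> gives the conditional
    distribution.\<close>
  have sum: "\<P>(\<omega> in S.\<mu>. entered M hh q \<omega>) = (\<Sum>m\<in>A q. e hh q m)" for hh q
    unfolding e_def
  proof (rule S.prob_sum)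
    show "AE \<omega> in S.\<mu>. (\<forall>m\<in>A q. labelled M hh q m \<omega> (J \<omega>) \<longrightarrow> entered M hh q \<omega>) \<and>
        (entered M hh q \<omega> \<longrightarrow> (\<exists>!m. m \<in> A q \<and> labelled M hh q m \<omega> (J \<omega>)))"
      using lab_en
    proof (eventually_elim, intro conjI ballI impI)
      fix \<omega> m assume "labelled M hh q m \<omega> (J \<omega>)"
      then show "entered M hh q \<omega>" by (auto simp: labelled_def entered_def)
    next
      fix \<omega> assume en: "\<forall>hh q m. labelled M hh q m \<omega> (J \<omega>) \<longrightarrow> (q, m) \<in> enabled Mh"
        and "entered M hh q \<omega>"
      then obtain m where "labelled M hh q m \<omega> (J \<omega>)"
        using ex_next_label unfolding entered_def labelled_def by metis
      then show "\<exists>!m. m \<in> A q \<and> labelled M hh q m \<omega> (J \<omega>)"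
        using en entered_labelled_unique[of M hh q _ \<omega> "J \<omega>"] unfolding A_def by blast
    qed
  qed (use O.pred_labelled O.pred_entered in \<open>simp_all add: pred_def fin_A\<close>)
  have df: "A q \<noteq> {}" if "q \<in> states Mh" for q
    using deadlock_free_quotient[OF scheduler_deadlock_free[OF \<sigma>] that] by (auto simp: A_def)
  have e0: "0 \<le> e hh q m" for hh q m
    by (simp add: e_def)
  define good where "good hh q p \<longleftrightarrow> set_pmf p \<subseteq> A q \<and>
      (\<forall>m\<in>A q. e hh q m = \<P>(\<omega> in S.\<mu>. entered M hh q \<omega>) * pmf p m)" for hh q p
  define \<sigma>h where "\<sigma>h hh q = (SOME p. good hh q p)" for hh q
  have "\<exists>p. good hh q p" if "q \<in> states Mh" for hh q
    unfolding good_def sum by (rule ex_pmf_proportional[OF fin_A df[OF that] e0])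
  then have good: "good hh q (\<sigma>h hh q)" if "q \<in> states Mh" for hh q
    unfolding \<sigma>h_def using that by (simp add: someI_ex)
  have \<sigma>h: "set_pmf (\<sigma>h hh q) \<subseteq> A q"
    "m \<in> A q \<Longrightarrow> e hh q m = \<P>(\<omega> in S.\<mu>. entered M hh q \<omega>) * pmf (\<sigma>h hh q) m"
    if "q \<in> states Mh" for hh q m
    using good[OF that, of hh] unfolding good_def by blast+
  have sched: "scheduler Mh \<sigma>h"
    unfolding scheduler_def
  proof (intro allI impI)
    fix hh q assume "finite_path Mh hh q"
    then have "q \<in> states Mh" by (rule finite_path_state[OF mdp_mec_quotient[OF M]])
    from \<sigma>h(1)[OF this, of hh] show "set_pmf (\<sigma>h hh q) \<subseteq> {m. (q, m) \<in> enabled Mh}"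
      by (simp add: A_def)
  qed
  have lab: "e hh q m = \<P>(\<omega> in S.\<mu>. entered M hh q \<omega>) * pmf (\<sigma>h hh q) m" for hh q m
  proof (cases "q \<in> states Mh")
    case True
    show ?thesis
    proof (cases "m \<in> A q")
      case False
      have "AE \<omega> in S.\<mu>. \<not> labelled M hh q m \<omega> (J \<omega>)"
        using lab_en by eventually_elim (use False in \<open>auto simp: A_def\<close>)
      then have "e hh q m = 0"
        unfolding e_def using O.pred_labelled by (subst S.prob_Collect_eq_0) (auto simp: pred_def)
      moreover have "pmf (\<sigma>h hh q) m = 0"
        using False \<sigma>h(1)[OF True] by (meson set_pmf_iff subsetD)
      ultimately show ?thesis by simp
    qed (use \<sigma>h(2) True in blast)
  next
    \<comment> \<open>No path enters a non-state, and the label weight is at most the entry weight,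
      so both sides are 0.\<close>
    case False
    have "AE \<omega> in S.\<mu>. \<not> entered M hh q \<omega>"
      using S.AE_infinite_paths
    proof eventually_elim
      case (elim \<omega>)
      have "fst (\<omega> n) \<in> states M" for n
        using infinite_path_step(1)[of \<omega> M n] elim by (auto simp: enabled_def)
      then show ?case using False cls_state by (auto simp: entered_def)
    qed
    then have en0: "\<P>(\<omega> in S.\<mu>. entered M hh q \<omega>) = 0"
      using O.pred_entered by (subst S.prob_Collect_eq_0) (auto simp: pred_def)
    have "e hh q m \<le> \<P>(\<omega> in S.\<mu>. entered M hh q \<omega>)"
      unfolding e_def using O.pred_entered
      by (intro S.finite_measure_mono) (auto simp: pred_def labelled_def entered_def)
    then have "e hh q m = 0"
      using en0 by (simp add: e_def measure_le_0_iff)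
    with en0 show ?thesis by simp
  qed
  interpret coupled M k P \<sigma> S.\<mu> "\<lambda>\<omega>. \<omega>" J \<sigma>h
  proof unfold_locales
    show "mdp Mh" by (rule mdp_mec_quotient[OF M])
    show "scheduler Mh \<sigma>h" by (rule sched)
    show "AE \<omega> in S.\<mu>. J \<omega> \<subseteq> {1..k}" by (auto simp: J_def)
    show "\<P>(\<omega> in S.\<mu>. labelled M hh q m \<omega> (J \<omega>)) = \<P>(\<omega> in S.\<mu>. entered M hh q \<omega>) * pmf (\<sigma>h hh q) m" for hh q m
      using lab by (simp add: e_def)
  qed
  show ?thesis
    using sched prob_reach unfolding J_def by blast
qed

section \<open>From the quotient to the MDP\<close>

lemma prob_bind_Pair:
  assumes "\<And>s. s \<in> set_pmf p \<Longrightarrow> s \<in> T \<Longrightarrow> measure_pmf.prob (f s) B = c"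
  shows "measure_pmf.prob (bind_pmf p (\<lambda>s. map_pmf (Pair s) (f s))) (T \<times> B) = measure_pmf.prob p T * c"
\<comment> \<open>If \<open>p\<close> does not charge \<open>T\<close>, the assumption says nothing
  about \<open>c\<close>, which might be negative; only the other case yields
  \<open>0 \<le> c\<close>.\<close>
proof (cases "set_pmf p \<inter> T = {}")
  case True
  then have "set_pmf (bind_pmf p (\<lambda>s. map_pmf (Pair s) (f s))) \<inter> T \<times> B = {}"
    by auto
  then have "measure_pmf.prob (bind_pmf p (\<lambda>s. map_pmf (Pair s) (f s))) (T \<times> B) = 0"
    by (subst measure_pmf_zero_iff)
  moreover have "measure_pmf.prob p T = 0"
    by (subst measure_pmf_zero_iff) (rule True)
  ultimately show ?thesis by simp
next
  case False
  then obtain s0 where "s0 \<in> set_pmf p" "s0 \<in> T" by blast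
  then have c: "0 \<le> c" using assms[of s0] by (metis measure_nonneg)
  have "emeasure (bind_pmf p (\<lambda>s. map_pmf (Pair s) (f s))) (T \<times> B) =
      (\<integral>\<^sup>+s. emeasure (map_pmf (Pair s) (f s)) (T \<times> B) \<partial>measure_pmf p)"
    by simp
  also have "\<dots> = (\<integral>\<^sup>+s. ennreal c * indicator T s \<partial>measure_pmf p)"
  proof (rule nn_integral_cong_AE, unfold AE_measure_pmf_iff, intro ballI)
    fix s assume s: "s \<in> set_pmf p"
    have "Pair s -` (T \<times> B) = (if s \<in> T then B else {})" by auto
    then show "emeasure (map_pmf (Pair s) (f s)) (T \<times> B) = ennreal c * indicator T s"
      using assms[OF s] by (simp add: measure_pmf.emeasure_eq_measure)
  qed
  also have "\<dots> = ennreal c * emeasure p T"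
    by (intro nn_integral_cmult_indicator) simp
  finally show ?thesis
    using c by (simp add: measure_pmf.emeasure_eq_measure mult.commute flip: ennreal_mult')
qed

text \<open>Meant for \<open>T\<close> a whole class and \<open>B\<close> fixing the remembered
  label: that label is drawn with the same probability in all states of the class, which factors
  out.\<close>

lemma (in scheduled) prob_next_action:
  assumes "\<And>s. s \<in> T \<Longrightarrow> cylinder_prob M \<sigma> h > 0 \<Longrightarrow> measure_pmf.prob (\<sigma> h s) B = c"
  shows "\<P>(\<omega> in \<mu>. history (length h) \<omega> = h \<and> \<omega> (length h) \<in> T \<times> B) =
    \<P>(\<omega> in \<mu>. history (length h) \<omega> = h \<and> fst (\<omega> (length h)) \<in> T) * c"
proof (cases "cylinder_prob M \<sigma> h = 0")
  case True
  then show ?thesis using prob_next[of h] prob_next_state[of h] by simp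
next
  case False
  then have pos: "cylinder_prob M \<sigma> h > 0"
    using cylinder_prob_nonneg[of M \<sigma> h] by simp
  define p where "p = (if h = [] then return_pmf (initial M)
         else the (transition M (fst (last h)) (snd (last h))))"
  have nxt: "next_pmf M \<sigma> h = bind_pmf p (\<lambda>s. map_pmf (Pair s) (\<sigma> h s))"
    using False by (simp add: next_pmf_def p_def)
  have 1: "measure_pmf.prob (next_pmf M \<sigma> h) (T \<times> B) = measure_pmf.prob p T * c"
    unfolding nxt using assms pos by (intro prob_bind_Pair) auto
  have 2: "measure_pmf.prob (next_pmf M \<sigma> h) (T \<times> UNIV) = measure_pmf.prob p T * 1"
    unfolding nxt by (intro prob_bind_Pair) simp
  show ?thesis
    using prob_next[of h "T \<times> B"] prob_next[of h "T \<times> UNIV"] 1 2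
    by (simp add: mem_Times_iff)
qed

lemma MEC_same_class:
  assumes "x \<in> states M" "y \<in> mec_class M x" "y \<noteq> x"
  shows "\<exists>E. MEC M E \<and> mec_class M x = fst ` E"
proof -
  have "mec_class M x \<in> mec_partition M" "x \<in> mec_class M x"
    using mec_class_in[OF assms(1)] mem_mec_class[OF assms(1)] by simp_all
  then show ?thesis using assms(2,3) by (auto simp: mec_partition_def)
qed

section \<open>The auxiliary MDP with remembered labels\<close>

locale unfolding_quotient = rabin_mdp M k P + H: scheduled "mec_quotient M k P" \<sigma>h
  for M :: "('s, 'a) mdp" and k P \<sigma>h
begin

text \<open>The lifted MDP remembers in its actions the quotient action that the scheduler currently
  wants to realise; a new one is drawn from \<open>\<sigma>h\<close> after every exit.\<close>

definition N :: "('s, 'a qaction \<times> 'a) mdp" where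
  "N = \<lparr> states = states M, actions = actions Mh \<times> actions M, initial = initial M,
     transition = (\<lambda>s (m, a). if m \<in> actions Mh then transition M s a else None) \<rparr>"

definition drop_mode :: "'s \<times> 'a qaction \<times> 'a \<Rightarrow> 's \<times> 'a" where
  "drop_mode x = (fst x, snd (snd x))"

definition mode_of :: "'s \<times> 'a qaction \<times> 'a \<Rightarrow> 'a qaction" where
  "mode_of x = fst (snd x)"

text \<open>In a MEC some action is not an exit, so the second branch applies and contains all
  actions of the MEC. A state outside the MECs has only exits, and the first branch keeps the set
  nonempty.\<close>

definition stay :: "'s \<Rightarrow> 'a set" where
  "stay s = (if {a. (s, a) \<in> enabled M - exits M} = {} then {a. (s, a) \<in> enabled M}
     else {a. (s, a) \<in> enabled M - exits M})"

definition goal_ec :: "'s set \<Rightarrow> nat set \<Rightarrow> ('s \<times> 'a) set" where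
  "goal_ec d I = (SOME E'. end_component M E' \<and> (\<exists>E. MEC M E \<and> d = fst ` E \<and> E' \<subseteq> E) \<and>
     (\<forall>i\<in>I. ec_rabin E' (P i)))"

text \<open>The case distinctions make the value a nonempty set of enabled actions for every mode in
  every state of \<open>M\<close>, so that the uniform distribution on it makes sense. Along almost
  all paths the mode fits the class anyway, by \<open>mode_enabled\<close>.\<close>

fun policy :: "'a qaction \<Rightarrow> 's \<Rightarrow> 'a set" where
  "policy (Act b) s = (if (s, b) \<in> exits M then {b} else stay s)"
| "policy (Tau I) s = (if (mec_class M s, I) \<in> achievable M k P \<and> s \<in> fst ` goal_ec (mec_class M s) I
     then {a. (s, a) \<in> goal_ec (mec_class M s) I} else stay s)"

definition mode_pmf :: "('s \<times> 'a qaction \<times> 'a) list \<Rightarrow> 's \<Rightarrow> 'a qaction pmf" where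
  "mode_pmf h s = (if fresh M (map drop_mode h) then \<sigma>h (exit_trace M (map drop_mode h)) (cls M s)
     else return_pmf (mode_of (last h)))"

definition \<sigma>N :: "('s \<times> 'a qaction \<times> 'a) list \<Rightarrow> 's \<Rightarrow> ('a qaction \<times> 'a) pmf" where
  "\<sigma>N h s = bind_pmf (mode_pmf h s) (\<lambda>m. map_pmf (Pair m) (pmf_of_set (policy m s)))"

lemma drop_mode_simps [simp]: "fst (drop_mode x) = fst x" "snd (drop_mode x) = snd (snd x)"
  "drop_mode (s, m, a) = (s, a)"
  by (simp_all add: drop_mode_def)

lemma mode_of_simps [simp]: "mode_of (s, m, a) = m"
  by (simp add: mode_of_def)

lemma N_simps [simp]: "states N = states M" "actions N = actions Mh \<times> actions M" "initial N = initial M"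
  "transition N s (m, a) = (if m \<in> actions Mh then transition M s a else None)"
  by (simp_all add: N_def)

lemma mdp_N: "mdp N"
  using M H.mdp_M by (auto simp: mdp_def split: if_splits)

lemma enabled_N: "x \<in> enabled N \<longleftrightarrow> drop_mode x \<in> enabled M \<and> mode_of x \<in> actions Mh"
  by (cases x) (auto simp: enabled_def)

lemma tprob_N: "m \<in> actions Mh \<Longrightarrow> tprob N s (m, a) T = tprob M s a T"
  by (simp add: tprob_def)

lemma tprob_N': "x \<in> enabled N \<Longrightarrow> tprob N (fst x) (snd x) T = tprob M (fst (drop_mode x)) (snd (drop_mode x)) T"
  by (cases x) (simp add: enabled_N tprob_N)

lemma deadlock_free_M: "s \<in> states M \<Longrightarrow> \<exists>a. (s, a) \<in> enabled M"
  using quotient_deadlock_free[OF scheduler_deadlock_free[OF H.scheduler]] .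

lemma goal_ec:
  assumes "(d, I) \<in> achievable M k P"
  shows "end_component M (goal_ec d I)" "\<exists>E. MEC M E \<and> d = fst ` E \<and> goal_ec d I \<subseteq> E"
    "\<forall>i\<in>I. ec_rabin (goal_ec d I) (P i)"
proof -
  have "\<exists>E'. end_component M E' \<and> (\<exists>E. MEC M E \<and> d = fst ` E \<and> E' \<subseteq> E) \<and> (\<forall>i\<in>I. ec_rabin E' (P i))"
  proof -
    obtain E E' where "MEC M E" "d = fst ` E" "end_component M E'" "E' \<subseteq> E" "\<forall>i\<in>I. ec_rabin E' (P i)"
      using assms by (auto simp: achievable_def)
    then show ?thesis by (intro exI[of _ E'] conjI exI[of _ E])
  qed
  from someI_ex[OF this, folded goal_ec_def]
  have *: "end_component M (goal_ec d I) \<and> (\<exists>E. MEC M E \<and> d = fst ` E \<and> goal_ec d I \<subseteq> E) \<and>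
    (\<forall>i\<in>I. ec_rabin (goal_ec d I) (P i))" .
  from * show "end_component M (goal_ec d I)" by (rule conjunct1)
  from * show "\<exists>E. MEC M E \<and> d = fst ` E \<and> goal_ec d I \<subseteq> E" by (elim conjE)
  from * show "\<forall>i\<in>I. ec_rabin (goal_ec d I) (P i)" by (elim conjE)
qed

lemma stay_subset: "stay s \<subseteq> {a. (s, a) \<in> enabled M}"
  by (auto simp: stay_def)

lemma stay_nonempty: "s \<in> states M \<Longrightarrow> stay s \<noteq> {}"
  using deadlock_free_M by (auto simp: stay_def)

lemma policy_subset: "policy m s \<subseteq> {a. (s, a) \<in> enabled M}"
proof (cases m)
  case (Act b)
  then show ?thesis using stay_subset exits_enabled[of M] by auto
next
  case (Tau I)
  have "goal_ec (mec_class M s) I \<subseteq> enabled M" if "(mec_class M s, I) \<in> achievable M k P"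
    using goal_ec(1)[OF that] by (simp add: end_component_def)
  then show ?thesis using Tau stay_subset by auto
qed

lemma policy_nonempty: "s \<in> states M \<Longrightarrow> policy m s \<noteq> {}"
  using stay_nonempty by (cases m) auto

lemma finite_policy: "finite (policy m s)"
proof (rule finite_subset[of _ "actions M"])
  show "policy m s \<subseteq> actions M" using policy_subset[of m s] by (auto simp: enabled_def)
  show "finite (actions M)" using M by (simp add: mdp_def)
qed

lemma pmf_\<sigma>N:
  assumes "s \<in> states M"
  shows "pmf (\<sigma>N h s) (m, a) = pmf (mode_pmf h s) m * (if a \<in> policy m s then 1 / card (policy m s) else 0)"
  unfolding \<sigma>N_def pmf_bind_Pair using policy_nonempty[OF assms] finite_policy
  by (simp add: indicator_def)

text \<open>\<open>scheduler\<close> constrains \<open>\<sigma>h\<close> on finite paths of the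
  quotient only, so the traces at which it is consulted must be such paths.\<close>

lemma finite_path_exit_trace:
  assumes "finite_path N h s"
  shows "finite_path Mh (exit_trace M (map drop_mode h)) (cls M s)"
  using assms
proof induction
  case (start s)
  then show ?case using cls_state[of s] by (auto intro: finite_path.start)
next
  case (step h s x t)
  obtain m a where x: "x = (m, a)" by (cases x)
  have sa: "(s, a) \<in> enabled M" "m \<in> actions Mh" using step.hyps by (simp_all add: enabled_N x)
  have t: "tprob M s a {t} > 0" using step.hyps sa by (simp add: x tprob_N)
  show ?case
  proof (cases "(s, a) \<in> exits M")
    case True
    have "(cls M s, Act a) \<in> enabled Mh"
      using True enabled_Act[of "mec_class M s" a] by (force simp: cls_def quot_pair_def)
    moreover have "tprob Mh (cls M s) (Act a) {cls M t} > 0"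
    proof -
      have "tprob M s a {t} \<le> tprob M s a {u. cls M u = cls M t}"
        by (auto simp: tprob_def split: option.split intro: measure_pmf.finite_measure_mono)
      also have "\<dots> = tprob Mh (cls M s) (Act a) {cls M t}"
        using tprob_quot_pair_cls[OF True, of "cls M t"] by (simp add: quot_pair_def cls_def)
      finally show ?thesis using t by simp
    qed
    ultimately show ?thesis
      using finite_path.step[OF step.IH] True by (simp add: x quot_pair_def cls_def)
  next
    case False
    have "cls M t = cls M s"
      using non_exit_class[OF sa(1) False t] by (simp add: cls_def)
    then show ?thesis using step.IH False by (simp add: x)
  qed
qed

lemma scheduler_N: "scheduler N \<sigma>N"
  unfolding scheduler_def
proof (intro allI impI)
  fix h s assume path: "finite_path N h s"
  have s: "s \<in> states M" using finite_path_state[OF mdp_N path] by simp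
  have "set_pmf (mode_pmf h s) \<subseteq> actions Mh"
  proof (cases "fresh M (map drop_mode h)")
    case True
    have "set_pmf (\<sigma>h (exit_trace M (map drop_mode h)) (cls M s)) \<subseteq>
        {m. (cls M s, m) \<in> enabled Mh}"
      using H.scheduler finite_path_exit_trace[OF path] unfolding scheduler_def by blast
    then show ?thesis using True by (auto simp: mode_pmf_def enabled_def)
  next
    case False
    from path False have "mode_of (last h) \<in> actions Mh"
      by cases (auto simp: fresh_def enabled_N)
    then show ?thesis using False by (simp add: mode_pmf_def)
  qed
  then show "set_pmf (\<sigma>N h s) \<subseteq> {x. (s, x) \<in> enabled N}"
    using policy_subset policy_nonempty[OF s] finite_policy
    by (fastforce simp: \<sigma>N_def enabled_N)
qed

sublocale NN: scheduled N \<sigma>N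
  by unfold_locales (rule mdp_N, rule scheduler_N)

section \<open>Forgetting the remembered labels\<close>

definition W :: "(nat \<Rightarrow> 's \<times> 'a qaction \<times> 'a) \<Rightarrow> nat \<Rightarrow> 's \<times> 'a" where
  "W \<omega> n = drop_mode (\<omega> n)"

lemma history_W: "history n (W \<omega>) = map drop_mode (history n \<omega>)"
  by (simp add: history_def W_def)

lemma W_measurable: "W \<in> NN.\<mu> \<rightarrow>\<^sub>M path_space M"
proof -
  define C where "C = states M \<times> actions M"
  have fin: "finite C" using M by (auto simp: C_def mdp_def)
  have mem: "W \<omega> n \<in> C" if "\<omega> \<in> space NN.\<mu>" for \<omega> n
  proof -
    have "\<omega> n \<in> states N \<times> actions N" using that unfolding NN.space_\<mu> by blast
    then show ?thesis by (cases "\<omega> n") (auto simp: W_def C_def)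
  qed
  have "(\<lambda>\<omega> n. W \<omega> n) \<in> NN.\<mu> \<rightarrow>\<^sub>M PiM UNIV (\<lambda>_. count_space C)"
  proof (rule measurable_PiM_single')
    show "(\<lambda>\<omega>. W \<omega> n) \<in> NN.\<mu> \<rightarrow>\<^sub>M count_space C" for n
    proof (subst measurable_count_space_eq2[OF fin], intro conjI ballI)
      show "(\<lambda>\<omega>. W \<omega> n) \<in> space NN.\<mu> \<rightarrow> C" using mem by blast
      fix x
      have "(\<lambda>\<omega>. W \<omega> n) -` {x} \<inter> space NN.\<mu> = {\<omega> \<in> space NN.\<mu>. drop_mode (\<omega> n) = x}"
        by (auto simp: W_def)
      then show "(\<lambda>\<omega>. W \<omega> n) -` {x} \<inter> space NN.\<mu> \<in> sets NN.\<mu>"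
        using NN.pred_coordinate[of "\<lambda>y. drop_mode y = x" n] by (simp add: pred_def)
    qed
    show "(\<lambda>\<omega> n. W \<omega> n) \<in> space NN.\<mu> \<rightarrow> (\<Pi>\<^sub>E i\<in>UNIV. space (count_space C))"
      using mem by auto
  qed
  then show ?thesis by (simp add: path_space_def C_def)
qed

lemma W_infinite_path:
  assumes "\<omega> \<in> infinite_paths N"
  shows "W \<omega> \<in> infinite_paths M"
  using infinite_path_step[OF assms]
  by (auto simp: infinite_paths_def W_def enabled_N tprob_N')

text \<open>A history of \<open>M\<close> has only finitely many lifts, since the actions of the
  quotient are finite in number; projected events become finite sums.\<close>

lemma sum_lifts:
  assumes "Measurable.pred NN.\<mu> (\<lambda>\<omega>. R (\<omega> n))" and h: "length h = n"
  shows "\<P>(\<omega> in NN.\<mu>. history n (W \<omega>) = h \<and> R (\<omega> n)) =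
    (\<Sum>g\<in>{g. set g \<subseteq> NN.C \<and> length g = n \<and> map drop_mode g = h}.
      \<P>(\<omega> in NN.\<mu>. history n \<omega> = g \<and> R (\<omega> n)))"
proof (rule NN.prob_sum)
  let ?L = "{g. set g \<subseteq> NN.C \<and> length g = n \<and> map drop_mode g = h}"
  show "finite ?L"
    by (rule finite_subset[OF _ finite_lists_length_eq[OF NN.finite_C, of n]]) auto
  show "{\<omega> \<in> space NN.\<mu>. history n \<omega> = g \<and> R (\<omega> n)} \<in> NN.events" for g
    unfolding pred_def[symmetric]
    by (intro pred_intros_logic NN.pred_history[of "\<lambda>x. x = g"] NN.pred_coordinate)
  have "{\<omega> \<in> space NN.\<mu>. history n (W \<omega>) = h \<and> R (\<omega> n)} =
      {\<omega> \<in> space NN.\<mu>. map drop_mode (history n \<omega>) = h \<and> R (\<omega> n)}"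
    by (simp add: history_W)
  also have "\<dots> \<in> NN.events"
    unfolding pred_def[symmetric]
    by (intro pred_intros_logic NN.pred_history[of "\<lambda>x. map drop_mode x = h"] NN.pred_coordinate)
  finally show "{\<omega> \<in> space NN.\<mu>. history n (W \<omega>) = h \<and> R (\<omega> n)} \<in> NN.events" .
  show "AE \<omega> in NN.\<mu>. (\<forall>g\<in>?L. history n \<omega> = g \<and> R (\<omega> n) \<longrightarrow> history n (W \<omega>) = h \<and> R (\<omega> n)) \<and>
      (history n (W \<omega>) = h \<and> R (\<omega> n) \<longrightarrow> (\<exists>!g. g \<in> ?L \<and> history n \<omega> = g \<and> R (\<omega> n)))"
  proof (rule AE_I2)
    fix \<omega> assume "\<omega> \<in> space NN.\<mu>"
    then have "set (history n \<omega>) \<subseteq> NN.C" by (rule NN.set_history_subset)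
    then show "(\<forall>g\<in>?L. history n \<omega> = g \<and> R (\<omega> n) \<longrightarrow> history n (W \<omega>) = h \<and> R (\<omega> n)) \<and>
      (history n (W \<omega>) = h \<and> R (\<omega> n) \<longrightarrow> (\<exists>!g. g \<in> ?L \<and> history n \<omega> = g \<and> R (\<omega> n)))"
      by (auto simp: history_W)
  qed
qed

text \<open>Transitions of \<open>N\<close> ignore the mode, so all lifts of a history have the same
  law of the next state, and so does their mixture. This is the compatibility that
  \<open>ex_scheduler_path_measure\<close> asks for.\<close>

lemma ex_projected_scheduler:
  "\<exists>\<sigma>. scheduler M \<sigma> \<and> path_measure M \<sigma> = distr NN.\<mu> (path_space M) W"
proof (rule ex_scheduler_path_measure[OF M])
  let ?\<nu> = "distr NN.\<mu> (path_space M) W"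
  define C where "C = states M \<times> actions M"
  have fin: "finite C" using M by (auto simp: mdp_def C_def)
  show "prob_space ?\<nu>" by (rule NN.prob_space_distr[OF W_measurable])
  show "sets ?\<nu> = sets (path_space M)" by simp
  have hist: "history n \<in> path_space M \<rightarrow>\<^sub>M count_space UNIV" for n
    using measurable_history[OF countable_finite[OF fin]] by (simp add: path_space_def C_def)
  have pred: "Measurable.pred (path_space M) (\<lambda>\<omega>. R (history n \<omega>))" for R n
    by (rule pred_count_space[OF hist])
  have pred2: "Measurable.pred (path_space M) (\<lambda>\<omega>. R (history n \<omega>) (\<omega> n))" for R n
    using pred[of "\<lambda>h. R (take n h) (last h)" "Suc n"] by simp
  show "AE \<omega> in ?\<nu>. fst (\<omega> 0) = initial M"
    using NN.AE_infinite_paths pred2[of "\<lambda>_ x. fst x = initial M" 0]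
    by (subst AE_distr_iff[OF W_measurable]) (auto simp: W_def pred_def)
  have "AE \<omega> in ?\<nu>. \<omega> n \<in> enabled M" for n
    using NN.AE_infinite_paths pred2[of "\<lambda>_ x. x \<in> enabled M" n]
    by (subst AE_distr_iff[OF W_measurable]) (auto dest: W_infinite_path infinite_path_step(1)[of "W _"] simp: pred_def)
  then show "AE \<omega> in ?\<nu>. \<forall>n. \<omega> n \<in> enabled M"
    by (simp add: AE_all_countable)
  have prob: "\<P>(\<omega> in ?\<nu>. Q \<omega>) = \<P>(\<omega> in NN.\<mu>. Q (W \<omega>))" if "Measurable.pred (path_space M) Q" for Q
  proof -
    have "W -` {\<omega> \<in> space (path_space M). Q \<omega>} \<inter> space NN.\<mu> = {\<omega> \<in> space NN.\<mu>. Q (W \<omega>)}"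
      using measurable_space[OF W_measurable] by auto
    then show ?thesis
      using that by (simp add: pred_def measure_distr[OF W_measurable])
  qed
  fix h :: "('s \<times> 'a) list" and t assume ne: "h \<noteq> []"
  let ?n = "length h" and ?L = "{g. set g \<subseteq> NN.C \<and> length g = length h \<and> map drop_mode g = h}"
  have "\<P>(\<omega> in ?\<nu>. history ?n \<omega> = h \<and> fst (\<omega> ?n) = t) = \<P>(\<omega> in NN.\<mu>. history ?n (W \<omega>) = h \<and> fst (\<omega> ?n) = t)"
    using prob[OF pred2[of "\<lambda>g x. g = h \<and> fst x = t" ?n]] by (simp add: W_def)
  also have "\<dots> = (\<Sum>g\<in>?L. \<P>(\<omega> in NN.\<mu>. history ?n \<omega> = g \<and> fst (\<omega> ?n) = t))"
    by (intro sum_lifts NN.pred_coordinate) simp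
  also have "\<dots> = (\<Sum>g\<in>?L. cylinder_prob N \<sigma>N g * tprob M (fst (last h)) (snd (last h)) {t})"
  proof (rule sum.cong[OF refl])
    fix g assume g: "g \<in> ?L"
    then have "g \<noteq> []" using ne by auto
    then have "last g \<in> NN.C" "last h = drop_mode (last g)"
      using g last_in_set[of g] by (auto simp: last_map simp del: last_in_set)
    then have "tprob N (fst (last g)) (snd (last g)) {t} = tprob M (fst (last h)) (snd (last h)) {t}"
      using tprob_N by (cases "last g") auto
    then show "\<P>(\<omega> in NN.\<mu>. history ?n \<omega> = g \<and> fst (\<omega> ?n) = t) =
        cylinder_prob N \<sigma>N g * tprob M (fst (last h)) (snd (last h)) {t}"
      using NN.prob_next_state[of g "{t}"] g \<open>g \<noteq> []\<close> by simp
  qed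
  \<comment> \<open>The vacuous conjunct gives the sum the shape of \<open>sum_lifts\<close> with
    \<open>R\<close> constantly true.\<close>
  also have "\<dots> = (\<Sum>g\<in>?L. \<P>(\<omega> in NN.\<mu>. history ?n \<omega> = g \<and> True)) * tprob M (fst (last h)) (snd (last h)) {t}"
    unfolding sum_distrib_right
  proof (rule sum.cong[OF refl])
    fix g assume "g \<in> ?L"
    then show "cylinder_prob N \<sigma>N g * tprob M (fst (last h)) (snd (last h)) {t} =
        \<P>(\<omega> in NN.\<mu>. history ?n \<omega> = g \<and> True) * tprob M (fst (last h)) (snd (last h)) {t}"
      using NN.prob_history[of g] by simp
  qed
  also have "(\<Sum>g\<in>?L. \<P>(\<omega> in NN.\<mu>. history ?n \<omega> = g \<and> True)) = \<P>(\<omega> in NN.\<mu>. history ?n (W \<omega>) = h \<and> True)"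
    by (rule sum_lifts[symmetric]) simp_all
  also have "\<dots> = \<P>(\<omega> in ?\<nu>. history ?n \<omega> = h)"
    using prob[OF pred[of "\<lambda>g. g = h" ?n]] by simp
  finally show "\<P>(\<omega> in ?\<nu>. history ?n \<omega> = h \<and> fst (\<omega> ?n) = t) =
      \<P>(\<omega> in ?\<nu>. history ?n \<omega> = h) * tprob M (fst (last h)) (snd (last h)) {t}" .
qed (rule deadlock_free_M)

end

lemma finite_path_history:
  assumes "\<omega> \<in> infinite_paths M"
  shows "finite_path M (history n \<omega>) (fst (\<omega> n))"
proof (induction n)
  case 0
  have "\<omega> 0 \<in> enabled M" by (rule infinite_path_step(1)[OF assms])
  then show ?case by (auto simp: enabled_def intro: finite_path.start)
next
  case (Suc n)
  show ?case
    using finite_path.step[OF Suc.IH, of "snd (\<omega> n)"] infinite_path_step[OF assms, of n]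
    by (simp add: history_Suc)
qed

text \<open>A walk that starts in \<open>R\<close> can leave \<open>R\<close> only from a state in
  \<open>T\<close>.\<close>

lemma rtrancl_closed_or_hits:
  assumes "(s, t) \<in> r\<^sup>*" "s \<in> R"
    and "\<And>u v. u \<in> R \<Longrightarrow> u \<notin> T \<Longrightarrow> (u, v) \<in> r \<Longrightarrow> v \<in> R"
  shows "R \<inter> T \<noteq> {} \<or> t \<in> R"
  using assms(1)
proof induction
  case base
  then show ?case using assms(2) by simp
next
  case (step u v)
  then show ?case using assms(3)[of u v] by blast
qed

section \<open>Modes along typical paths\<close>

context unfolding_quotient begin

text \<open>Positive probability of all prefixes puts every mode and action taken into the support
  of its distribution, which allows the following arguments to be made path by path.\<close>

definition steady :: "(nat \<Rightarrow> 's \<times> 'a qaction \<times> 'a) \<Rightarrow> bool" where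
  "steady \<omega> \<longleftrightarrow> \<omega> \<in> infinite_paths N \<and> (\<forall>n. cylinder_prob N \<sigma>N (history n \<omega>) > 0)"

lemma AE_steady: "AE \<omega> in NN.\<mu>. steady \<omega>"
  using NN.AE_infinite_paths NN.AE_cylinder_prob_pos by eventually_elim (simp add: steady_def)

lemma MEC_stay_no_exit:
  assumes "MEC M E" "mec_class M s = fst ` E" "s \<in> states M" "a \<in> stay s"
  shows "(s, a) \<notin> exits M"
proof -
  have "s \<in> fst ` E" using mem_mec_class[OF assms(3)] assms(2) by simp
  then obtain a' where a': "(s, a') \<in> E" by auto
  then have "(s, a') \<in> enabled M - exits M"
    using assms(1) MEC_no_exit[OF assms(1)] by (auto simp: MEC_def end_component_def)
  then show ?thesis using assms(4) by (auto simp: stay_def split: if_splits)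
qed

lemma MEC_subset_stay:
  assumes "MEC M E" "(s, a) \<in> E"
  shows "a \<in> stay s"
proof -
  have "(s, a) \<in> enabled M - exits M"
    using assms MEC_no_exit[OF assms(1)] by (auto simp: MEC_def end_component_def)
  then show ?thesis by (auto simp: stay_def)
qed

context
  fixes \<omega>
  assumes st: "steady \<omega>"
begin

lemma path_N: "\<omega> \<in> infinite_paths N"
  using st by (simp add: steady_def)

lemma path_W: "W \<omega> \<in> infinite_paths M"
  by (rule W_infinite_path[OF path_N])

lemma state_N: "fst (\<omega> n) \<in> states M"
  using infinite_path_step(1)[OF path_N, of n] by (auto simp: enabled_def)

lemma fst_W: "fst (W \<omega> n) = fst (\<omega> n)"
  by (simp add: W_def)

lemma steady_mode: "mode_of (\<omega> n) \<in> set_pmf (mode_pmf (history n \<omega>) (fst (\<omega> n)))"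
  and steady_policy: "snd (snd (\<omega> n)) \<in> policy (mode_of (\<omega> n)) (fst (\<omega> n))"
proof -
  obtain s m a where x: "\<omega> n = (s, m, a)" by (cases "\<omega> n")
  have "cylinder_prob N \<sigma>N (history n \<omega> @ [(s, m, a)]) \<noteq> 0"
    using st x by (simp add: steady_def flip: x history_Suc) (metis less_irrefl)
  then have "pmf (\<sigma>N (history n \<omega>) s) (m, a) \<noteq> 0"
    unfolding cylinder_prob_snoc by auto
  moreover have "s \<in> states M" using state_N[of n] x by simp
  ultimately show "mode_of (\<omega> n) \<in> set_pmf (mode_pmf (history n \<omega>) (fst (\<omega> n)))"
    "snd (snd (\<omega> n)) \<in> policy (mode_of (\<omega> n)) (fst (\<omega> n))"
    by (auto simp: x pmf_\<sigma>N set_pmf_iff split: if_splits)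
qed

lemma mode_kept:
  assumes "W \<omega> n \<notin> exits M"
  shows "mode_of (\<omega> (Suc n)) = mode_of (\<omega> n)"
proof -
  have "\<not> fresh M (map drop_mode (history (Suc n) \<omega>))"
    using assms by (simp add: fresh_history flip: history_W)
  then show ?thesis
    using steady_mode[of "Suc n"] by (simp add: mode_pmf_def)
qed

lemma mode_const:
  "n \<le> j \<Longrightarrow> (\<And>i. n \<le> i \<Longrightarrow> i < j \<Longrightarrow> W \<omega> i \<notin> exits M) \<Longrightarrow> mode_of (\<omega> j) = mode_of (\<omega> n)"
  by (induction j rule: dec_induct) (auto simp: mode_kept)

text \<open>A mode drawn after an exit is enabled in the class entered because
  \<open>\<sigma>h\<close> is a scheduler; until the next exit neither the mode nor the class
  changes.\<close>

lemma mode_enabled: "(cls M (fst (\<omega> n)), mode_of (\<omega> n)) \<in> enabled Mh"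
proof (induction n)
  case 0
  have "set_pmf (mode_pmf (history 0 \<omega>) (fst (\<omega> 0))) \<subseteq> {m. (cls M (fst (\<omega> 0)), m) \<in> enabled Mh}"
    using H.scheduler finite_path_exit_trace[OF finite_path_history[OF path_N, of 0]]
    by (simp add: mode_pmf_def fresh_def scheduler_def)
  then show ?case using steady_mode[of 0] by blast
next
  case (Suc n)
  show ?case
  proof (cases "W \<omega> n \<in> exits M")
    case True
    then have "fresh M (map drop_mode (history (Suc n) \<omega>))"
      by (simp add: fresh_history flip: history_W)
    then have "set_pmf (mode_pmf (history (Suc n) \<omega>) (fst (\<omega> (Suc n)))) \<subseteq>
        {m. (cls M (fst (\<omega> (Suc n))), m) \<in> enabled Mh}"
      using H.scheduler finite_path_exit_trace[OF finite_path_history[OF path_N, of "Suc n"]]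
      by (simp add: mode_pmf_def scheduler_def)
    then show ?thesis using steady_mode[of "Suc n"] by blast
  next
    case False
    have "mec_class M (fst (W \<omega> (Suc n))) = mec_class M (fst (W \<omega> n))"
      by (rule class_no_exit[OF path_W]) (use False in \<open>auto simp: less_Suc_eq le_less\<close>)
    then show ?thesis using mode_kept[OF False] Suc by (simp add: fst_W cls_def)
  qed
qed

text \<open>The policy never exits by accident. As long as its target has not been reached, the
  class is a MEC, where \<open>stay\<close> contains no exit; inside the goal end component only its
  own actions are played.\<close>

lemma exit_mode:
  assumes exit: "W \<omega> n \<in> exits M"
  shows "mode_of (\<omega> n) = Act (snd (W \<omega> n))"
proof -
  obtain s m a where x: "\<omega> n = (s, m, a)" by (cases "\<omega> n")
  have sa: "(s, a) \<in> exits M" using exit by (simp add: W_def x)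
  have s: "s \<in> states M" using state_N[of n] x by simp
  have pol: "a \<in> policy m s" using steady_policy[of n] x by simp
  have en: "(Cls (mec_class M s), m) \<in> enabled Mh" using mode_enabled[of n] x by (simp add: cls_def)
  have "m = Act a"
  proof (cases m)
    case (Act b)
    show ?thesis
    proof (cases "(s, b) \<in> exits M")
      case True
      then show ?thesis using pol Act by simp
    next
      case False
      obtain y where y: "y \<in> exits M" "(Cls (mec_class M s), Act b) = quot_pair M y"
        using en enabled_Act Act by blast
      have "fst y \<in> states M" using y(1) exits_enabled[of M] by (auto simp: enabled_def)
      then have "fst y \<in> mec_class M s"
        using mem_mec_class[of "fst y" M] y(2) by (simp add: quot_pair_def)
      moreover have "fst y \<noteq> s"
        using y False by (cases y) (auto simp: quot_pair_def)
      \<comment> \<open>The source of \<open>b\<close> lies in the class and differs from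
        \<open>s\<close>; a class with two states is a MEC.\<close>
      ultimately obtain E where "MEC M E" "mec_class M s = fst ` E"
        using MEC_same_class[OF s] by blast
      then have "(s, a) \<notin> exits M"
        using pol False Act by (intro MEC_stay_no_exit[OF _ _ s]) auto
      with sa show ?thesis by simp
    qed
  next
    case (Tau I)
    have ach: "(mec_class M s, I) \<in> achievable M k P" using en enabled_Tau Tau by blast
    obtain E where E: "MEC M E" "mec_class M s = fst ` E" "goal_ec (mec_class M s) I \<subseteq> E"
      using goal_ec(2)[OF ach] by blast
    have "(s, a) \<notin> exits M"
    proof (cases "s \<in> fst ` goal_ec (mec_class M s) I")
      case True
      then have "(s, a) \<in> E" using pol Tau ach E(3) by auto
      then show ?thesis using MEC_no_exit[OF E(1)] by blast
    next
      case False
      then show ?thesis using pol Tau by (intro MEC_stay_no_exit[OF E(1,2) s]) auto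
    qed
    with sa show ?thesis by simp
  qed
  then show ?thesis by (simp add: x W_def)
qed

end

text \<open>Only non-exits are considered: after them the mode is kept, so the probability of
  \<open>y\<close> right after \<open>x\<close> is a constant. After an exit the mode depends on the
  whole trace through \<open>\<sigma>h\<close>, and no uniform lower bound is available.\<close>

definition fair_succ :: "'s \<times> 'a qaction \<times> 'a \<Rightarrow> 's \<times> 'a qaction \<times> 'a \<Rightarrow> bool" where
  "fair_succ x y \<longleftrightarrow> x \<in> enabled N \<and> drop_mode x \<notin> exits M \<and> fst y \<in> states M \<and>
     tprob N (fst x) (snd x) {fst y} > 0 \<and> mode_of y = mode_of x \<and>
     snd (snd y) \<in> policy (mode_of x) (fst y)"

lemma fair_succ_in_C: "fair_succ x y \<Longrightarrow> x \<in> NN.C \<and> y \<in> NN.C"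
  using NN.enabled_subset policy_subset[of "mode_of x" "fst y"]
  by (cases x; cases y) (auto simp: fair_succ_def enabled_N enabled_def)

text \<open>The bound for \<open>AE_infinitely_often\<close> is the transition probability times the
  uniform weight of one action of the policy; the mode contributes the factor 1.\<close>

lemma AE_fair: "AE \<omega> in NN.\<mu>. \<forall>x y. fair_succ x y \<longrightarrow> x \<in> limit_pairs \<omega> \<longrightarrow> y \<in> limit_pairs \<omega>"
proof -
  let ?X = "{z \<in> NN.C \<times> NN.C. fair_succ (fst z) (snd z)}"
  have "AE \<omega> in NN.\<mu>. \<forall>z\<in>?X. (\<exists>\<^sub>\<infinity>n. history n \<omega> \<noteq> [] \<and> last (history n \<omega>) = fst z) \<longrightarrow>
      (\<exists>\<^sub>\<infinity>n. (history n \<omega> \<noteq> [] \<and> last (history n \<omega>) = fst z) \<and> \<omega> n \<in> {snd z})"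
  proof (rule AE_ball_countable')
    show "countable ?X"
      by (rule countable_finite, rule finite_subset[of _ "NN.C \<times> NN.C"]) (use NN.finite_C in auto)
    fix z assume "z \<in> ?X"
    then obtain x y where z: "z = (x, y)" and fair: "fair_succ x y" by (cases z) auto
    obtain t m a where y: "y = (t, m, a)" by (cases y)
    have t: "t \<in> states M" and pol: "a \<in> policy m t" and m: "mode_of x = m" and x: "drop_mode x \<notin> exits M"
      and pos: "tprob N (fst x) (snd x) {t} > 0"
      using fair by (auto simp: fair_succ_def y)
    let ?e = "tprob N (fst x) (snd x) {t} * (1 / card (policy m t))"
    have card: "card (policy m t) > 0" using pol finite_policy by (auto simp: card_gt_0_iff)
    have "?e \<le> measure_pmf.prob (next_pmf N \<sigma>N h) {y}"
      if h: "h \<noteq> [] \<and> last h = x" and cp: "cylinder_prob N \<sigma>N h > 0" for h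
    proof -
      have "mode_pmf h t = return_pmf m"
        using h x m by (simp add: mode_pmf_def fresh_def last_map)
      then have "cylinder_prob N \<sigma>N (h @ [y]) = cylinder_prob N \<sigma>N h * ?e"
        unfolding y cylinder_prob_snoc using h pol by (simp add: pmf_\<sigma>N[OF t])
      then have "cylinder_prob N \<sigma>N h * pmf (next_pmf N \<sigma>N h) y = cylinder_prob N \<sigma>N h * ?e"
        using next_pmf(2)[OF mdp_N scheduler_N, of h y] by (simp only:)
      then have "pmf (next_pmf N \<sigma>N h) y = ?e"
        by (rule mult_left_cancel[THEN iffD1, rotated]) (use cp in simp)
      then show ?thesis by (simp add: measure_pmf_single)
    qed
    then show "AE \<omega> in NN.\<mu>. (\<exists>\<^sub>\<infinity>n. history n \<omega> \<noteq> [] \<and> last (history n \<omega>) = fst z) \<longrightarrow>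
      (\<exists>\<^sub>\<infinity>n. (history n \<omega> \<noteq> [] \<and> last (history n \<omega>) = fst z) \<and> \<omega> n \<in> {snd z})"
      using card pos z
      by (intro NN.AE_infinitely_often[where \<epsilon>="?e" and Q="\<lambda>h. h \<noteq> [] \<and> last h = fst z"]) auto
  qed
  then show ?thesis
  proof (eventually_elim, intro allI impI)
    fix \<omega> x y
    assume io: "\<forall>z\<in>?X. (\<exists>\<^sub>\<infinity>n. history n \<omega> \<noteq> [] \<and> last (history n \<omega>) = fst z) \<longrightarrow>
        (\<exists>\<^sub>\<infinity>n. (history n \<omega> \<noteq> [] \<and> last (history n \<omega>) = fst z) \<and> \<omega> n \<in> {snd z})"
      and fair: "fair_succ x y" and x: "x \<in> limit_pairs \<omega>"
    have "\<exists>\<^sub>\<infinity>n. history n \<omega> \<noteq> [] \<and> last (history n \<omega>) = x"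
      unfolding INFM_nat_le
    proof
      fix m
      obtain n where "n \<ge> m" "\<omega> n = x"
        using x by (auto simp: limit_pairs_def INFM_nat_le)
      then show "\<exists>n\<ge>m. history n \<omega> \<noteq> [] \<and> last (history n \<omega>) = x"
        by (intro exI[of _ "Suc n"]) auto
    qed
    moreover have "(x, y) \<in> ?X" using fair fair_succ_in_C[OF fair] by simp
    ultimately have "\<exists>\<^sub>\<infinity>n. (history n \<omega> \<noteq> [] \<and> last (history n \<omega>) = x) \<and> \<omega> n \<in> {y}"
      using io[rule_format, of "(x, y)"] by simp
    then have "\<exists>\<^sub>\<infinity>n. \<omega> n = y" by (rule frequently_mono[rotated]) auto
    then show "y \<in> limit_pairs \<omega>" by (simp add: limit_pairs_def)
  qed
qed

text \<open>Mode and class are constant along the tail, and by fairness the recurrent part is closed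
  under all moves of the policy. In mode \<open>Act b\<close> it would spread through the MEC to the
  source of \<open>b\<close> and make an exit recurrent, a contradiction. In mode
  \<open>Tau I\<close> it spreads to the goal end component, covers it, and the path is trapped
  there.\<close>

lemma tail_mode:
  assumes st: "steady \<omega>" and fin: "\<omega> \<in> space NN.\<mu>"
    and fair: "\<forall>x y. fair_succ x y \<longrightarrow> x \<in> limit_pairs \<omega> \<longrightarrow> y \<in> limit_pairs \<omega>"
    and no_exit: "\<forall>j\<ge>n0. W \<omega> j \<notin> exits M"
  shows "\<exists>I. mode_of (\<omega> n0) = Tau I \<and> (\<forall>i\<in>I. W \<omega> \<in> rabin M (P i))"
proof -
  define m where "m = mode_of (\<omega> n0)"
  define d where "d = mec_class M (fst (\<omega> n0))"
  have mode: "mode_of (\<omega> j) = m" if "j \<ge> n0" for j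
    unfolding m_def by (rule mode_const[OF st that]) (use no_exit in auto)
  have same_class: "mec_class M (fst (\<omega> j)) = d" if "j \<ge> n0" for j
    using class_no_exit[OF path_W[OF st] that] no_exit by (simp add: d_def fst_W[OF st])
  have lim: "mode_of y = m" "drop_mode y \<notin> exits M" "mec_class M (fst y) = d" "y \<in> enabled N"
    if y: "y \<in> limit_pairs \<omega>" for y
  proof -
    obtain j where "j \<ge> n0" "\<omega> j = y" using y by (auto simp: limit_pairs_def INFM_nat_le)
    then show "mode_of y = m" "drop_mode y \<notin> exits M" "mec_class M (fst y) = d" "y \<in> enabled N"
      using mode same_class no_exit infinite_path_step(1)[OF path_N[OF st], of j] by (auto simp: W_def)
  qed
  \<comment> \<open>States all of whose policy actions recur. Passing from pairs to states makes one
    recurrent predecessor enough to put a state into \<open>R\<close>.\<close>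
  define R where "R = {t \<in> states M. \<forall>a\<in>policy m t. (t, m, a) \<in> limit_pairs \<omega>}"
  have R_succ: "t \<in> R" if y: "y \<in> limit_pairs \<omega>" "t \<in> states M" "tprob N (fst y) (snd y) {t} > 0" for y t
  proof -
    have "(t, m, a) \<in> limit_pairs \<omega>" if a: "a \<in> policy m t" for a
    proof (rule fair[rule_format, OF _ y(1)])
      show "fair_succ y (t, m, a)"
        using y lim[OF y(1)] a by (simp add: fair_succ_def)
    qed
    then show ?thesis using y(2) by (simp add: R_def)
  qed
  have R_edge: "u \<in> R" if t: "t \<in> R" "a \<in> policy m t" "u \<in> states M" "tprob M t a {u} > 0" for t a u
  proof -
    have y: "(t, m, a) \<in> limit_pairs \<omega>" using t by (simp add: R_def)
    then have "tprob N t (m, a) {u} > 0" using t lim(4)[OF y] by (simp add: enabled_N tprob_N)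
    then show ?thesis using R_succ[OF y t(3)] by simp
  qed
  have R_class: "mec_class M t = d" if t: "t \<in> R" for t
  proof -
    obtain a where "a \<in> policy m t" using policy_nonempty[of t m] t unfolding R_def by blast
    then have "(t, m, a) \<in> limit_pairs \<omega>" using t by (simp add: R_def)
    from lim(3)[OF this] show ?thesis by simp
  qed
  \<comment> \<open>\<open>T\<close> collects the states in which the policy may deviate from the
    end component \<open>E\<close>. Until it is hit, \<open>R\<close> follows every edge of
    \<open>E\<close>.\<close>
  have R_path: "R \<inter> T \<noteq> {} \<or> e \<in> R"
    if E: "end_component M E" "t \<in> R" "t \<in> fst ` E" "e \<in> fst ` E"
      and pol: "\<And>u a. u \<in> R \<Longrightarrow> u \<notin> T \<Longrightarrow> (u, a) \<in> E \<Longrightarrow> a \<in> policy m u" for E T t e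
  proof (rule rtrancl_closed_or_hits)
    show "(t, e) \<in> (ec_edges M E)\<^sup>*" using E by (auto simp: end_component_def)
    show "t \<in> R" by (rule E)
    fix u v assume u: "u \<in> R" "u \<notin> T" and "(u, v) \<in> ec_edges M E"
    then obtain a where a: "(u, a) \<in> E" "tprob M u a {v} > 0" and v: "v \<in> fst ` E"
      by (auto simp: ec_edges_def)
    have "v \<in> states M" using v E(1) by (auto simp: end_component_def enabled_def)
    then show "v \<in> R" using R_edge[OF u(1) pol[OF u a(1)] _ a(2)] by simp
  qed
  obtain n1 where "\<forall>n\<ge>n1. \<omega> n \<in> limit_pairs \<omega>"
    using eventually_limit_pairs[OF NN.finite_C, of \<omega>] fin unfolding NN.space_\<mu> by blast
  then have y: "\<omega> n1 \<in> limit_pairs \<omega>" by simp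
  obtain t0 where "t0 \<in> states M" "tprob N (fst (\<omega> n1)) (snd (\<omega> n1)) {t0} > 0"
    using ex_successor[OF mdp_N, of "fst (\<omega> n1)" "snd (\<omega> n1)"] lim(4)[OF y] by auto
  then have t0: "t0 \<in> R" using R_succ[OF y] by blast
  then have t0_states: "t0 \<in> states M" by (simp add: R_def)
  have t0_d: "t0 \<in> d" using mem_mec_class[OF t0_states] R_class[OF t0] by simp
  have en: "(Cls d, m) \<in> enabled Mh"
    using mode_enabled[OF st, of n0] by (simp add: m_def d_def cls_def)
  show ?thesis
  proof (cases m)
    case (Act b)
    obtain x where x: "x \<in> exits M" "(Cls d, Act b) = quot_pair M x"
      using en enabled_Act Act by blast
    obtain s where xs: "x = (s, b)" and cs: "mec_class M s = d"
      using x(2) by (cases x) (auto simp: quot_pair_def)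
    have s: "s \<in> states M" using x(1) xs exits_enabled[of M] by (auto simp: enabled_def)
    have sR: "s \<notin> R"
    proof
      assume "s \<in> R"
      then have "(s, m, b) \<in> limit_pairs \<omega>" using x(1) Act xs by (simp add: R_def)
      from lim(2)[OF this] show False using x(1) xs by simp
    qed
    then have "t0 \<noteq> s" using t0 by blast
    moreover have "s \<in> mec_class M t0" using mem_mec_class[OF s] cs R_class[OF t0] by simp
    ultimately obtain E where E: "MEC M E" "mec_class M t0 = fst ` E"
      using MEC_same_class[OF t0_states] by blast
    have dE: "d = fst ` E" using E(2) R_class[OF t0] by simp
    have "R \<inter> {s} \<noteq> {} \<or> s \<in> R"
    proof (rule R_path[of E t0])
      show "end_component M E" using E(1) by (simp add: MEC_def)
      show "t0 \<in> R" by (rule t0)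
      show "t0 \<in> fst ` E" using t0_d dE by simp
      show "s \<in> fst ` E" using mem_mec_class[OF s] cs dE by simp
      fix u a assume u: "u \<in> R" "u \<notin> {s}" "(u, a) \<in> E"
      \<comment> \<open>By disjointness \<open>b\<close> belongs to \<open>s\<close> alone, so
        elsewhere the policy is \<open>stay\<close>, which includes all actions of the MEC.\<close>
      have "(u, b) \<notin> exits M"
      proof
        assume "(u, b) \<in> exits M"
        then have "u = s" using x(1) xs dis exits_enabled[of M] unfolding disjoint_actions_def by blast
        with u(2) show False by simp
      qed
      then show "a \<in> policy m u" using Act MEC_subset_stay[OF E(1) u(3)] by simp
    qed
    with sR show ?thesis by simp
  next
    case (Tau I)
    have ach: "(d, I) \<in> achievable M k P" using en enabled_Tau Tau by blast
    define E' where "E' = goal_ec d I"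
    have E': "end_component M E'" "\<forall>i\<in>I. ec_rabin E' (P i)"
      using goal_ec(1,3)[OF ach] by (simp_all add: E'_def)
    obtain E where E: "MEC M E" "d = fst ` E" "E' \<subseteq> E"
      using goal_ec(2)[OF ach] by (auto simp: E'_def)
    obtain e0 where e0: "e0 \<in> fst ` E'" using E'(1) by (auto simp: end_component_def)
    have pol_in: "policy m u = {a. (u, a) \<in> E'}" if "mec_class M u = d" "u \<in> fst ` E'" for u
      using that ach Tau by (simp add: E'_def)
    have "R \<inter> fst ` E' \<noteq> {} \<or> e0 \<in> R"
    proof (rule R_path[of E t0])
      show "end_component M E" using E(1) by (simp add: MEC_def)
      show "t0 \<in> R" by (rule t0)
      show "t0 \<in> fst ` E" using t0_d E(2) by simp
      show "e0 \<in> fst ` E" using e0 E(3) by blast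
      fix u a assume u: "u \<in> R" "u \<notin> fst ` E'" "(u, a) \<in> E"
      then show "a \<in> policy m u"
        using Tau MEC_subset_stay[OF E(1) u(3)] R_class[OF u(1)] by (simp add: E'_def)
    qed
    then obtain e where e: "e \<in> R" "e \<in> fst ` E'" using e0 by blast
    have sub: "e' \<in> R" if e': "e' \<in> fst ` E'" for e'
    proof -
      \<comment> \<open>Within \<open>E'\<close> the policy consists of exactly the actions of
        \<open>E'\<close>, so there is nothing to stop at and strong connectivity puts all of
        \<open>E'\<close> into \<open>R\<close>.\<close>
      have "R \<inter> ({} :: 's set) \<noteq> {} \<or> e' \<in> R"
      proof (rule R_path[OF E'(1) e e'])
        fix u a assume u: "u \<in> R" "(u, a) \<in> E'"
        then have "u \<in> fst ` E'" by force
        then show "a \<in> policy m u" using pol_in[OF R_class[OF u(1)]] u(2) by simp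
      qed
      then show ?thesis by simp
    qed
    have visit: "\<exists>j\<ge>n. fst (\<omega> j) = e'" if e': "e' \<in> fst ` E'" for e' n
    proof -
      have "e' \<in> R" by (rule sub[OF e'])
      moreover obtain a where "a \<in> policy m e'"
        using policy_nonempty[of e' m] \<open>e' \<in> R\<close> unfolding R_def by blast
      ultimately have "(e', m, a) \<in> limit_pairs \<omega>" by (simp add: R_def)
      then obtain j where "j \<ge> n" "\<omega> j = (e', m, a)"
        by (auto simp: limit_pairs_def INFM_nat_le)
      then show ?thesis by auto
    qed
    obtain n2 where n2: "n2 \<ge> n0" "fst (\<omega> n2) \<in> fst ` E'" using visit[OF e0] e0 by blast
    \<comment> \<open>Having entered \<open>E'\<close>, the path plays only actions of
      \<open>E'\<close> and cannot leave it.\<close>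
    have inside: "fst (\<omega> j) \<in> fst ` E'" if j: "n2 \<le> j" for j
      using j
    proof (induction j rule: dec_induct)
      case base
      show ?case by (rule n2(2))
    next
      case (step j)
      have "n0 \<le> j" using step n2 by simp
      have "snd (snd (\<omega> j)) \<in> policy m (fst (\<omega> j))"
        using steady_policy[OF st, of j] mode[OF \<open>n0 \<le> j\<close>] by simp
      then have "(fst (\<omega> j), snd (snd (\<omega> j))) \<in> E'"
        using pol_in[OF same_class[OF \<open>n0 \<le> j\<close>] step.IH] by simp
      then have "tprob M (fst (\<omega> j)) (snd (snd (\<omega> j))) (fst ` E') = 1"
        using E'(1) by (auto simp: end_component_def)
      moreover have "tprob M (fst (\<omega> j)) (snd (snd (\<omega> j))) {fst (\<omega> (Suc j))} > 0"
        using infinite_path_step(2)[OF path_W[OF st], of j] by (simp add: W_def)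
      ultimately show ?case by (rule tprob_pos_mem)
    qed
    have "W \<omega> \<in> rabin M (P i)" if i: "i \<in> I" for i
    proof -
      have "ec_rabin E' (P i)" using E'(2) i by simp
      then obtain z where "z \<in> P i" "case z of (F, G) \<Rightarrow> fst ` E' \<inter> F \<noteq> {} \<and> fst ` E' \<subseteq> G"
        unfolding ec_rabin_def by (rule bexE)
      then obtain F G where FG: "(F, G) \<in> P i" "fst ` E' \<inter> F \<noteq> {}" "fst ` E' \<subseteq> G"
        by (cases z) simp
      obtain f where f: "f \<in> fst ` E'" "f \<in> F" using FG(2) by blast
      have F: "\<exists>j\<ge>n. fst (W \<omega> j) \<in> F" for n
        unfolding fst_W[OF st] using visit[OF f(1), of n] f(2) by blast
      have G: "\<forall>j\<ge>n2. fst (W \<omega> j) \<in> G"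
        unfolding fst_W[OF st] using inside FG(3) by blast
      have "case (F, G) of (F, G) \<Rightarrow> (\<forall>n. \<exists>j\<ge>n. fst (W \<omega> j) \<in> F) \<and> (\<exists>n. \<forall>j\<ge>n. fst (W \<omega> j) \<in> G)"
        unfolding prod.case
      proof (intro conjI allI)
        show "\<exists>j\<ge>n. fst (W \<omega> j) \<in> F" for n by (rule F)
        from G show "\<exists>n. \<forall>j\<ge>n. fst (W \<omega> j) \<in> G" by (rule exI)
      qed
      then show ?thesis
        unfolding rabin_def using path_W[OF st] FG(1) by (intro CollectI conjI bexI[of _ "(F, G)"])
    qed
    then show ?thesis using Tau by (simp add: m_def)
  qed
qed

section \<open>The label to which a path commits itself\<close>

lemma AE_tail: "AE \<omega> in NN.\<mu>. \<forall>n. (\<forall>j\<ge>n. W \<omega> j \<notin> exits M) \<longrightarrow>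
    (\<exists>I. mode_of (\<omega> n) = Tau I \<and> (\<forall>i\<in>I. W \<omega> \<in> rabin M (P i)))"
  using AE_steady AE_space AE_fair by eventually_elim (intro allI impI, rule tail_mode)

text \<open>The eventual mode, read index by index to fit \<open>measurable_index_set\<close>. If
  the modes do not settle on one \<open>Tau I\<close>, the value is the empty set, so it is always a
  subset of \<open>{1..k}\<close>.\<close>

definition committed :: "(nat \<Rightarrow> 's \<times> 'a qaction \<times> 'a) \<Rightarrow> nat set" where
  "committed \<omega> = {i \<in> {1..k}. \<exists>n I. (\<forall>j. n \<le> j \<longrightarrow> mode_of (\<omega> j) = Tau I) \<and> i \<in> I}"

lemma committed_measurable: "committed \<in> NN.\<mu> \<rightarrow>\<^sub>M count_space UNIV"
proof -
  \<comment> \<open>Sets of naturals are uncountably many, so the quantifier over \<open>I\<close>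
    is traded for a comparison with the mode at time \<open>n\<close>; the quantifiers over times
    are countable.\<close>
  have eq: "committed \<omega> = {i \<in> {1..k}. \<exists>n. (\<forall>j. n \<le> j \<longrightarrow> (\<exists>I. mode_of (\<omega> j) = Tau I \<and> i \<in> I) \<and> mode_of (\<omega> j) = mode_of (\<omega> n))}" for \<omega>
  proof -
    have "(\<exists>n I. (\<forall>j. n \<le> j \<longrightarrow> mode_of (\<omega> j) = Tau I) \<and> i \<in> I) \<longleftrightarrow>
      (\<exists>n. (\<forall>j. n \<le> j \<longrightarrow> (\<exists>I. mode_of (\<omega> j) = Tau I \<and> i \<in> I) \<and> mode_of (\<omega> j) = mode_of (\<omega> n)))" for i
    proof
      assume "\<exists>n I. (\<forall>j. n \<le> j \<longrightarrow> mode_of (\<omega> j) = Tau I) \<and> i \<in> I"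
      then obtain n I where "\<forall>j. n \<le> j \<longrightarrow> mode_of (\<omega> j) = Tau I" "i \<in> I" by (elim exE conjE)
      then show "\<exists>n. (\<forall>j. n \<le> j \<longrightarrow> (\<exists>I. mode_of (\<omega> j) = Tau I \<and> i \<in> I) \<and> mode_of (\<omega> j) = mode_of (\<omega> n))"
        by (intro exI[of _ n]) simp
    next
      assume "\<exists>n. (\<forall>j. n \<le> j \<longrightarrow> (\<exists>I. mode_of (\<omega> j) = Tau I \<and> i \<in> I) \<and> mode_of (\<omega> j) = mode_of (\<omega> n))"
      then obtain n where n: "\<forall>j. n \<le> j \<longrightarrow> (\<exists>I. mode_of (\<omega> j) = Tau I \<and> i \<in> I) \<and> mode_of (\<omega> j) = mode_of (\<omega> n)"
        by (elim exE)
      from n[rule_format, of n] obtain I where I: "mode_of (\<omega> n) = Tau I" "i \<in> I" by auto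
      have "mode_of (\<omega> j) = Tau I" if "n \<le> j" for j
        using conjunct2[OF n[rule_format, OF that]] I(1) by (rule trans)
      with I(2) show "\<exists>n I. (\<forall>j. n \<le> j \<longrightarrow> mode_of (\<omega> j) = Tau I) \<and> i \<in> I"
        by (intro exI[of _ n] exI[of _ I]) simp
    qed
    then show ?thesis unfolding committed_def by (simp only:)
  qed
  show ?thesis
    unfolding eq[abs_def]
  proof (rule measurable_index_set, simp)
    fix i
    show "Measurable.pred NN.\<mu> (\<lambda>\<omega>. \<exists>n. \<forall>j. n \<le> j \<longrightarrow>
        (\<exists>I. mode_of (\<omega> j) = Tau I \<and> i \<in> I) \<and> mode_of (\<omega> j) = mode_of (\<omega> n))"
    proof (rule pred_intros_countable, rule pred_intros_countable)
      fix n j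
      show "Measurable.pred NN.\<mu> (\<lambda>\<omega>. n \<le> j \<longrightarrow>
          (\<exists>I. mode_of (\<omega> j) = Tau I \<and> i \<in> I) \<and> mode_of (\<omega> j) = mode_of (\<omega> n))"
        by (rule NN.pred_coordinate2[of "\<lambda>x y. n \<le> j \<longrightarrow> (\<exists>I. mode_of x = Tau I \<and> i \<in> I) \<and> mode_of x = mode_of y"])
    qed
  qed
qed

lemma committed_eq:
  assumes "\<forall>j. n \<le> j \<longrightarrow> mode_of (\<omega> j) = Tau I" "I \<subseteq> {1..k}"
  shows "committed \<omega> = I"
proof -
  have uniq: "I' = I" if "\<forall>j. n' \<le> j \<longrightarrow> mode_of (\<omega> j) = Tau I'" for n' I'
    using that[rule_format, of "max n n'"] assms(1)[rule_format, of "max n n'"] by simp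
  show ?thesis
  proof (intro set_eqI iffI)
    fix i assume "i \<in> committed \<omega>"
    then obtain n' I' where "\<forall>j. n' \<le> j \<longrightarrow> mode_of (\<omega> j) = Tau I'" "i \<in> I'"
      unfolding committed_def by blast
    then show "i \<in> I" using uniq by blast
  next
    fix i assume "i \<in> I"
    then show "i \<in> committed \<omega>" unfolding committed_def using assms by blast
  qed
qed

text \<open>The mode announces the future. If an exit follows, the mode lasts until then and
  \<open>exit_mode\<close> applies; otherwise \<open>AE_tail\<close> shows that it is a
  \<open>Tau\<close>, which then lasts forever.\<close>

lemma AE_next_label_mode:
  "AE \<omega> in NN.\<mu>. \<forall>n. next_label M (W \<omega>) (committed \<omega>) n (mode_of (\<omega> n))"
  using AE_steady AE_tail
proof (eventually_elim, intro allI)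
  fix \<omega> n
  assume st: "steady \<omega>" and tail: "\<forall>n. (\<forall>j\<ge>n. W \<omega> j \<notin> exits M) \<longrightarrow>
    (\<exists>I. mode_of (\<omega> n) = Tau I \<and> (\<forall>i\<in>I. W \<omega> \<in> rabin M (P i)))"
  obtain m where m: "next_label M (W \<omega>) (committed \<omega>) n m" using ex_next_label ..
  show "next_label M (W \<omega>) (committed \<omega>) n (mode_of (\<omega> n))"
  proof (cases m)
    case (Act b)
    then obtain j where j: "n \<le> j" "W \<omega> j \<in> exits M" "snd (W \<omega> j) = b" "\<forall>i. n \<le> i \<and> i < j \<longrightarrow> W \<omega> i \<notin> exits M"
      using m by auto
    have "mode_of (\<omega> j) = mode_of (\<omega> n)"
      by (rule mode_const[OF st j(1)]) (use j(4) in blast)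
    then have "mode_of (\<omega> n) = m"
      using exit_mode[OF st j(2)] j(3) Act by simp
    then show ?thesis using m by simp
  next
    case (Tau I0)
    then have no: "\<forall>j\<ge>n. W \<omega> j \<notin> exits M" using m by simp
    obtain I where I: "mode_of (\<omega> n) = Tau I" using tail[rule_format, of n] no by blast
    have "(mec_class M (fst (\<omega> n)), I) \<in> achievable M k P"
      using mode_enabled[OF st, of n] I by (simp add: cls_def enabled_Tau)
    then have "I \<subseteq> {1..k}" by (auto simp: achievable_def)
    moreover have "\<forall>j. n \<le> j \<longrightarrow> mode_of (\<omega> j) = Tau I"
    proof (intro allI impI)
      fix j assume "n \<le> j"
      then have "mode_of (\<omega> j) = mode_of (\<omega> n)"
        by (rule mode_const[OF st]) (use no in blast)
      then show "mode_of (\<omega> j) = Tau I" using I by (rule trans)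
    qed
    ultimately have "committed \<omega> = I" by (intro committed_eq)
    then show ?thesis using no I by simp
  qed
qed

lemma AE_committed_rabin: "AE \<omega> in NN.\<mu>. (\<exists>n. \<forall>j\<ge>n. W \<omega> j \<notin> exits M) \<longrightarrow>
    (\<forall>i\<in>committed \<omega>. W \<omega> \<in> rabin M (P i))"
  using AE_next_label_mode AE_tail
proof (eventually_elim, intro impI)
  fix \<omega>
  assume lab: "\<forall>n. next_label M (W \<omega>) (committed \<omega>) n (mode_of (\<omega> n))"
    and tail: "\<forall>n. (\<forall>j\<ge>n. W \<omega> j \<notin> exits M) \<longrightarrow>
      (\<exists>I. mode_of (\<omega> n) = Tau I \<and> (\<forall>i\<in>I. W \<omega> \<in> rabin M (P i)))"
    and "\<exists>n. \<forall>j\<ge>n. W \<omega> j \<notin> exits M"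
  then obtain n I where "mode_of (\<omega> n) = Tau I" "\<forall>i\<in>I. W \<omega> \<in> rabin M (P i)" by blast
  then show "\<forall>i\<in>committed \<omega>. W \<omega> \<in> rabin M (P i)"
    using lab[rule_format, of n] by simp
qed

text \<open>The counterpart of \<open>labelled\<close> that reads the label off the mode at entry
  instead of off the future, so that its probability is that of a single step of
  \<open>N\<close>.\<close>

definition chosen where
  "chosen hh q m \<omega> \<longleftrightarrow> (\<exists>n. exited M hh (W \<omega>) n \<and> cls M (fst (\<omega> n)) = q \<and> mode_of (\<omega> n) = m)"

lemma prob_\<sigma>N_mode: "measure_pmf.prob (\<sigma>N h s) ({m} \<times> UNIV) = pmf (mode_pmf h s) m"
  unfolding \<sigma>N_def by (subst prob_bind_Pair[where c=1]) (simp_all add: measure_pmf_single)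

text \<open>On every fresh history with trace \<open>hh\<close> the mode is drawn from
  \<open>\<sigma>h hh q\<close>, whichever state of the class was entered, so all histories
  contribute the same factor.\<close>

lemma prob_chosen:
  "\<P>(\<omega> in NN.\<mu>. chosen hh q m \<omega>) = \<P>(\<omega> in NN.\<mu>. entered M hh q (W \<omega>)) * pmf (\<sigma>h hh q) m"
proof -
  define K where "K = {g. set g \<subseteq> NN.C \<and> fresh M (map drop_mode g) \<and> exit_trace M (map drop_mode g) = hh}"
  define A where "A g = {\<omega> \<in> space NN.\<mu>. history (length g) \<omega> = g \<and>
    \<omega> (length g) \<in> {s. cls M s = q} \<times> ({m} \<times> UNIV)}" for g
  define B where "B g = {\<omega> \<in> space NN.\<mu>. history (length g) \<omega> = g \<and>
    fst (\<omega> (length g)) \<in> {s. cls M s = q}}" for g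
  have "K \<subseteq> lists NN.C" unfolding K_def by (auto simp: in_lists_conv_set)
  then have count: "countable K"
    using countable_lists[OF countable_finite[OF NN.finite_C]] by (rule countable_subset)
  have A_meas: "A g \<in> NN.events" for g
    unfolding A_def pred_def[symmetric]
    by (intro pred_intros_logic NN.pred_history[of "\<lambda>x. x = g"] NN.pred_coordinate)
  have B_meas: "B g \<in> NN.events" for g
    unfolding B_def pred_def[symmetric]
    by (intro pred_intros_logic NN.pred_history[of "\<lambda>x. x = g"] NN.pred_coordinate)
  have K_iff: "history n \<omega> \<in> K \<longleftrightarrow> exited M hh (W \<omega>) n" if "\<omega> \<in> space NN.\<mu>" for \<omega> n
    using NN.set_history_subset[OF that, of n] by (simp add: K_def exited_def history_W)
  have uniq: "g = g'" if g: "g \<in> K" "g' \<in> K" "\<omega> \<in> B g" "\<omega> \<in> B g'" for g g' \<omega>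
  proof -
    have h: "history (length g) \<omega> = g" "history (length g') \<omega> = g'" "\<omega> \<in> space NN.\<mu>"
      using g by (simp_all add: B_def)
    then have "exited M hh (W \<omega>) (length g)" "exited M hh (W \<omega>) (length g')"
      using g K_iff[OF h(3), of "length g"] K_iff[OF h(3), of "length g'"] by simp_all
    then have "length g = length g'" by (rule exited_unique)
    then show ?thesis using h by metis
  qed
  have AB: "A g \<subseteq> B g" for g by (auto simp: A_def B_def)
  have disj_B: "disjoint_family_on B K"
    unfolding disjoint_family_on_def using uniq by blast
  have disj_A: "disjoint_family_on A K"
    unfolding disjoint_family_on_def using uniq AB by blast
  have scale: "NN.prob (A g) = NN.prob (B g) * pmf (\<sigma>h hh q) m" if g: "g \<in> K" for g
    unfolding A_def B_def
  proof (rule NN.prob_next_action)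
    fix s assume "s \<in> {s. cls M s = q}"
    then show "measure_pmf.prob (\<sigma>N g s) ({m} \<times> UNIV) = pmf (\<sigma>h hh q) m"
      using g by (simp add: prob_\<sigma>N_mode mode_pmf_def K_def)
  qed
  have "NN.prob (\<Union>g\<in>K. A g) = NN.prob (\<Union>g\<in>K. B g) * pmf (\<sigma>h hh q) m"
    by (rule measure_UN_scale[OF NN.finite_measure_axioms NN.finite_measure_axioms count])
      (use A_meas B_meas disj_A disj_B scale in simp_all)
  moreover have "(\<Union>g\<in>K. A g) = {\<omega> \<in> space NN.\<mu>. chosen hh q m \<omega>}"
  proof (intro set_eqI iffI)
    fix \<omega> assume "\<omega> \<in> (\<Union>g\<in>K. A g)"
    then obtain g where g: "g \<in> K" "\<omega> \<in> A g" by blast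
    then have h: "\<omega> \<in> space NN.\<mu>" "history (length g) \<omega> = g" by (simp_all add: A_def)
    have "exited M hh (W \<omega>) (length g)" using K_iff[OF h(1), of "length g"] h(2) g(1) by simp
    moreover have "cls M (fst (\<omega> (length g))) = q" "mode_of (\<omega> (length g)) = m"
      using g(2) by (auto simp: A_def mode_of_def mem_Times_iff)
    ultimately show "\<omega> \<in> {\<omega> \<in> space NN.\<mu>. chosen hh q m \<omega>}"
      using h(1) unfolding chosen_def by blast
  next
    fix \<omega> assume "\<omega> \<in> {\<omega> \<in> space NN.\<mu>. chosen hh q m \<omega>}"
    then obtain n where w: "\<omega> \<in> space NN.\<mu>" and n: "exited M hh (W \<omega>) n" "cls M (fst (\<omega> n)) = q" "mode_of (\<omega> n) = m"
      unfolding chosen_def by blast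
    then have "\<omega> \<in> A (history n \<omega>)" by (simp add: A_def mode_of_def mem_Times_iff)
    then show "\<omega> \<in> (\<Union>g\<in>K. A g)" using K_iff[OF w] n(1) by blast
  qed
  moreover have "(\<Union>g\<in>K. B g) = {\<omega> \<in> space NN.\<mu>. entered M hh q (W \<omega>)}"
  proof (intro set_eqI iffI)
    fix \<omega> assume "\<omega> \<in> (\<Union>g\<in>K. B g)"
    then obtain g where g: "g \<in> K" "\<omega> \<in> B g" by blast
    then have h: "\<omega> \<in> space NN.\<mu>" "history (length g) \<omega> = g" "cls M (fst (\<omega> (length g))) = q"
      by (simp_all add: B_def)
    have "exited M hh (W \<omega>) (length g)" using K_iff[OF h(1), of "length g"] h(2) g(1) by simp
    then have "entered M hh q (W \<omega>)"
      unfolding entered_def using h(3) by (intro exI[of _ "length g"]) (simp add: W_def)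
    then show "\<omega> \<in> {\<omega> \<in> space NN.\<mu>. entered M hh q (W \<omega>)}" using h(1) by simp
  next
    fix \<omega> assume "\<omega> \<in> {\<omega> \<in> space NN.\<mu>. entered M hh q (W \<omega>)}"
    then obtain n where w: "\<omega> \<in> space NN.\<mu>" and n: "exited M hh (W \<omega>) n" "cls M (fst (\<omega> n)) = q"
      unfolding entered_def by (auto simp: W_def)
    then have "\<omega> \<in> B (history n \<omega>)" by (simp add: B_def)
    then show "\<omega> \<in> (\<Union>g\<in>K. B g)" using K_iff[OF w] n(1) by blast
  qed
  ultimately show ?thesis by simp
qed

lemma chosen_iff_labelled:
  assumes "\<forall>n. next_label M (W \<omega>) (committed \<omega>) n (mode_of (\<omega> n))"
  shows "chosen hh q m \<omega> \<longleftrightarrow> labelled M hh q m (W \<omega>) (committed \<omega>)"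
proof
  assume "chosen hh q m \<omega>"
  then obtain n where "exited M hh (W \<omega>) n" "cls M (fst (\<omega> n)) = q" "mode_of (\<omega> n) = m"
    unfolding chosen_def by blast
  then show "labelled M hh q m (W \<omega>) (committed \<omega>)"
    unfolding labelled_def using assms[rule_format, of n] by (intro exI[of _ n]) (simp add: W_def)
next
  assume lab: "labelled M hh q m (W \<omega>) (committed \<omega>)"
  then obtain n where n: "exited M hh (W \<omega>) n" "cls M (fst (\<omega> n)) = q"
    unfolding labelled_def by (auto simp: W_def)
  then have "labelled M hh q (mode_of (\<omega> n)) (W \<omega>) (committed \<omega>)"
    unfolding labelled_def using assms[rule_format, of n] by (intro exI[of _ n]) (simp add: W_def)
  then have "mode_of (\<omega> n) = m" using lab by (rule entered_labelled_unique)
  then show "chosen hh q m \<omega>" using n unfolding chosen_def by blast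
qed

text \<open>Almost surely the committed label contains only satisfied indices, possibly not all of
  them. Hence membership of \<open>i\<close> in the label bounds the Rabin probability from below,
  and its absence bounds the Streett probability from above.\<close>

lemma ex_scheduler_dominating:
  "\<exists>\<sigma>. scheduler M \<sigma> \<and> (\<forall>i\<in>{1..k}.
    Sigma_Algebra.measure (path_measure Mh \<sigma>h) (reach Mh (Bot ` {I. I \<subseteq> {1..k} \<and> i \<in> I})) \<le>
      Sigma_Algebra.measure (path_measure M \<sigma>) (rabin M (P i)) \<and>
    Sigma_Algebra.measure (path_measure M \<sigma>) (streett M (P i)) \<le>
      Sigma_Algebra.measure (path_measure Mh \<sigma>h) (reach Mh (Bot ` {I. I \<subseteq> {1..k} \<and> i \<notin> I})))"
proof -
  obtain \<sigma> where \<sigma>: "scheduler M \<sigma>" and pm: "path_measure M \<sigma> = distr NN.\<mu> (path_space M) W"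
    using ex_projected_scheduler by blast
  interpret S: scheduled M \<sigma> using M \<sigma> by unfold_locales
  have sets: "sets S.\<mu> = sets (path_space M)" by (simp add: pm)
  interpret O: observed M k P \<sigma> NN.\<mu> W committed
  proof unfold_locales
    show "W \<in> NN.\<mu> \<rightarrow>\<^sub>M S.\<mu>"
      using W_measurable measurable_cong_sets[OF refl sets] by blast
    show "distr NN.\<mu> S.\<mu> W = S.\<mu>"
      using distr_cong[OF refl sets, of NN.\<mu> W W] pm by simp
    show "committed \<in> NN.\<mu> \<rightarrow>\<^sub>M count_space UNIV" by (rule committed_measurable)
  qed
  interpret coupled M k P \<sigma> NN.\<mu> W committed \<sigma>h
  proof unfold_locales
    show "AE \<omega> in NN.\<mu>. committed \<omega> \<subseteq> {1..k}" by (auto simp: committed_def)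
    fix hh q m
    have eq: "AE \<omega> in NN.\<mu>. chosen hh q m \<omega> \<longleftrightarrow> labelled M hh q m (W \<omega>) (committed \<omega>)"
      using AE_next_label_mode by eventually_elim (rule chosen_iff_labelled)
    have "Measurable.pred NN.\<mu> (\<lambda>\<omega>. chosen hh q m \<omega>)"
      unfolding chosen_def
    proof (rule pred_intros_countable)
      fix n
      have "Measurable.pred NN.\<mu> (\<lambda>\<omega>. mode_of (\<omega> n) = m)"
        "Measurable.pred NN.\<mu> (\<lambda>\<omega>. cls M (fst (\<omega> n)) = q)"
        by (rule NN.pred_coordinate)+
      then show "Measurable.pred NN.\<mu> (\<lambda>\<omega>. exited M hh (W \<omega>) n \<and> cls M (fst (\<omega> n)) = q \<and> mode_of (\<omega> n) = m)"
        using O.pred_exited by (intro pred_intros_logic)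
    qed
    then have "\<P>(\<omega> in NN.\<mu>. chosen hh q m \<omega>) = \<P>(\<omega> in NN.\<mu>. labelled M hh q m (W \<omega>) (committed \<omega>))"
      using eq O.pred_labelled by (intro NN.prob_eq_AE) (simp_all add: pred_def)
    then show "\<P>(\<omega> in NN.\<mu>. labelled M hh q m (W \<omega>) (committed \<omega>)) =
        \<P>(\<omega> in NN.\<mu>. entered M hh q (W \<omega>)) * pmf (\<sigma>h hh q) m"
      using prob_chosen by simp
  qed
  have sat: "AE \<omega> in NN.\<mu>. \<forall>i\<in>committed \<omega>. W \<omega> \<in> rabin M (P i)"
    using AE_committed_rabin O.AE_W[OF S.AE_eventually_no_exit] by eventually_elim (rule mp)
  show ?thesis
  proof (intro exI[of _ \<sigma>] conjI ballI \<sigma>)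
    fix i assume i: "i \<in> {1..k}"
    have rabin: "rabin M (P i) \<in> sets S.\<mu>" by (rule S.rabin_measurable[OF finite_P[OF i]])
    have rabin_eq: "{\<omega> \<in> space S.\<mu>. \<omega> \<in> rabin M (P i)} = rabin M (P i)"
      using sets.sets_into_space[OF rabin] by blast
    then have pred: "Measurable.pred S.\<mu> (\<lambda>\<omega>. \<omega> \<in> rabin M (P i))"
      using rabin by (simp add: pred_def)
    have predW: "Measurable.pred NN.\<mu> (\<lambda>\<omega>. W \<omega> \<in> rabin M (P i))"
      by (rule measurable_compose[OF O.W_measurable pred])
    have pr: "S.prob (rabin M (P i)) = \<P>(\<omega> in NN.\<mu>. W \<omega> \<in> rabin M (P i))"
      using O.prob_W[OF pred] rabin_eq by simp
    have "\<P>(\<omega> in NN.\<mu>. committed \<omega> \<in> {I. I \<subseteq> {1..k} \<and> i \<in> I}) \<le> \<P>(\<omega> in NN.\<mu>. W \<omega> \<in> rabin M (P i))"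
    proof (rule NN.finite_measure_mono_AE)
      show "AE \<omega> in NN.\<mu>. \<omega> \<in> {\<omega> \<in> space NN.\<mu>. committed \<omega> \<in> {I. I \<subseteq> {1..k} \<and> i \<in> I}} \<longrightarrow>
          \<omega> \<in> {\<omega> \<in> space NN.\<mu>. W \<omega> \<in> rabin M (P i)}"
        using sat by eventually_elim simp
      show "{\<omega> \<in> space NN.\<mu>. W \<omega> \<in> rabin M (P i)} \<in> NN.events"
        using predW by (simp add: pred_def)
    qed
    then show "Sigma_Algebra.measure (path_measure Mh \<sigma>h) (reach Mh (Bot ` {I. I \<subseteq> {1..k} \<and> i \<in> I})) \<le>
        Sigma_Algebra.measure (path_measure M \<sigma>) (rabin M (P i))"
      by (simp only: prob_reach pr)
    have "\<P>(\<omega> in NN.\<mu>. W \<omega> \<notin> rabin M (P i)) \<le> \<P>(\<omega> in NN.\<mu>. committed \<omega> \<in> {I. I \<subseteq> {1..k} \<and> i \<notin> I})"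
    proof (rule NN.finite_measure_mono_AE)
      show "AE \<omega> in NN.\<mu>. \<omega> \<in> {\<omega> \<in> space NN.\<mu>. W \<omega> \<notin> rabin M (P i)} \<longrightarrow>
          \<omega> \<in> {\<omega> \<in> space NN.\<mu>. committed \<omega> \<in> {I. I \<subseteq> {1..k} \<and> i \<notin> I}}"
        using sat by eventually_elim (auto simp: committed_def)
      show "{\<omega> \<in> space NN.\<mu>. committed \<omega> \<in> {I. I \<subseteq> {1..k} \<and> i \<notin> I}} \<in> NN.events"
        using O.pred_J[of "\<lambda>J. J \<in> {I. I \<subseteq> {1..k} \<and> i \<notin> I}"] by (simp add: pred_def)
    qed
    moreover have "S.prob (streett M (P i)) = \<P>(\<omega> in NN.\<mu>. W \<omega> \<notin> rabin M (P i))"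
      unfolding S.prob_streett[OF finite_P[OF i]]
      by (rule O.prob_W[symmetric]) (rule pred_intros_logic(2)[OF pred])
    ultimately show "Sigma_Algebra.measure (path_measure M \<sigma>) (streett M (P i)) \<le>
        Sigma_Algebra.measure (path_measure Mh \<sigma>h) (reach Mh (Bot ` {I. I \<subseteq> {1..k} \<and> i \<notin> I}))"
      by (simp only: prob_reach)
  qed
qed

end

section \<open>The two equivalences\<close>

theorem theorem1:
  fixes M :: "('s, 'a) mdp"
    and k :: nat
    and P :: "nat \<Rightarrow> ('s set \<times> 's set) set"
    and lam :: "nat \<Rightarrow> real"
    and cmp :: "real \<Rightarrow> real \<Rightarrow> bool"
  defines "Mhat \<equiv> mec_quotient M k P"
    and "G \<equiv> \<lambda>i. Bot ` {I. I \<subseteq> {1..k} \<and> i \<in> I}"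
    and "Gbar \<equiv> \<lambda>i. Bot ` {I. I \<subseteq> {1..k} \<and> i \<notin> I}"
  assumes "mdp M" and "disjoint_actions M"
    and "\<forall>i \<in> {1..k}. P i \<subseteq> Pow (states M) \<times> Pow (states M)"
    and "\<forall>i \<in> {1..k}. 0 \<le> lam i \<and> lam i \<le> 1"
    and "cmp \<in> {(\<ge>), (>)}"
  shows "(sat_exists_conj M cmp k lam (\<lambda>i. rabin M (P i)) \<longleftrightarrow>
          sat_exists_conj Mhat cmp k lam (\<lambda>i. reach Mhat (G i))) \<and>
         (sat_forall_disj M cmp k lam (\<lambda>i. streett M (P i)) \<longleftrightarrow>
          sat_forall_disj Mhat cmp k lam (\<lambda>i. reach Mhat (Gbar i)))"
proof -
  interpret R: rabin_mdp M k P
    using assms by unfold_locales auto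
  have cmp: "cmp y l" if "cmp x l" "x \<le> y" for x y l
    using that assms(8) by auto
  \<comment> \<open>The label here is exactly the set of satisfied properties, and so equality holds
    for \<open>G i\<close> and \<open>Gbar i\<close> alike.\<close>
  have fwd: "\<exists>\<sigma>h. scheduler Mhat \<sigma>h \<and> (\<forall>i\<in>{1..k}.
      Sigma_Algebra.measure (path_measure Mhat \<sigma>h) (reach Mhat (G i)) =
        Sigma_Algebra.measure (path_measure M \<sigma>) (rabin M (P i)) \<and>
      Sigma_Algebra.measure (path_measure Mhat \<sigma>h) (reach Mhat (Gbar i)) =
        Sigma_Algebra.measure (path_measure M \<sigma>) (streett M (P i)))" if \<sigma>: "scheduler M \<sigma>" for \<sigma>
  proof -
    interpret S: scheduled M \<sigma> using assms(4) \<sigma> by unfold_locales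
    obtain \<sigma>h where \<sigma>h: "scheduler Mhat \<sigma>h" and reach: "\<And>U. Sigma_Algebra.measure (path_measure Mhat \<sigma>h) (reach Mhat (Bot ` U)) =
        \<P>(\<omega> in S.\<mu>. {i \<in> {1..k}. \<omega> \<in> rabin M (P i)} \<in> U)"
      using R.ex_quotient_scheduler[OF \<sigma>] unfolding Mhat_def by blast
    show ?thesis
    proof (intro exI[of _ \<sigma>h] conjI ballI \<sigma>h)
      fix i assume i: "i \<in> {1..k}"
      have "{\<omega> \<in> space S.\<mu>. {i \<in> {1..k}. \<omega> \<in> rabin M (P i)} \<in> {I. I \<subseteq> {1..k} \<and> i \<in> I}} = rabin M (P i)"
        using i sets.sets_into_space[OF S.rabin_measurable[OF R.finite_P[OF i]]] by auto
      then show "Sigma_Algebra.measure (path_measure Mhat \<sigma>h) (reach Mhat (G i)) =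
          Sigma_Algebra.measure (path_measure M \<sigma>) (rabin M (P i))"
        unfolding G_def reach by simp
      have "{\<omega> \<in> space S.\<mu>. {i \<in> {1..k}. \<omega> \<in> rabin M (P i)} \<in> {I. I \<subseteq> {1..k} \<and> i \<notin> I}} =
          {\<omega> \<in> space S.\<mu>. \<omega> \<notin> rabin M (P i)}"
        using i by auto
      then show "Sigma_Algebra.measure (path_measure Mhat \<sigma>h) (reach Mhat (Gbar i)) =
          Sigma_Algebra.measure (path_measure M \<sigma>) (streett M (P i))"
        unfolding Gbar_def reach S.prob_streett[OF R.finite_P[OF i]] by simp
    qed
  qed
  have bwd: "\<exists>\<sigma>. scheduler M \<sigma> \<and> (\<forall>i\<in>{1..k}.
      Sigma_Algebra.measure (path_measure Mhat \<sigma>h) (reach Mhat (G i)) \<le>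
        Sigma_Algebra.measure (path_measure M \<sigma>) (rabin M (P i)) \<and>
      Sigma_Algebra.measure (path_measure M \<sigma>) (streett M (P i)) \<le>
        Sigma_Algebra.measure (path_measure Mhat \<sigma>h) (reach Mhat (Gbar i)))" if \<sigma>h: "scheduler Mhat \<sigma>h" for \<sigma>h
  proof -
    interpret U: unfolding_quotient M k P \<sigma>h
      using \<sigma>h mdp_mec_quotient[OF assms(4)] unfolding Mhat_def by unfold_locales
    show ?thesis
      using U.ex_scheduler_dominating unfolding Mhat_def G_def Gbar_def .
  qed
  show ?thesis
  proof (intro conjI iffI)
    assume "sat_exists_conj M cmp k lam (\<lambda>i. rabin M (P i))"
    then obtain \<sigma> where \<sigma>: "scheduler M \<sigma>"
      "\<forall>i\<in>{1..k}. cmp (Sigma_Algebra.measure (path_measure M \<sigma>) (rabin M (P i))) (lam i)"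
      unfolding sat_exists_conj_def by blast
    obtain \<sigma>h where "scheduler Mhat \<sigma>h" "\<forall>i\<in>{1..k}.
      Sigma_Algebra.measure (path_measure Mhat \<sigma>h) (reach Mhat (G i)) =
        Sigma_Algebra.measure (path_measure M \<sigma>) (rabin M (P i))"
      using fwd[OF \<sigma>(1)] by blast
    then show "sat_exists_conj Mhat cmp k lam (\<lambda>i. reach Mhat (G i))"
      unfolding sat_exists_conj_def using \<sigma>(2) by (intro exI[of _ \<sigma>h]) simp
  next
    assume "sat_exists_conj Mhat cmp k lam (\<lambda>i. reach Mhat (G i))"
    then obtain \<sigma>h where \<sigma>h: "scheduler Mhat \<sigma>h"
      "\<forall>i\<in>{1..k}. cmp (Sigma_Algebra.measure (path_measure Mhat \<sigma>h) (reach Mhat (G i))) (lam i)"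
      unfolding sat_exists_conj_def by blast
    obtain \<sigma> where "scheduler M \<sigma>" "\<forall>i\<in>{1..k}.
      Sigma_Algebra.measure (path_measure Mhat \<sigma>h) (reach Mhat (G i)) \<le>
        Sigma_Algebra.measure (path_measure M \<sigma>) (rabin M (P i))"
      using bwd[OF \<sigma>h(1)] by blast
    then show "sat_exists_conj M cmp k lam (\<lambda>i. rabin M (P i))"
      unfolding sat_exists_conj_def using \<sigma>h(2) cmp by (intro exI[of _ \<sigma>]) blast
  next
    \<comment> \<open>A quotient scheduler is judged by the scheduler of \<open>M\<close> it
      induces: the Streett probability of the latter is a lower bound for reaching
      \<open>Gbar i\<close>, so the index found in \<open>M\<close> serves again.\<close>
    assume all: "sat_forall_disj M cmp k lam (\<lambda>i. streett M (P i))"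
    show "sat_forall_disj Mhat cmp k lam (\<lambda>i. reach Mhat (Gbar i))"
      unfolding sat_forall_disj_def
    proof (intro allI impI)
      fix \<sigma>h assume "scheduler Mhat \<sigma>h"
      from bwd[OF this] obtain \<sigma> where \<sigma>: "scheduler M \<sigma>" "\<forall>i\<in>{1..k}.
        Sigma_Algebra.measure (path_measure M \<sigma>) (streett M (P i)) \<le>
          Sigma_Algebra.measure (path_measure Mhat \<sigma>h) (reach Mhat (Gbar i))"
        by blast
      obtain i where "i \<in> {1..k}" "cmp (Sigma_Algebra.measure (path_measure M \<sigma>) (streett M (P i))) (lam i)"
        using all \<sigma>(1) unfolding sat_forall_disj_def by blast
      then show "\<exists>i\<in>{1..k}. cmp (Sigma_Algebra.measure (path_measure Mhat \<sigma>h) (reach Mhat (Gbar i))) (lam i)"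
        using \<sigma>(2) cmp by blast
    qed
  next
    assume all: "sat_forall_disj Mhat cmp k lam (\<lambda>i. reach Mhat (Gbar i))"
    show "sat_forall_disj M cmp k lam (\<lambda>i. streett M (P i))"
      unfolding sat_forall_disj_def
    proof (intro allI impI)
      fix \<sigma> assume "scheduler M \<sigma>"
      from fwd[OF this] obtain \<sigma>h where \<sigma>h: "scheduler Mhat \<sigma>h" "\<forall>i\<in>{1..k}.
        Sigma_Algebra.measure (path_measure Mhat \<sigma>h) (reach Mhat (Gbar i)) =
          Sigma_Algebra.measure (path_measure M \<sigma>) (streett M (P i))"
        by blast
      obtain i where "i \<in> {1..k}" "cmp (Sigma_Algebra.measure (path_measure Mhat \<sigma>h) (reach Mhat (Gbar i))) (lam i)"
        using all \<sigma>h(1) unfolding sat_forall_disj_def by blast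
      then show "\<exists>i\<in>{1..k}. cmp (Sigma_Algebra.measure (path_measure M \<sigma>) (streett M (P i))) (lam i)"
        using \<sigma>h(2) by (intro bexI[of _ i]) simp_all
    qed
  qed
qed

end
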